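(* Let $k$ be a field of characteristic $0$ and $\mathscr{C}=\mathrm{FA}$. Let $n\geq1$ and let $e_{\mathrm{sgn}}\in kG_n$ be the idempotent corresponding to the sign representation of $G_n=S_n$. Then $\Delta_{n,\mathrm{sgn}}\cong k\mathscr{C}e_{\mathrm{sgn}}$ as $\mathscr{C}$-modules. Furthermore, if $m\geq 1$ and $\lambda\in\mathrm{Irr}(G_m)$ is regular, then $$\mathrm{Hom}_{k\mathscr{C}}(P^c_{m,\lambda},\,\Delta_{n,\mathrm{sgn}})=0.$$
   Context: $\mathrm{FA}$ is the category with objects $[n]=\{1,\dots,n\}$, $n\in\mathbb{Z}_+=\{1,2,\dots\}$, and morphisms all maps of sets; $G_n=S_n$ is the automorphism group of $[n]$, and $\mathrm{Irr}(G_n)$ a complete set of non-isomorphic irreducible $kG_n$-modules. A $\mathscr{C}$-module is a covariant functor $\mathscr{C}\to k\text{-}\mathrm{Mod}$. The standard module $\Delta_n$ is the quotient of $k\mathscr{C}(n,-)$ by the submodule spanned by all non-injective maps with source $[n]$; for $\lambda\in\mathrm{Irr}(G_n)$, $\Delta_{n,\lambda}=\Delta_n\otimes_{kG_n}kG_ne_\lambda$, where $e_\lambda\in kG_n$ is a primitive idempotent with $kG_ne_\lambda\cong\lambda$. $k\mathscr{C}e_{\mathrm{sgn}}=\{x e_{\mathrm{sgn}}:x\in k\mathscr{C}(n,-)\}$ is the (projective) direct summand of $k\mathscr{C}(n,-)$ generated by $e_{\mathrm{sgn}}$. $P^c_{m,\lambda}$ is the projective cover of $\Delta_{m,\lambda}$.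 A representation $\lambda\in\mathrm{Irr}(G_m)$ is singular if there is a nonzero homomorphism $\Delta_{m+1}\to\Delta_{m,\lambda}$ and regular otherwise; for $\mathrm{FA}$ the singular ones are exactly the sign representations. *)

theory Defs
  imports
    "HOL-Algebra.Algebraic_Closure_Type"
    "HOL-Algebra.Coset"
    "HOL-Algebra.AbelCoset"
    "HOL-Algebra.Module"
    "HOL-Combinatorics.Permutations"
    "HOL-Library.FuncSet"
    "HOL-Library.Poly_Mapping"
begin

text \<open>
  The ground field is a type \<open>'k::field_char_0\<close>, viewed as the ring record
  \<open>ring_of_type_algebra\<close>.  All \<open>k\<close>-modules are \<open>module\<close> records of HOL-Algebra; the ring
  multiplication and unit which such a record also contains are irrelevant and left
  undefined where a record is built below.
\<close>

abbreviation ground :: "'k::field_char_0 ring" where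
  "ground \<equiv> ring_of_type_algebra"


section \<open>Modules\<close>

text \<open>The library locale \<open>module\<close> requires a commutative base ring, which group algebras are not.\<close>

locale left_module = R?: ring R + M?: abelian_group M
  for R :: "('a, 'c) ring_scheme" (structure) and M :: "('a, 'b) module" (structure) +
  assumes smult_closed:
      "\<lbrakk>a \<in> carrier R; x \<in> carrier M\<rbrakk> \<Longrightarrow> a \<odot>\<^bsub>M\<^esub> x \<in> carrier M"
    and smult_l_distr:
      "\<lbrakk>a \<in> carrier R; b \<in> carrier R; x \<in> carrier M\<rbrakk> \<Longrightarrow>
        (a \<oplus>\<^bsub>R\<^esub> b) \<odot>\<^bsub>M\<^esub> x = a \<odot>\<^bsub>M\<^esub> x \<oplus>\<^bsub>M\<^esub> b \<odot>\<^bsub>M\<^esub> x"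
    and smult_r_distr:
      "\<lbrakk>a \<in> carrier R; x \<in> carrier M; y \<in> carrier M\<rbrakk> \<Longrightarrow>
        a \<odot>\<^bsub>M\<^esub> (x \<oplus>\<^bsub>M\<^esub> y) = a \<odot>\<^bsub>M\<^esub> x \<oplus>\<^bsub>M\<^esub> a \<odot>\<^bsub>M\<^esub> y"
    and smult_assoc1:
      "\<lbrakk>a \<in> carrier R; b \<in> carrier R; x \<in> carrier M\<rbrakk> \<Longrightarrow>
        (a \<otimes>\<^bsub>R\<^esub> b) \<odot>\<^bsub>M\<^esub> x = a \<odot>\<^bsub>M\<^esub> (b \<odot>\<^bsub>M\<^esub> x)"
    and smult_one: "x \<in> carrier M \<Longrightarrow> \<one>\<^bsub>R\<^esub> \<odot>\<^bsub>M\<^esub> x = x"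

definition linear_maps ::
    "('a, 'c) ring_scheme \<Rightarrow> ('a, 'v) module \<Rightarrow> ('a, 'w) module \<Rightarrow> ('v \<Rightarrow> 'w) set" where
  "linear_maps R M N =
    {h \<in> carrier M \<rightarrow> carrier N.
      (\<forall>x\<in>carrier M. \<forall>y\<in>carrier M. h (x \<oplus>\<^bsub>M\<^esub> y) = h x \<oplus>\<^bsub>N\<^esub> h y) \<and>
      (\<forall>a\<in>carrier R. \<forall>x\<in>carrier M. h (a \<odot>\<^bsub>M\<^esub> x) = a \<odot>\<^bsub>N\<^esub> h x)}"

definition module_isomorphic ::
    "('a, 'c) ring_scheme \<Rightarrow> ('a, 'v) module \<Rightarrow> ('a, 'w) module \<Rightarrow> bool" where
  "module_isomorphic R M N \<longleftrightarrow>
    (\<exists>h\<in>linear_maps R M N. bij_betw h (carrier M) (carrier N))"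

definition irreducible_module :: "('a, 'c) ring_scheme \<Rightarrow> ('a, 'v) module \<Rightarrow> bool" where
  "irreducible_module R M \<longleftrightarrow>
    left_module R M \<and> carrier M \<noteq> {\<zero>\<^bsub>M\<^esub>} \<and>
    (\<forall>U. submodule U R M \<longrightarrow> U = {\<zero>\<^bsub>M\<^esub>} \<or> U = carrier M)"

definition primitive_idempotent :: "('a, 'c) ring_scheme \<Rightarrow> 'a \<Rightarrow> bool" where
  "primitive_idempotent R e \<longleftrightarrow>
    e \<in> carrier R \<and> e \<otimes>\<^bsub>R\<^esub> e = e \<and> e \<noteq> \<zero>\<^bsub>R\<^esub> \<and>
    (\<forall>f\<in>carrier R. \<forall>g\<in>carrier R.
      f \<otimes>\<^bsub>R\<^esub> f = f \<and> g \<otimes>\<^bsub>R\<^esub> g = g \<and> f \<otimes>\<^bsub>R\<^esub> g = \<zero>\<^bsub>R\<^esub> \<and> g \<otimes>\<^bsub>R\<^esub> f = \<zero>\<^bsub>R\<^esub> \<and>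
      e = f \<oplus>\<^bsub>R\<^esub> g \<longrightarrow> f = \<zero>\<^bsub>R\<^esub> \<or> g = \<zero>\<^bsub>R\<^esub>)"

definition span_in :: "('a, 'c) ring_scheme \<Rightarrow> ('a, 'v) module \<Rightarrow> 'v set \<Rightarrow> 'v set" where
  "span_in R M S = \<Inter>{U. submodule U R M \<and> S \<subseteq> U}"

text \<open>The map from a quotient to \<open>N / W\<close> which \<open>h\<close> induces; its arguments are cosets.\<close>

definition quot_map :: "('a, 'w) module \<Rightarrow> 'w set \<Rightarrow> ('v \<Rightarrow> 'w) \<Rightarrow> 'v set \<Rightarrow> 'w set" where
  "quot_map N W h C = (\<Union>x\<in>C. W +>\<^bsub>N\<^esub> h x)"

definition quot_module :: "('a, 'v) module \<Rightarrow> 'v set \<Rightarrow> ('a, 'v set) module" where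
  "quot_module M U =
    \<lparr>carrier = a_rcosets\<^bsub>M\<^esub> U, monoid.mult = undefined, one = undefined,
     zero = U, add = set_add M, module.smult = (\<lambda>c. quot_map M U (module.smult M c))\<rparr>"

text \<open>The free \<open>k\<close>-module on \<open>S\<close>: formal finite linear combinations of elements of \<open>S\<close>.\<close>

definition free_module :: "'s set \<Rightarrow> ('k::field_char_0, 's \<Rightarrow>\<^sub>0 'k) module" where
  "free_module S =
    \<lparr>carrier = {a. Poly_Mapping.keys a \<subseteq> S}, monoid.mult = undefined, one = undefined,
     zero = 0, add = (+), module.smult = (\<lambda>c. Poly_Mapping.map ((*) c))\<rparr>"

definition push :: "('s \<Rightarrow> 't) \<Rightarrow> ('s \<Rightarrow>\<^sub>0 'k::field_char_0) \<Rightarrow> ('t \<Rightarrow>\<^sub>0 'k)" where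
  "push h a = (\<Sum>s\<in>Poly_Mapping.keys a. Poly_Mapping.single (h s) (Poly_Mapping.lookup a s))"

text \<open>
  \<open>M \<otimes>\<^sub>A N\<close> for a \<open>k\<close>-algebra \<open>A\<close>, a right \<open>A\<close>-module \<open>M\<close> (a \<open>k\<close>-module with
  right action \<open>r\<close>) and a left \<open>A\<close>-module \<open>N\<close>, as the quotient of the free \<open>k\<close>-module on
  pairs by the bilinearity and balancing relations.  That \<open>k\<close> can also be moved to the right
  factor is the last relation for the scalars in \<open>A\<close>.
\<close>

definition tensor_relations ::
    "('a, 'c) ring_scheme \<Rightarrow> ('k, 'x) module \<Rightarrow> ('x \<Rightarrow> 'a \<Rightarrow> 'x) \<Rightarrow> ('a, 'y) module \<Rightarrow>
      ('x \<times> 'y \<Rightarrow>\<^sub>0 'k::field_char_0) set" where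
  "tensor_relations A M r N =
    {Poly_Mapping.single (x \<oplus>\<^bsub>M\<^esub> x', y) 1 - Poly_Mapping.single (x, y) 1
        - Poly_Mapping.single (x', y) 1 |
      x x' y. x \<in> carrier M \<and> x' \<in> carrier M \<and> y \<in> carrier N} \<union>
    {Poly_Mapping.single (x, y \<oplus>\<^bsub>N\<^esub> y') 1 - Poly_Mapping.single (x, y) 1
        - Poly_Mapping.single (x, y') 1 |
      x y y'. x \<in> carrier M \<and> y \<in> carrier N \<and> y' \<in> carrier N} \<union>
    {Poly_Mapping.single (c \<odot>\<^bsub>M\<^esub> x, y) 1 - Poly_Mapping.single (x, y) c |
      c x y. x \<in> carrier M \<and> y \<in> carrier N} \<union>
    {Poly_Mapping.single (r x a, y) 1 - Poly_Mapping.single (x, a \<odot>\<^bsub>N\<^esub> y) 1 |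
      x a y. x \<in> carrier M \<and> a \<in> carrier A \<and> y \<in> carrier N}"

definition tensor_null ::
    "('a, 'c) ring_scheme \<Rightarrow> ('k, 'x) module \<Rightarrow> ('x \<Rightarrow> 'a \<Rightarrow> 'x) \<Rightarrow> ('a, 'y) module \<Rightarrow>
      ('x \<times> 'y \<Rightarrow>\<^sub>0 'k::field_char_0) set" where
  "tensor_null A M r N =
    span_in ground (free_module (carrier M \<times> carrier N)) (tensor_relations A M r N)"

definition tensor ::
    "('a, 'c) ring_scheme \<Rightarrow> ('k, 'x) module \<Rightarrow> ('x \<Rightarrow> 'a \<Rightarrow> 'x) \<Rightarrow> ('a, 'y) module \<Rightarrow>
      ('k::field_char_0, ('x \<times> 'y \<Rightarrow>\<^sub>0 'k) set) module" where
  "tensor A M r N = quot_module (free_module (carrier M \<times> carrier N)) (tensor_null A M r N)"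


section \<open>The category FA and its linearization\<close>

text \<open>
  The object \<open>[n]\<close> is \<open>{1..n}\<close> with \<open>n \<ge> 1\<close>; a morphism is an extensional function, that is,
  it is \<open>undefined\<close> outside its source.
\<close>

definition FA_hom :: "nat \<Rightarrow> nat \<Rightarrow> (nat \<Rightarrow> nat) set" where
  "FA_hom m n = {1..m} \<rightarrow>\<^sub>E {1..n}"

definition FA_id :: "nat \<Rightarrow> nat \<Rightarrow> nat" where
  "FA_id n = restrict id {1..n}"

definition FA_aut :: "nat \<Rightarrow> (nat \<Rightarrow> nat) set" where
  "FA_aut n = {f \<in> FA_hom n n. bij_betw f {1..n} {1..n}}"

text \<open>The bilinear extension of the composition \<open>g \<circ> f\<close> of morphisms, where \<open>f\<close> has source \<open>[n]\<close>.\<close>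

definition lin_comp ::
    "nat \<Rightarrow> ((nat \<Rightarrow> nat) \<Rightarrow>\<^sub>0 'k::field_char_0) \<Rightarrow> ((nat \<Rightarrow> nat) \<Rightarrow>\<^sub>0 'k) \<Rightarrow> ((nat \<Rightarrow> nat) \<Rightarrow>\<^sub>0 'k)" where
  "lin_comp n b a =
    (\<Sum>g\<in>Poly_Mapping.keys b. \<Sum>f\<in>Poly_Mapping.keys a.
      Poly_Mapping.single (compose {1..n} g f) (Poly_Mapping.lookup b g * Poly_Mapping.lookup a f))"

definition group_algebra :: "nat \<Rightarrow> ((nat \<Rightarrow> nat) \<Rightarrow>\<^sub>0 'k::field_char_0) ring" where
  "group_algebra n =
    \<lparr>carrier = {a. Poly_Mapping.keys a \<subseteq> FA_aut n}, monoid.mult = lin_comp n,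
     one = Poly_Mapping.single (FA_id n) 1, zero = 0, add = (+)\<rparr>"

text \<open>The left module \<open>k G\<^sub>n e\<close>.\<close>

definition left_ideal ::
    "nat \<Rightarrow> ((nat \<Rightarrow> nat) \<Rightarrow>\<^sub>0 'k::field_char_0) \<Rightarrow>
      ((nat \<Rightarrow> nat) \<Rightarrow>\<^sub>0 'k, (nat \<Rightarrow> nat) \<Rightarrow>\<^sub>0 'k) module" where
  "left_ideal n e =
    \<lparr>carrier = (\<lambda>a. lin_comp n a e) ` carrier (group_algebra n), monoid.mult = undefined, one = undefined,
     zero = 0, add = (+), module.smult = lin_comp n\<rparr>"

text \<open>
  The sign representation on \<open>k\<close>.  The library function \<open>sign\<close> expects a permutation which is
  the identity (rather than undefined) outside \<open>{1..n}\<close>.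
\<close>

definition sgn_rep :: "nat \<Rightarrow> ((nat \<Rightarrow> nat) \<Rightarrow>\<^sub>0 'k::field_char_0, 'k) module" where
  "sgn_rep n =
    \<lparr>carrier = UNIV, monoid.mult = undefined, one = undefined, zero = 0, add = (+),
     module.smult = (\<lambda>a x. (\<Sum>\<sigma>\<in>Poly_Mapping.keys a.
       Poly_Mapping.lookup a \<sigma> * of_int (sign (restrict_id \<sigma> {1..n}))) * x)\<rparr>"

text \<open>\<open>e\<close> is a possible choice of \<open>e\<^sub>\<lambda>\<close> for \<open>\<lambda> = L\<close>.\<close>

definition idempotent_of ::
    "nat \<Rightarrow> ((nat \<Rightarrow> nat) \<Rightarrow>\<^sub>0 'k::field_char_0, 'l) module \<Rightarrow> ((nat \<Rightarrow> nat) \<Rightarrow>\<^sub>0 'k) \<Rightarrow> bool" where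
  "idempotent_of n L e \<longleftrightarrow>
    primitive_idempotent (group_algebra n) e \<and>
    module_isomorphic (group_algebra n) (left_ideal n e) L"


section \<open>FA-modules\<close>

text \<open>
  A covariant functor from FA to \<open>k\<close>-modules; \<open>fa_act V m n f\<close> is its value on the morphism
  \<open>f : [m] \<rightarrow> [n]\<close>.  The value \<open>fa_obj V 0\<close> is meaningless, and every condition
  below only refers to positive indices.
\<close>

record ('k, 'v) fa_functor =
  fa_obj :: "nat \<Rightarrow> ('k, 'v) module"
  fa_act :: "nat \<Rightarrow> nat \<Rightarrow> (nat \<Rightarrow> nat) \<Rightarrow> 'v \<Rightarrow> 'v"

definition fa_module :: "('k::field_char_0, 'v) fa_functor \<Rightarrow> bool" where
  "fa_module V \<longleftrightarrow>
    (\<forall>n\<ge>1. Module.module ground (fa_obj V n)) \<and>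
    (\<forall>m\<ge>1. \<forall>n\<ge>1. \<forall>f\<in>FA_hom m n. fa_act V m n f \<in> linear_maps ground (fa_obj V m) (fa_obj V n)) \<and>
    (\<forall>n\<ge>1. \<forall>x\<in>carrier (fa_obj V n). fa_act V n n (FA_id n) x = x) \<and>
    (\<forall>l\<ge>1. \<forall>m\<ge>1. \<forall>n\<ge>1. \<forall>f\<in>FA_hom l m. \<forall>g\<in>FA_hom m n. \<forall>x\<in>carrier (fa_obj V l).
      fa_act V l n (compose {1..l} g f) x = fa_act V m n g (fa_act V l m f x))"

definition fa_homs ::
    "('k::field_char_0, 'v) fa_functor \<Rightarrow> ('k, 'w) fa_functor \<Rightarrow> (nat \<Rightarrow> 'v \<Rightarrow> 'w) set" where
  "fa_homs V W =
    {\<phi>. (\<forall>n\<ge>1. \<phi> n \<in> linear_maps ground (fa_obj V n) (fa_obj W n)) \<and>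
        (\<forall>m\<ge>1. \<forall>n\<ge>1. \<forall>f\<in>FA_hom m n. \<forall>x\<in>carrier (fa_obj V m).
          \<phi> n (fa_act V m n f x) = fa_act W m n f (\<phi> m x))}"

definition fa_zero_hom ::
    "('k::field_char_0, 'v) fa_functor \<Rightarrow> ('k, 'w) fa_functor \<Rightarrow> (nat \<Rightarrow> 'v \<Rightarrow> 'w) \<Rightarrow> bool" where
  "fa_zero_hom V W \<phi> \<longleftrightarrow> (\<forall>n\<ge>1. \<forall>x\<in>carrier (fa_obj V n). \<phi> n x = \<zero>\<^bsub>fa_obj W n\<^esub>)"

definition fa_epi ::
    "('k::field_char_0, 'v) fa_functor \<Rightarrow> ('k, 'w) fa_functor \<Rightarrow> (nat \<Rightarrow> 'v \<Rightarrow> 'w) \<Rightarrow> bool" where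
  "fa_epi V W \<phi> \<longleftrightarrow>
    \<phi> \<in> fa_homs V W \<and> (\<forall>n\<ge>1. \<phi> n ` carrier (fa_obj V n) = carrier (fa_obj W n))"

definition fa_isomorphic :: "('k::field_char_0, 'v) fa_functor \<Rightarrow> ('k, 'w) fa_functor \<Rightarrow> bool" where
  "fa_isomorphic V W \<longleftrightarrow>
    (\<exists>\<phi>\<in>fa_homs V W. \<forall>n\<ge>1. bij_betw (\<phi> n) (carrier (fa_obj V n)) (carrier (fa_obj W n)))"

definition fa_submodule :: "('k::field_char_0, 'v) fa_functor \<Rightarrow> (nat \<Rightarrow> 'v set) \<Rightarrow> bool" where
  "fa_submodule V U \<longleftrightarrow>
    (\<forall>n\<ge>1. submodule (U n) ground (fa_obj V n)) \<and>
    (\<forall>m\<ge>1. \<forall>n\<ge>1. \<forall>f\<in>FA_hom m n. fa_act V m n f ` U m \<subseteq> U n)"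

definition fa_quotient ::
    "('k::field_char_0, 'v) fa_functor \<Rightarrow> (nat \<Rightarrow> 'v set) \<Rightarrow> ('k, 'v set) fa_functor" where
  "fa_quotient V U =
    \<lparr>fa_obj = (\<lambda>n. quot_module (fa_obj V n) (U n)),
     fa_act = (\<lambda>m n f. quot_map (fa_obj V n) (U n) (fa_act V m n f))\<rparr>"

text \<open>The pointwise tensor product with \<open>N\<close> of an FA-module with a right \<open>A\<close>-action \<open>r\<close>.\<close>

definition fa_tensor ::
    "('a, 'c) ring_scheme \<Rightarrow> ('k::field_char_0, 'v) fa_functor \<Rightarrow> (nat \<Rightarrow> 'v \<Rightarrow> 'a \<Rightarrow> 'v) \<Rightarrow>
      ('a, 'y) module \<Rightarrow> ('k, ('v \<times> 'y \<Rightarrow>\<^sub>0 'k) set) fa_functor" where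
  "fa_tensor A V r N =
    \<lparr>fa_obj = (\<lambda>n. tensor A (fa_obj V n) (r n) N),
     fa_act = (\<lambda>m n f.
       quot_map (free_module (carrier (fa_obj V n) \<times> carrier N)) (tensor_null A (fa_obj V n) (r n) N)
         (push (\<lambda>(x, y). (fa_act V m n f x, y))))\<rparr>"

text \<open>
  Projectivity as the lifting property.  The test modules live in one fixed type: it contains
  the free FA-module with one generator in degree \<open>l\<close> for each \<open>x \<in> P(l)\<close> (basis: the triples
  \<open>(l, x, f)\<close> with \<open>f\<close> a morphism of source \<open>[l]\<close>), which maps onto \<open>P\<close>, as well as an
  isomorphic copy of \<open>P\<close>.  Hence \<open>P\<close> is a summand of that free module, and the lifting
  property holds for test modules of any type.
\<close>

definition fa_projective :: "('k::field_char_0, 'p) fa_functor \<Rightarrow> bool" where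
  "fa_projective P \<longleftrightarrow> fa_module P \<and>
    (\<forall>(M :: ('k, nat \<times> 'p \<times> (nat \<Rightarrow> nat) \<Rightarrow>\<^sub>0 'k) fa_functor)
      (N :: ('k, nat \<times> 'p \<times> (nat \<Rightarrow> nat) \<Rightarrow>\<^sub>0 'k) fa_functor) \<epsilon> \<phi>.
      fa_module M \<and> fa_module N \<and> fa_epi M N \<epsilon> \<and> \<phi> \<in> fa_homs P N \<longrightarrow>
      (\<exists>\<psi>\<in>fa_homs P M. \<forall>n\<ge>1. \<forall>x\<in>carrier (fa_obj P n). \<epsilon> n (\<psi> n x) = \<phi> n x))"

text \<open>A projective cover is an epimorphism \<open>\<pi>\<close> from a projective module with superfluous kernel.\<close>

definition fa_projective_cover ::
    "('k::field_char_0, 'p) fa_functor \<Rightarrow> (nat \<Rightarrow> 'p \<Rightarrow> 'v) \<Rightarrow> ('k, 'v) fa_functor \<Rightarrow> bool" where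
  "fa_projective_cover P \<pi> V \<longleftrightarrow>
    fa_projective P \<and> fa_epi P V \<pi> \<and>
    (\<forall>U. fa_submodule P U \<and>
      (\<forall>n\<ge>1. set_add (fa_obj P n) (U n) {x \<in> carrier (fa_obj P n). \<pi> n x = \<zero>\<^bsub>fa_obj V n\<^esub>}
        = carrier (fa_obj P n)) \<longrightarrow>
      (\<forall>n\<ge>1. U n = carrier (fa_obj P n)))"


section \<open>Standard modules\<close>

text \<open>The representable module \<open>k FA(n, -)\<close>.\<close>

definition kFA :: "nat \<Rightarrow> ('k::field_char_0, (nat \<Rightarrow> nat) \<Rightarrow>\<^sub>0 'k) fa_functor" where
  "kFA n =
    \<lparr>fa_obj = (\<lambda>m. free_module (FA_hom n m)),
     fa_act = (\<lambda>m l f. lin_comp n (Poly_Mapping.single f 1))\<rparr>"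

text \<open>Its submodule \<open>k FA e = {x e | x \<in> k FA(n, -)}\<close>, for \<open>e\<close> in \<open>k G\<^sub>n\<close>.\<close>

definition kFA_idem ::
    "nat \<Rightarrow> ((nat \<Rightarrow> nat) \<Rightarrow>\<^sub>0 'k::field_char_0) \<Rightarrow> ('k, (nat \<Rightarrow> nat) \<Rightarrow>\<^sub>0 'k) fa_functor" where
  "kFA_idem n e =
    \<lparr>fa_obj = (\<lambda>m. (fa_obj (kFA n) m)
       \<lparr>carrier := (\<lambda>x. lin_comp n x e) ` carrier (fa_obj (kFA n) m)\<rparr>),
     fa_act = fa_act (kFA n)\<rparr>"

definition noninjective :: "nat \<Rightarrow> nat \<Rightarrow> ((nat \<Rightarrow> nat) \<Rightarrow>\<^sub>0 'k::field_char_0) set" where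
  "noninjective n m =
    span_in ground (free_module (FA_hom n m))
      {Poly_Mapping.single f 1 | f. f \<in> FA_hom n m \<and> \<not> inj_on f {1..n}}"

definition standard :: "nat \<Rightarrow> ('k::field_char_0, ((nat \<Rightarrow> nat) \<Rightarrow>\<^sub>0 'k) set) fa_functor" where
  "standard n = fa_quotient (kFA n) (noninjective n)"

text \<open>The right action of \<open>k G\<^sub>n\<close> on the standard module, induced by precomposition.\<close>

definition standard_right ::
    "nat \<Rightarrow> nat \<Rightarrow> ((nat \<Rightarrow> nat) \<Rightarrow>\<^sub>0 'k::field_char_0) set \<Rightarrow> ((nat \<Rightarrow> nat) \<Rightarrow>\<^sub>0 'k) \<Rightarrow>
      ((nat \<Rightarrow> nat) \<Rightarrow>\<^sub>0 'k) set" where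
  "standard_right n m C a =
    quot_map (fa_obj (kFA n) m) (noninjective n m) (\<lambda>x. lin_comp n x a) C"

text \<open>\<open>\<Delta>\<^bsub>n,\<lambda>\<^esub>\<close>, as a function of the chosen idempotent \<open>e = e\<^sub>\<lambda>\<close>.\<close>

definition standard_irr ::
    "nat \<Rightarrow> ((nat \<Rightarrow> nat) \<Rightarrow>\<^sub>0 'k::field_char_0) \<Rightarrow>
      ('k, (((nat \<Rightarrow> nat) \<Rightarrow>\<^sub>0 'k) set \<times> ((nat \<Rightarrow> nat) \<Rightarrow>\<^sub>0 'k) \<Rightarrow>\<^sub>0 'k) set) fa_functor" where
  "standard_irr n e =
    fa_tensor (group_algebra n) (standard n) (standard_right n) (left_ideal n e)"

text \<open>Up to isomorphism \<open>\<Delta>\<^bsub>m,\<lambda>\<^esub>\<close> does not depend on the choice of \<open>e\<^sub>\<lambda>\<close>, hence neither does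
  singularity.\<close>

definition singular_rep :: "nat \<Rightarrow> ((nat \<Rightarrow> nat) \<Rightarrow>\<^sub>0 'k::field_char_0, 'l) module \<Rightarrow> bool" where
  "singular_rep m L \<longleftrightarrow>
    (\<exists>e. idempotent_of m L e \<and>
      (\<exists>\<phi>\<in>fa_homs (standard (m + 1)) (standard_irr m e).
        \<not> fa_zero_hom (standard (m + 1)) (standard_irr m e) \<phi>))"

definition regular_rep :: "nat \<Rightarrow> ((nat \<Rightarrow> nat) \<Rightarrow>\<^sub>0 'k::field_char_0, 'l) module \<Rightarrow> bool" where
  "regular_rep m L \<longleftrightarrow> \<not> singular_rep m L"

end

theory Submission
  imports Defs
begin

text \<open>
  A non-injective map \<open>f\<close> of source \<open>[n]\<close> is fixed by some transposition \<open>t\<close> of \<open>[n]\<close>, so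
  \<open>f e\<^sub>s\<^sub>g\<^sub>n = f t e\<^sub>s\<^sub>g\<^sub>n = - f e\<^sub>s\<^sub>g\<^sub>n\<close> vanishes.  Hence \<open>(z + U) \<otimes> e\<^sub>s\<^sub>g\<^sub>n \<mapsto> z e\<^sub>s\<^sub>g\<^sub>n\<close> is well
  defined on \<open>\<Delta>\<^bsub>n,sgn\<^esub>\<close>, and it is an isomorphism onto \<open>k FA e\<^sub>s\<^sub>g\<^sub>n\<close>.

  The modules \<open>k FA e\<^sub>s\<^sub>g\<^sub>n\<close> are the exterior powers of the permutation modules.  Restriction along the inclusions
  \<open>[n - 1] \<rightarrow> [n]\<close> makes them into an exact Koszul complex.  Let \<open>D\<^sub>q\<close> be the image of the differential out of the
  \<open>q\<close>-th exterior power: it vanishes below degree \<open>q\<close>, it is generated by its value in degree \<open>q\<close>, which is the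
  sign representation, and every nonzero element of \<open>D\<^sub>q\<close> has a nonzero image in degree \<open>q\<close>.  A nonzero homomorphism
  \<open>P \<rightarrow> \<Delta>\<^bsub>n,sgn\<^esub>\<close> from the projective cover of \<open>\<Delta>\<^bsub>m,\<lambda>\<^esub>\<close> yields a nonzero \<open>\<phi> : P \<rightarrow> D\<^sub>q\<close> with \<open>q = n\<close>, by composition
  with the differential, or \<open>q = n + 1\<close>, by exactness.  Unless \<open>m = q\<close> and \<open>\<lambda>\<close> is the sign representation,
  \<open>ker \<phi> + ker \<pi> = P\<close> by the properties of \<open>D\<^sub>q\<close>, which contradicts the superfluousness of \<open>ker \<pi>\<close>.  But the sign
  representation is singular, because \<open>\<Delta>\<^bsub>m+1\<^esub>\<close> maps onto \<open>D\<^bsub>m+1\<^esub> \<subseteq> \<Delta>\<^bsub>m,sgn\<^esub>\<close>.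
\<close>

section \<open>Linear extension of maps of bases\<close>

text \<open>Intervals \<open>{1..n}\<close> and conditions such as \<open>x \<ge> 1\<close> keep the
  form in which the definitions state them.\<close>

declare One_nat_def [simp del]

section \<open>Scalar multiples and supports of finite linear combinations\<close>

abbreviation pscale :: "'k::field_char_0 \<Rightarrow> ('s \<Rightarrow>\<^sub>0 'k) \<Rightarrow> ('s \<Rightarrow>\<^sub>0 'k)" (infixr "*\<^sub>p" 75) where
  "c *\<^sub>p a \<equiv> Poly_Mapping.map ((*) c) a"

lemma lookup_pscale [simp]: "Poly_Mapping.lookup (c *\<^sub>p a) s = c * Poly_Mapping.lookup a s"
  by (simp add: Poly_Mapping.map.rep_eq when_def)

lemma pscale_simps [simp]:
  "c *\<^sub>p (0 :: 's \<Rightarrow>\<^sub>0 'k::field_char_0) = 0" "0 *\<^sub>p a = 0" "1 *\<^sub>p a = a"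
  "c *\<^sub>p (d *\<^sub>p a) = (c * d) *\<^sub>p a"
  "c *\<^sub>p Poly_Mapping.single s d = Poly_Mapping.single s (c * d)"
  for a :: "'s \<Rightarrow>\<^sub>0 'k::field_char_0"
  by (rule poly_mapping_eqI; simp add: lookup_single when_def)+

lemma pscale_add: "c *\<^sub>p (a + b) = c *\<^sub>p a + c *\<^sub>p b"
  and pscale_add_left: "(c + d) *\<^sub>p a = c *\<^sub>p a + d *\<^sub>p a"
  and pscale_diff: "c *\<^sub>p (a - b) = c *\<^sub>p a - c *\<^sub>p b"
  and pscale_minus_left: "(- c) *\<^sub>p a = - (c *\<^sub>p a)"
  and pscale_minus_one: "(- 1) *\<^sub>p a = - a"
  by (rule poly_mapping_eqI; simp add: lookup_add lookup_minus algebra_simps)+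

lemma pscale_sum: "c *\<^sub>p (\<Sum>i\<in>I. f i) = (\<Sum>i\<in>I. c *\<^sub>p f i)"
  by (rule poly_mapping_eqI) (simp add: lookup_sum sum_distrib_left)

lemma pscale_eq_0_iff [simp]: "c *\<^sub>p a = 0 \<longleftrightarrow> c = 0 \<or> a = 0"
proof
  assume *: "c *\<^sub>p a = 0"
  have "a = 0" if "c \<noteq> 0"
  proof (rule poly_mapping_eqI)
    fix s
    show "Poly_Mapping.lookup a s = Poly_Mapping.lookup 0 s"
      using arg_cong[OF *, of "\<lambda>b. Poly_Mapping.lookup b s"] that by simp
  qed
  then show "c = 0 \<or> a = 0" by blast
qed auto

text \<open>In characteristic 0 the scalar \<open>1 + 1\<close> is nonzero. This is what later turns
  a change of sign into vanishing.\<close>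

lemma eq_minus_self_iff: "a = - a \<longleftrightarrow> a = 0" for a :: "'s \<Rightarrow>\<^sub>0 'k::field_char_0"
proof
  assume "a = - a"
  then have "(1 + 1) *\<^sub>p a = 0"
    unfolding pscale_add_left by (simp add: eq_neg_iff_add_eq_0)
  then show "a = 0" by simp
qed simp

lemma keys_pscale: "Poly_Mapping.keys (c *\<^sub>p a) \<subseteq> Poly_Mapping.keys a"
  by (auto simp: in_keys_iff)

lemma keys_sum_subset:
  "Poly_Mapping.keys (\<Sum>i\<in>I. f i) \<subseteq> (\<Union>i\<in>I. Poly_Mapping.keys (f i))"
proof (induction I rule: infinite_finite_induct)
  case (insert i I)
  then show ?case
    using Poly_Mapping.keys_add[of "f i" "sum f I"] by auto
qed auto

lemma pm_decompose:
  "a = (\<Sum>s\<in>Poly_Mapping.keys a. Poly_Mapping.single s (Poly_Mapping.lookup a s))"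
  by (rule poly_mapping_eqI)
    (simp add: lookup_sum lookup_single when_def sum.delta in_keys_iff)

text \<open>Reduces a linear claim to basis elements; the arbitrary coefficient in the case
  \<open>single\<close> takes care of scalar multiples.\<close>

lemma keys_induct [consumes 1, case_names zero single add]:
  fixes a :: "'s \<Rightarrow>\<^sub>0 'k::field_char_0"
  assumes keys: "Poly_Mapping.keys a \<subseteq> S"
    and zero: "P 0"
    and single: "\<And>s c. s \<in> S \<Longrightarrow> P (Poly_Mapping.single s c)"
    and add: "\<And>a b. P a \<Longrightarrow> P b \<Longrightarrow> P (a + b)"
  shows "P a"
proof -
  have "P (\<Sum>s\<in>I. Poly_Mapping.single s (Poly_Mapping.lookup a s))" if "finite I" "I \<subseteq> S" for I
    using that by (induction I rule: finite_induct) (auto intro: zero single add)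
  then show ?thesis
    using pm_decompose[of a] keys by (metis finite_keys)
qed

text \<open>Both \<open>push\<close> and \<open>lin_comp\<close> are rewritten in terms of this
  extension, so that linearity is proved only once.\<close>

definition lin_ext :: "('s \<Rightarrow> ('t \<Rightarrow>\<^sub>0 'k::field_char_0)) \<Rightarrow> ('s \<Rightarrow>\<^sub>0 'k) \<Rightarrow> ('t \<Rightarrow>\<^sub>0 'k)" where
  "lin_ext F a = (\<Sum>s\<in>Poly_Mapping.keys a. Poly_Mapping.lookup a s *\<^sub>p F s)"

text \<open>Terms may cancel in \<open>a + b\<close>, so its support can be smaller than the union;
  sums over a common superset remain comparable.\<close>

lemma lin_ext_superset:
  assumes "finite A" "Poly_Mapping.keys a \<subseteq> A"
  shows "lin_ext F a = (\<Sum>s\<in>A. Poly_Mapping.lookup a s *\<^sub>p F s)"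
  unfolding lin_ext_def using assms
  by (intro sum.mono_neutral_left) (auto simp: in_keys_iff)

lemma lin_ext_zero [simp]: "lin_ext F 0 = 0"
  by (simp add: lin_ext_def)

lemma lin_ext_add: "lin_ext F (a + b) = lin_ext F a + lin_ext F b"
proof -
  let ?A = "Poly_Mapping.keys a \<union> Poly_Mapping.keys b"
  have "lin_ext F c = (\<Sum>s\<in>?A. Poly_Mapping.lookup c s *\<^sub>p F s)" if "Poly_Mapping.keys c \<subseteq> ?A" for c
    using that by (intro lin_ext_superset) auto
  then show ?thesis
    using Poly_Mapping.keys_add[of a b]
    by (simp add: lookup_add pscale_add_left sum.distrib)
qed

lemma lin_ext_pscale: "lin_ext F (c *\<^sub>p a) = c *\<^sub>p lin_ext F a"
  using lin_ext_superset[OF finite_keys keys_pscale, of F c a]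
  by (simp add: lin_ext_def pscale_sum)

lemma lin_ext_minus: "lin_ext F (- a) = - lin_ext F a"
  using lin_ext_pscale[of F "- 1" a] by (simp only: pscale_minus_one)

lemma lin_ext_diff: "lin_ext F (a - b) = lin_ext F a - lin_ext F b"
  using lin_ext_add[of F a "- b"] by (simp add: lin_ext_minus)

lemma lin_ext_sum: "lin_ext F (\<Sum>i\<in>I. f i) = (\<Sum>i\<in>I. lin_ext F (f i))"
  by (induction I rule: infinite_finite_induct) (auto simp: lin_ext_add)

lemma lin_ext_single [simp]: "lin_ext F (Poly_Mapping.single s c) = c *\<^sub>p F s"
  by (cases "c = 0") (auto simp: lin_ext_def)

lemma lin_ext_cong:
  "(\<And>s. s \<in> Poly_Mapping.keys a \<Longrightarrow> F s = G s) \<Longrightarrow> lin_ext F a = lin_ext G a"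
  by (simp add: lin_ext_def)

lemma lin_ext_id [simp]: "lin_ext (\<lambda>s. Poly_Mapping.single s 1) a = a"
  using pm_decompose[of a] by (simp add: lin_ext_def)

lemma lin_ext_fun_pscale: "lin_ext (\<lambda>s. c *\<^sub>p F s) a = c *\<^sub>p lin_ext F a"
  by (simp add: lin_ext_def pscale_sum mult.commute)

lemma lin_ext_lin_ext: "lin_ext F (lin_ext G a) = lin_ext (\<lambda>s. lin_ext F (G s)) a"
  by (simp add: lin_ext_def[of G] lin_ext_def[of "\<lambda>s. lin_ext F (G s)"] lin_ext_sum lin_ext_pscale)

text \<open>Exchanging two finite sums; this is the source of the linearity of
  \<open>lin_comp\<close> in its right argument.\<close>

lemma lin_ext_swap: "lin_ext (\<lambda>s. lin_ext (F s) b) a = lin_ext (\<lambda>t. lin_ext (\<lambda>s. F s t) a) b"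
  unfolding lin_ext_def pscale_sum
  by (subst sum.swap) (simp add: mult.commute)

lemma keys_lin_ext:
  assumes "\<And>s. s \<in> Poly_Mapping.keys a \<Longrightarrow> Poly_Mapping.keys (F s) \<subseteq> S"
  shows "Poly_Mapping.keys (lin_ext F a) \<subseteq> S"
  using keys_sum_subset[of "\<lambda>s. Poly_Mapping.lookup a s *\<^sub>p F s" "Poly_Mapping.keys a"] assms
    keys_pscale by (fastforce simp: lin_ext_def)

lemma push_eq_lin_ext: "push h = lin_ext (\<lambda>s. Poly_Mapping.single (h s) 1)"
  by (rule ext) (simp add: push_def lin_ext_def)

lemma push_cong: "(\<And>s. s \<in> Poly_Mapping.keys a \<Longrightarrow> h s = g s) \<Longrightarrow> push h a = push g a"
  unfolding push_eq_lin_ext by (rule lin_ext_cong) simp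

lemma push_push: "push h (push g a) = push (\<lambda>s. h (g s)) a"
  by (simp add: push_eq_lin_ext lin_ext_lin_ext)

lemmas push_linear = lin_ext_add[of "\<lambda>s. Poly_Mapping.single (h s) 1" for h, folded push_eq_lin_ext]
  lin_ext_pscale[of "\<lambda>s. Poly_Mapping.single (h s) 1" for h, folded push_eq_lin_ext]
  lin_ext_diff[of "\<lambda>s. Poly_Mapping.single (h s) 1" for h, folded push_eq_lin_ext]

lemma push_single [simp]: "push h (Poly_Mapping.single s c) = Poly_Mapping.single (h s) c"
  by (simp add: push_eq_lin_ext)

lemma push_zero [simp]: "push h 0 = 0"
  by (simp add: push_eq_lin_ext)

section \<open>Composition of linear combinations of maps\<close>

lemma lin_comp_eq_lin_ext:
  "lin_comp n b a = lin_ext (\<lambda>g. lin_ext (\<lambda>f. Poly_Mapping.single (compose {1..n} g f) 1) a) b"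
  by (simp add: lin_comp_def lin_ext_def pscale_sum)

lemma lin_comp_left: "lin_comp n b a = lin_ext (\<lambda>g. push (compose {1..n} g) a) b"
  by (simp add: lin_comp_eq_lin_ext push_eq_lin_ext)

lemma lin_comp_right: "lin_comp n b a = lin_ext (\<lambda>f. push (\<lambda>g. compose {1..n} g f) b) a"
  by (simp add: lin_comp_eq_lin_ext push_eq_lin_ext lin_ext_swap[of _ a])

lemma lin_comp_linear_left:
  "lin_comp n (b + b') a = lin_comp n b a + lin_comp n b' a"
  "lin_comp n (b - b') a = lin_comp n b a - lin_comp n b' a"
  "lin_comp n (c *\<^sub>p b) a = c *\<^sub>p lin_comp n b a"
  "lin_comp n (- b) a = - lin_comp n b a"
  "lin_comp n (0 :: (nat \<Rightarrow> nat) \<Rightarrow>\<^sub>0 'k::field_char_0) a = 0"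
  "lin_comp n (\<Sum>i\<in>I. f i) a = (\<Sum>i\<in>I. lin_comp n (f i) a)"
  for a :: "(nat \<Rightarrow> nat) \<Rightarrow>\<^sub>0 'k::field_char_0"
  by (simp_all add: lin_comp_left lin_ext_add lin_ext_diff lin_ext_pscale lin_ext_minus lin_ext_sum)

lemma lin_comp_linear_right:
  "lin_comp n b (a + a') = lin_comp n b a + lin_comp n b a'"
  "lin_comp n b (a - a') = lin_comp n b a - lin_comp n b a'"
  "lin_comp n b (c *\<^sub>p a) = c *\<^sub>p lin_comp n b a"
  "lin_comp n b (- a) = - lin_comp n b a"
  "lin_comp n b (0 :: (nat \<Rightarrow> nat) \<Rightarrow>\<^sub>0 'k::field_char_0) = 0"
  "lin_comp n b (\<Sum>i\<in>I. f i) = (\<Sum>i\<in>I. lin_comp n b (f i))"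
  for b :: "(nat \<Rightarrow> nat) \<Rightarrow>\<^sub>0 'k::field_char_0"
  by (simp_all add: lin_comp_right lin_ext_add lin_ext_diff lin_ext_pscale lin_ext_minus lin_ext_sum)

lemma lin_comp_single_left: "lin_comp n (Poly_Mapping.single g c) a = c *\<^sub>p push (compose {1..n} g) a"
  by (simp add: lin_comp_left)

lemma lin_comp_single_right:
  "lin_comp n b (Poly_Mapping.single f c) = c *\<^sub>p push (\<lambda>g. compose {1..n} g f) b"
  by (simp add: lin_comp_right)

lemma lin_comp_single_single:
  "lin_comp n (Poly_Mapping.single g c) (Poly_Mapping.single f d)
    = Poly_Mapping.single (compose {1..n} g f) (c * d)"
  by (simp add: lin_comp_single_left)

lemma keys_lin_comp:
  assumes "\<And>g f. g \<in> Poly_Mapping.keys b \<Longrightarrow> f \<in> Poly_Mapping.keys a \<Longrightarrow> compose {1..n} g f \<in> S"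
  shows "Poly_Mapping.keys (lin_comp n b a) \<subseteq> S"
  unfolding lin_comp_eq_lin_ext by (intro keys_lin_ext) (auto intro: assms)

lemma FA_hom_compose [intro]:
  "f \<in> FA_hom l m \<Longrightarrow> g \<in> FA_hom m n \<Longrightarrow> compose {1..l} g f \<in> FA_hom l n"
  by (auto simp: FA_hom_def compose_def)

lemma FA_hom_keys_lin_comp:
  "Poly_Mapping.keys b \<subseteq> FA_hom m n \<Longrightarrow> Poly_Mapping.keys a \<subseteq> FA_hom l m
    \<Longrightarrow> Poly_Mapping.keys (lin_comp l b a) \<subseteq> FA_hom l n"
  by (intro keys_lin_comp FA_hom_compose) auto

text \<open>The map \<open>compose {1..m} h g\<close> is \<open>undefined\<close> outside
  \<open>[m]\<close>, hence the condition on the target of the rightmost maps.\<close>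

lemma lin_comp_assoc:
  assumes "Poly_Mapping.keys a \<subseteq> FA_hom l m"
  shows "lin_comp l (lin_comp m c b) a = lin_comp l c (lin_comp l b a)"
  using assms
proof (induction rule: keys_induct)
  case (single f d)
  have *: "compose {1..l} (compose {1..m} h g) f = compose {1..l} h (compose {1..l} g f)" for g h
    using single by (auto simp: FA_hom_def compose_def fun_eq_iff)
  show ?case
    by (simp add: lin_comp_left[of _ c] lin_comp_single_right push_push push_eq_lin_ext
        lin_ext_lin_ext lin_ext_fun_pscale lin_ext_pscale *)
qed (auto simp: lin_comp_linear_right)

lemma FA_id_in [simp]: "l \<le> m \<Longrightarrow> FA_id l \<in> FA_hom l m"
  by (auto simp: FA_id_def FA_hom_def)

lemma compose_FA_id_left: "f \<in> FA_hom l m \<Longrightarrow> compose {1..l} (FA_id m) f = f"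
  by (auto simp: FA_hom_def compose_def FA_id_def fun_eq_iff PiE_def extensional_def)

lemma compose_FA_id_right: "f \<in> FA_hom l m \<Longrightarrow> compose {1..l} f (FA_id l) = f"
  by (auto simp: FA_hom_def compose_def FA_id_def fun_eq_iff PiE_def extensional_def)

lemma push_ident: "(\<And>s. s \<in> Poly_Mapping.keys a \<Longrightarrow> h s = s) \<Longrightarrow> push h a = a"
  using push_cong[of a h "\<lambda>s. s"] by (simp add: push_eq_lin_ext)

lemma lin_comp_id_left:
  "Poly_Mapping.keys a \<subseteq> FA_hom l m \<Longrightarrow> lin_comp l (Poly_Mapping.single (FA_id m) 1) a = a"
  by (auto simp: lin_comp_single_left compose_FA_id_left intro!: push_ident)

lemma lin_comp_id_right:
  "Poly_Mapping.keys a \<subseteq> FA_hom l m \<Longrightarrow> lin_comp l a (Poly_Mapping.single (FA_id l) 1) = a"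
  by (auto simp: lin_comp_single_right compose_FA_id_right intro!: push_ident)

text \<open>Embeds the ground field in the group algebra, so that maps linear over
  \<open>group_algebra n\<close> are seen to respect scalars and signs.\<close>

lemma lin_comp_scalar_left:
  assumes "Poly_Mapping.keys a \<subseteq> FA_hom l m"
  shows "lin_comp l (Poly_Mapping.single (FA_id m) c) a = c *\<^sub>p a"
proof -
  have "lin_comp l (Poly_Mapping.single (FA_id m) c) a = c *\<^sub>p lin_comp l (Poly_Mapping.single (FA_id m) 1) a"
    unfolding lin_comp_single_left by (simp only: pscale_simps mult_1_right)
  then show ?thesis unfolding lin_comp_id_left[OF assms] .
qed

section \<open>The antisymmetrizer and the Koszul complex\<close>

lemma compose_restrict: "h ` A \<subseteq> B \<Longrightarrow> compose A (restrict g B) (restrict h A) = restrict (g \<circ> h) A"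
  by (auto simp: compose_def fun_eq_iff)

text \<open>Passes from automorphisms, which are \<open>undefined\<close> outside
  \<open>[n]\<close>, to library permutations, which are the identity there.\<close>

lemma FA_aut_permutes:
  assumes "f \<in> FA_aut n"
  shows "restrict_id f {1..n} permutes {1..n}" "restrict (restrict_id f {1..n}) {1..n} = f"
proof -
  from assms have "bij_betw (restrict_id f {1..n}) {1..n} {1..n}" "f \<in> extensional {1..n}"
    by (auto simp: FA_aut_def FA_hom_def restrict_id_def PiE_def intro: bij_betw_cong[THEN iffD1])
  then show "restrict_id f {1..n} permutes {1..n}" "restrict (restrict_id f {1..n}) {1..n} = f"
    by (auto simp: restrict_id_def fun_eq_iff extensional_def intro!: bij_imp_permutes)
qed

lemma permutes_FA_aut [intro]: "p permutes {1..n} \<Longrightarrow> restrict p {1..n} \<in> FA_aut n"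
  using permutes_imp_bij[of p "{1..n}"] permutes_image[of p "{1..n}"]
  by (auto simp: FA_aut_def FA_hom_def intro: bij_betw_cong[THEN iffD1])

lemma FA_aut_hom: "f \<in> FA_aut n \<Longrightarrow> f \<in> FA_hom n n"
  by (simp add: FA_aut_def)

lemma FA_aut_eq: "FA_aut n = {f \<in> FA_hom n n. inj_on f {1..n}}"
  unfolding FA_aut_def bij_betw_def FA_hom_def
  using endo_inj_surj[of "{1..n}"] by (auto simp: PiE_def Pi_def image_subset_iff)

lemma FA_aut_compose [intro]: "f \<in> FA_aut n \<Longrightarrow> g \<in> FA_aut n \<Longrightarrow> compose {1..n} g f \<in> FA_aut n"
  by (auto simp: FA_aut_def intro: bij_betw_compose)

lemma FA_id_aut [simp]: "FA_id n \<in> FA_aut n"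
  by (auto simp: FA_aut_eq) (simp add: FA_id_def inj_on_def)

text \<open>Left unnormalized: this is \<open>n!\<close> times the idempotent of the sign
  representation, and the division is postponed to where it is needed.\<close>

definition antisymmetrizer :: "nat \<Rightarrow> ((nat \<Rightarrow> nat) \<Rightarrow>\<^sub>0 'k::field_char_0)" where
  "antisymmetrizer n =
    (\<Sum>p | p permutes {1..n}. Poly_Mapping.single (restrict p {1..n}) (of_int (sign p)))"

lemma lin_comp_antisymmetrizer:
  "lin_comp n (Poly_Mapping.single f 1) (antisymmetrizer n)
    = (\<Sum>p | p permutes {1..n}. Poly_Mapping.single (restrict (f \<circ> p) {1..n}) (of_int (sign p)))"
  unfolding antisymmetrizer_def lin_comp_linear_right
  by (intro sum.cong) (auto simp: lin_comp_single_single compose_def fun_eq_iff intro!: arg_cong2[of _ _ _ _ Poly_Mapping.single])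

text \<open>With \<open>t \<circ> p\<close> as summation index in place of \<open>p\<close>, each
  sign changes by the factor \<open>sign t\<close>, which is its own inverse.\<close>

lemma lin_comp_antisymmetrizer_permute:
  fixes f :: "nat \<Rightarrow> nat"
  assumes "t permutes {1..n}"
  shows "(\<Sum>p | p permutes {1..n}. Poly_Mapping.single (restrict (f \<circ> (t \<circ> p)) {1..n}) (of_int (sign p)))
    = of_int (sign t) *\<^sub>p
      (\<Sum>p | p permutes {1..n}. Poly_Mapping.single (restrict (f \<circ> p) {1..n}) (of_int (sign p) :: 'k::field_char_0))"
proof -
  have "of_int (sign p) = (of_int (sign t) * of_int (sign (t \<circ> p)) :: 'k)" if "p permutes {1..n}" for p
  proof -
    have "sign (t \<circ> p) = sign t * sign p"
      using assms that by (intro sign_compose permutes_imp_permutation[of "{1..n}"]) auto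
    then show ?thesis
      by (cases "sign t = 1") (auto simp: sign_def)
  qed
  then show ?thesis
    by (subst setum_permutations_compose_left[OF assms]) (auto simp: pscale_sum intro!: sum.cong)
qed

text \<open>The transposition of two points with equal image fixes \<open>f\<close> but has sign -1,
  so the product equals its own negative.\<close>

lemma antisymmetrizer_noninjective:
  assumes "\<not> inj_on f {1..n}"
  shows "lin_comp n (Poly_Mapping.single f c) (antisymmetrizer n) = (0 :: _ \<Rightarrow>\<^sub>0 'k::field_char_0)"
proof -
  from assms obtain i j where ij: "i \<in> {1..n}" "j \<in> {1..n}" "i \<noteq> j" "f i = f j"
    by (auto simp: inj_on_def)
  define t where "t = transpose i j"
  have t: "t permutes {1..n}" and s: "sign t = -1"
    using ij by (auto simp: t_def sign_swap_id intro: permutes_swap_id)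
  have "f \<circ> (t \<circ> p) = f \<circ> p" for p :: "nat \<Rightarrow> nat"
    using ij by (auto simp: fun_eq_iff t_def transpose_def)
  then have eq: "(\<lambda>p. Poly_Mapping.single (restrict (f \<circ> (t \<circ> p)) {1..n}) (of_int (sign p) :: 'k))
      = (\<lambda>p. Poly_Mapping.single (restrict (f \<circ> p) {1..n}) (of_int (sign p)))"
    by (simp only:)
  have "lin_comp n (Poly_Mapping.single f 1) (antisymmetrizer n)
      = - lin_comp n (Poly_Mapping.single f 1) (antisymmetrizer n :: _ \<Rightarrow>\<^sub>0 'k)"
    unfolding lin_comp_antisymmetrizer
    using lin_comp_antisymmetrizer_permute[OF t, of f, where 'k = 'k] s
    unfolding eq by (simp only: of_int_minus of_int_1 pscale_minus_one)
  then have *: "lin_comp n (Poly_Mapping.single f 1) (antisymmetrizer n :: _ \<Rightarrow>\<^sub>0 'k) = 0"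
    by (simp only: eq_minus_self_iff)
  have "lin_comp n (Poly_Mapping.single f c) (antisymmetrizer n :: _ \<Rightarrow>\<^sub>0 'k)
      = c *\<^sub>p lin_comp n (Poly_Mapping.single f 1) (antisymmetrizer n)"
    by (simp add: lin_comp_single_left)
  then show ?thesis unfolding * by simp
qed

text \<open>The case \<open>f = id\<close> of the reindexing in
  \<open>lin_comp_antisymmetrizer_permute\<close>.\<close>

lemma antisymmetrizer_left:
  assumes "t permutes {1..n}"
  shows "lin_comp n (Poly_Mapping.single (restrict t {1..n}) 1) (antisymmetrizer n)
    = of_int (sign t) *\<^sub>p (antisymmetrizer n :: _ \<Rightarrow>\<^sub>0 'k::field_char_0)"
proof -
  have "restrict (restrict t {1..n} \<circ> p) {1..n} = restrict (id \<circ> (t \<circ> p)) {1..n}" if "p permutes {1..n}" for p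
    using permutes_in_image[OF that] by (auto simp: fun_eq_iff)
  then show ?thesis
    using lin_comp_antisymmetrizer_permute[OF assms, of id, where 'k = 'k]
    unfolding lin_comp_antisymmetrizer
    by (simp add: antisymmetrizer_def)
qed

lemma antisymmetrizer_right:
  assumes t: "t permutes {1..n}"
  shows "lin_comp n (antisymmetrizer n) (Poly_Mapping.single (restrict t {1..n}) 1)
    = of_int (sign t) *\<^sub>p (antisymmetrizer n :: _ \<Rightarrow>\<^sub>0 'k::field_char_0)"
proof -
  have "lin_comp n (antisymmetrizer n :: _ \<Rightarrow>\<^sub>0 'k) (Poly_Mapping.single (restrict t {1..n}) 1)
      = (\<Sum>p | p permutes {1..n}. Poly_Mapping.single (restrict (p \<circ> t) {1..n}) (of_int (sign p)))"
    unfolding antisymmetrizer_def lin_comp_linear_left lin_comp_single_single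
    using permutes_image[OF t] by (intro sum.cong refl) (simp add: compose_restrict)
  also have "\<dots> = (\<Sum>p | p permutes {1..n}.
      of_int (sign t) *\<^sub>p Poly_Mapping.single (restrict (p \<circ> t) {1..n}) (of_int (sign (p \<circ> t))))"
  proof (intro sum.cong refl)
    fix p assume "p \<in> {p. p permutes {1..n}}"
    then have "sign (p \<circ> t) = sign p * sign t"
      using t by (intro sign_compose permutes_imp_permutation[of "{1..n}"]) auto
    then show "Poly_Mapping.single (restrict (p \<circ> t) {1..n}) (of_int (sign p) :: 'k)
        = of_int (sign t) *\<^sub>p Poly_Mapping.single (restrict (p \<circ> t) {1..n}) (of_int (sign (p \<circ> t)))"
      by (cases "sign t = 1") (auto simp: sign_def)
  qed
  also have "\<dots> = of_int (sign t) *\<^sub>p antisymmetrizer n"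
    unfolding antisymmetrizer_def pscale_sum
    by (rule sum_permutations_compose_right[OF t, symmetric])
  finally show ?thesis .
qed

text \<open>Permutations act on the antisymmetrizer by their sign and the other self-maps of
  \<open>[n]\<close> by zero, so even the full endomorphism monoid preserves this line.\<close>

lemma antisymmetrizer_left_multiple:
  fixes y :: "(nat \<Rightarrow> nat) \<Rightarrow>\<^sub>0 'k::field_char_0"
  assumes "Poly_Mapping.keys y \<subseteq> FA_hom n n"
  shows "\<exists>c. lin_comp n y (antisymmetrizer n) = c *\<^sub>p antisymmetrizer n"
  using assms
proof (induction rule: keys_induct)
  case zero
  show ?case by (rule exI[of _ 0]) (simp only: lin_comp_linear_left pscale_simps)
next
  case (single f c)
  show ?case
  proof (cases "inj_on f {1..n}")
    case True
    with single have f: "f \<in> FA_aut n" by (auto simp: FA_aut_eq)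
    have "lin_comp n (Poly_Mapping.single f c) (antisymmetrizer n)
        = c *\<^sub>p lin_comp n (Poly_Mapping.single f 1) (antisymmetrizer n)"
      by (simp add: lin_comp_single_left)
    also have "\<dots> = (c * of_int (sign (restrict_id f {1..n}))) *\<^sub>p antisymmetrizer n"
      using antisymmetrizer_left[OF FA_aut_permutes(1)[OF f], where 'k = 'k]
      unfolding FA_aut_permutes(2)[OF f] by (simp only: pscale_simps)
    finally show ?thesis ..
  next
    case False
    then show ?thesis by (intro exI[of _ 0]) (simp only: antisymmetrizer_noninjective not_False_eq_True pscale_simps)
  qed
next
  case (add a b)
  then show ?case by (metis lin_comp_linear_left(1) pscale_add_left)
qed

lemma antisymmetrizer_right_multiple:
  fixes y :: "(nat \<Rightarrow> nat) \<Rightarrow>\<^sub>0 'k::field_char_0"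
  assumes "Poly_Mapping.keys y \<subseteq> FA_aut n"
  shows "\<exists>c. lin_comp n (antisymmetrizer n) y = c *\<^sub>p antisymmetrizer n"
  using assms
proof (induction rule: keys_induct)
  case zero
  show ?case by (rule exI[of _ 0]) (simp only: lin_comp_linear_right pscale_simps)
next
  case (single f c)
  have "lin_comp n (antisymmetrizer n) (Poly_Mapping.single f c)
      = c *\<^sub>p lin_comp n (antisymmetrizer n) (Poly_Mapping.single f 1)"
    by (simp add: lin_comp_single_right)
  also have "\<dots> = (c * of_int (sign (restrict_id f {1..n}))) *\<^sub>p antisymmetrizer n"
    using antisymmetrizer_right[OF FA_aut_permutes(1)[OF single], where 'k = 'k]
    unfolding FA_aut_permutes(2)[OF single] by (simp only: pscale_simps)
  finally show ?case ..
next
  case (add a b)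
  then show ?case by (metis lin_comp_linear_right(1) pscale_add_left)
qed

text \<open>Regarded as tensors with \<open>n\<close> factors, the combinations of maps
  \<open>[n] \<rightarrow> [x]\<close> with this property are the antisymmetric ones, a copy of the
  \<open>n\<close>-th exterior power.\<close>

definition alternating :: "nat \<Rightarrow> ((nat \<Rightarrow> nat) \<Rightarrow>\<^sub>0 'k::field_char_0) \<Rightarrow> bool" where
  "alternating n v \<longleftrightarrow> (\<forall>p. p permutes {1..n} \<longrightarrow>
    lin_comp n v (Poly_Mapping.single (restrict p {1..n}) 1) = of_int (sign p) *\<^sub>p v)"

text \<open>Each of the \<open>n!\<close> summands contributes \<open>v\<close>, because its sign
  occurs twice. Together with \<open>alternating_lin_comp_antisymmetrizer\<close>, the alternating
  elements are exactly the right multiples by the antisymmetrizer.\<close>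

lemma alternating_antisymmetrizer:
  fixes v :: "(nat \<Rightarrow> nat) \<Rightarrow>\<^sub>0 'k::field_char_0"
  assumes "alternating n v"
  shows "lin_comp n v (antisymmetrizer n) = of_nat (fact n) *\<^sub>p v"
proof -
  have "lin_comp n v (Poly_Mapping.single (restrict p {1..n}) (of_int (sign p))) = v"
    if "p permutes {1..n}" for p
  proof -
    have "lin_comp n v (Poly_Mapping.single (restrict p {1..n}) (of_int (sign p)))
        = of_int (sign p) *\<^sub>p lin_comp n v (Poly_Mapping.single (restrict p {1..n}) 1)"
      by (simp add: lin_comp_single_right)
    also have "\<dots> = v"
      using assms that by (auto simp: alternating_def sign_def)
    finally show ?thesis .
  qed
  then have "lin_comp n v (antisymmetrizer n) = (\<Sum>p | p permutes {1..n}. v)"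
    unfolding antisymmetrizer_def lin_comp_linear_right by (intro sum.cong) auto
  also have "\<dots> = of_nat (fact n) *\<^sub>p v"
    by (rule poly_mapping_eqI) (simp add: lookup_sum card_permutations)
  finally show ?thesis .
qed

lemma alternating_lin_comp_antisymmetrizer:
  "alternating n (lin_comp n y (antisymmetrizer n))"
  unfolding alternating_def
proof safe
  fix p assume p: "p permutes {1..n}"
  then have "Poly_Mapping.keys (Poly_Mapping.single (restrict p {1..n}) (1::'a)) \<subseteq> FA_hom n n"
    using FA_aut_hom by auto
  then show "lin_comp n (lin_comp n y (antisymmetrizer n)) (Poly_Mapping.single (restrict p {1..n}) 1)
      = of_int (sign p) *\<^sub>p lin_comp n y (antisymmetrizer n :: _ \<Rightarrow>\<^sub>0 'a)"
    by (simp add: lin_comp_assoc antisymmetrizer_right[OF p] lin_comp_linear_right)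
qed

text \<open>The generator of the submodule of \<open>k FA(r, -)\<close> which lives in degree \<open>r + 1\<close>;
  right multiplication by the inclusion \<open>[r] \<rightarrow> [r + 1]\<close> plays the role of a Koszul differential.\<close>

definition koszul_generator :: "nat \<Rightarrow> ((nat \<Rightarrow> nat) \<Rightarrow>\<^sub>0 'k::field_char_0)" where
  "koszul_generator r = lin_comp r (antisymmetrizer (Suc r)) (Poly_Mapping.single (FA_id r) 1)"

text \<open>Shows that the left multiples of the generator are the values of the differential on
  alternating elements in \<open>r + 1\<close> arguments.\<close>

lemma lin_comp_koszul_generator:
  "lin_comp r y (koszul_generator r)
    = lin_comp r (lin_comp (Suc r) y (antisymmetrizer (Suc r))) (Poly_Mapping.single (FA_id r) 1)"
  unfolding koszul_generator_def by (rule lin_comp_assoc[symmetric]) simp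

lemma koszul_generator_eq_sum:
  "koszul_generator r =
    (\<Sum>p | p permutes {1..Suc r}. Poly_Mapping.single (restrict p {1..r}) (of_int (sign p)))"
  unfolding koszul_generator_def antisymmetrizer_def lin_comp_linear_left lin_comp_single_single
  by (intro sum.cong) (auto simp: FA_id_def compose_def fun_eq_iff intro!: arg_cong2[of _ _ _ _ Poly_Mapping.single])

lemma keys_koszul_generator:
  "Poly_Mapping.keys (koszul_generator r) \<subseteq> {f \<in> FA_hom r (Suc r). inj_on f {1..r}}"
  unfolding koszul_generator_eq_sum
  apply (rule order_trans[OF keys_sum_subset])
  apply (auto simp: FA_hom_def)
  subgoal for p i
    using permutes_in_image[of p "{1..Suc r}" i] by auto
  subgoal for p i
    using permutes_in_image[of p "{1..Suc r}" i] by auto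
  subgoal for p
    using permutes_inj_on[of p] by (auto simp: inj_on_def)
  done

text \<open>A permutation of \<open>[r + 1]\<close> that fixes \<open>[r]\<close> pointwise must fix
  the last point too, so the inclusion occurs with coefficient 1.\<close>

lemma koszul_generator_nonzero: "koszul_generator r \<noteq> 0"
proof -
  have eq: "restrict p {1..r} = FA_id r \<longleftrightarrow> p = id" if p: "p permutes {1..Suc r}" for p
  proof
    assume *: "restrict p {1..r} = FA_id r"
    have "p i = i" if "i \<in> {1..r}" for i
      using fun_cong[OF *, of i] that by (simp add: FA_id_def)
    moreover have "i \<in> {1..r}" if "i \<in> {1..Suc r} - {Suc r}" for i
      using that by auto
    ultimately have "p permutes {Suc r}"
      using p by (blast intro: permutes_superset)
    then show "p = id" by simp
  qed (simp add: FA_id_def)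
  have "Poly_Mapping.lookup (koszul_generator r) (FA_id r)
      = (\<Sum>p | p permutes {1..Suc r}. if p = id then 1 else (0::'a))"
    unfolding koszul_generator_eq_sum lookup_sum
    by (intro sum.cong) (auto simp: lookup_single when_def eq sign_id)
  also have "\<dots> = 1"
    by (simp add: sum.delta finite_permutations permutes_id)
  finally show ?thesis by auto
qed

lemma koszul_noninjective:
  "\<not> inj_on f {1..Suc r} \<Longrightarrow> lin_comp r (Poly_Mapping.single f c) (koszul_generator r) = 0"
  by (simp add: lin_comp_koszul_generator antisymmetrizer_noninjective lin_comp_linear_left)

text \<open>Pigeonhole: no map from \<open>[r + 1]\<close> to a smaller set is injective.\<close>

lemma koszul_low_degree:
  assumes "Poly_Mapping.keys y \<subseteq> FA_hom (Suc r) x" "x < Suc r"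
  shows "lin_comp r y (koszul_generator r) = 0"
  using assms(1)
proof (induction rule: keys_induct)
  case (single f c)
  have "\<not> inj_on f {1..Suc r}"
    using card_inj_on_le[of f "{1..Suc r}" "{1..x}"] single assms(2) by (auto simp: FA_hom_def)
  then show ?case by (rule koszul_noninjective)
qed (simp_all add: lin_comp_linear_left)

text \<open>In degree \<open>r + 1\<close> the submodule generated by
  \<open>koszul_generator r\<close> is thus a line, and \<open>koszul_left_sign\<close> identifies
  it as the sign representation.\<close>

lemma koszul_left_multiple:
  assumes "Poly_Mapping.keys y \<subseteq> FA_hom (Suc r) (Suc r)"
  shows "\<exists>c. lin_comp r y (koszul_generator r) = c *\<^sub>p koszul_generator r"
  using antisymmetrizer_left_multiple[OF assms]
  unfolding lin_comp_koszul_generator by (auto simp: lin_comp_linear_left koszul_generator_def)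

lemma koszul_left_sign:
  assumes "t permutes {1..Suc r}"
  shows "lin_comp r (Poly_Mapping.single (restrict t {1..Suc r}) 1) (koszul_generator r)
    = of_int (sign t) *\<^sub>p koszul_generator r"
  unfolding lin_comp_koszul_generator antisymmetrizer_left[OF assms]
  by (simp add: lin_comp_linear_left koszul_generator_def)

text \<open>Non-injective maps kill the generator, and composing injections gives injections. This
  brings all left multiples within reach of \<open>injective_support_detect\<close>.\<close>

lemma keys_koszul:
  assumes "Poly_Mapping.keys y \<subseteq> FA_hom (Suc r) x"
  shows "Poly_Mapping.keys (lin_comp r y (koszul_generator r)) \<subseteq> {f \<in> FA_hom r x. inj_on f {1..r}}"
  using assms
proof (induction rule: keys_induct)
  case (single f c)
  show ?case
  proof (cases "inj_on f {1..Suc r}")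
    case True
    show ?thesis
    proof (rule keys_lin_comp)
      fix g h assume "g \<in> Poly_Mapping.keys (Poly_Mapping.single f c)" "h \<in> Poly_Mapping.keys (koszul_generator r)"
      then have g: "g = f" and h: "h \<in> FA_hom r (Suc r)" "inj_on h {1..r}"
        using keys_koszul_generator by (auto split: if_splits)
      have "h ` {1..r} \<subseteq> {1..Suc r}"
        using h(1) by (auto simp: FA_hom_def)
      then have "inj_on (f \<circ> h) {1..r}"
        using comp_inj_on[OF h(2) inj_on_subset[OF True]] by blast
      then have "inj_on (compose {1..r} f h) {1..r}"
        by (rule inj_on_cong[THEN iffD1, rotated]) (simp add: compose_def)
      then show "compose {1..r} g h \<in> {f \<in> FA_hom r x. inj_on f {1..r}}"
        using g h single by auto
    qed
  next
    case False
    then show ?thesis by (simp add: koszul_noninjective)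
  qed
next
  case (add a b)
  then show ?case
    using Poly_Mapping.keys_add[of "lin_comp r a (koszul_generator r)"] by (fastforce simp: lin_comp_linear_left)
qed (simp add: lin_comp_linear_left)

text \<open>The test map sends the image of one injection \<open>f\<^sub>0\<close> in the support identically to \<open>[r]\<close> and everything
  else to \<open>r + 1\<close>, so that no other map in the support has the same image as \<open>f\<^sub>0\<close>.\<close>

lemma injective_support_detect:
  fixes v :: "(nat \<Rightarrow> nat) \<Rightarrow>\<^sub>0 'k::field_char_0"
  assumes keys: "Poly_Mapping.keys v \<subseteq> {f \<in> FA_hom r x. inj_on f {1..r}}" and "v \<noteq> 0"
  shows "\<exists>f\<in>FA_hom x (Suc r). lin_comp r (Poly_Mapping.single f 1) v \<noteq> 0"
proof -
  from \<open>v \<noteq> 0\<close> obtain f0 where f0: "f0 \<in> Poly_Mapping.keys v"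
    by (metis poly_mapping_eqI lookup_zero in_keys_iff)
  with keys have f0': "f0 \<in> FA_hom r x" "inj_on f0 {1..r}" by auto
  define f where "f = (\<lambda>i\<in>{1..x}. if i \<in> f0 ` {1..r} then inv_into {1..r} f0 i else Suc r)"
  have f: "f \<in> FA_hom x (Suc r)"
    using inv_into_into[of _ f0 "{1..r}"] by (fastforce simp: FA_hom_def f_def)
  have comp: "compose {1..r} f h = FA_id r \<longleftrightarrow> h = f0" if h: "h \<in> FA_hom r x" for h
  proof
    assume *: "compose {1..r} f h = FA_id r"
    have "h i = f0 i" if i: "i \<in> {1..r}" for i
    proof -
      have fh: "f (h i) = i" and hi: "h i \<in> {1..x}"
        using fun_cong[OF *, of i] i h by (auto simp: compose_def FA_id_def FA_hom_def)
      \<comment> \<open>The value \<open>i\<close> of \<open>f\<close> is at most \<open>r\<close>,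
        which excludes the default value \<open>Suc r\<close>.\<close>
      then have "h i \<in> f0 ` {1..r}" "inv_into {1..r} f0 (h i) = i"
        using i by (auto simp: f_def split: if_splits)
      then show ?thesis by (metis f_inv_into_f)
    qed
    then show "h = f0"
      using h f0' unfolding FA_hom_def by (metis PiE_ext)
  next
    assume "h = f0"
    then show "compose {1..r} f h = FA_id r"
      using f0' by (auto simp: compose_def FA_id_def FA_hom_def fun_eq_iff f_def)
  qed
  \<comment> \<open>By \<open>comp\<close>, only \<open>f0\<close> contributes to the coefficient of
    the inclusion, so nothing can cancel there.\<close>
  have "Poly_Mapping.lookup (lin_comp r (Poly_Mapping.single f 1) v) (FA_id r)
      = (\<Sum>h\<in>Poly_Mapping.keys v. if h = f0 then Poly_Mapping.lookup v h else 0)"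
    unfolding lin_comp_single_left push_def lookup_pscale lookup_sum mult_1_left
    using keys comp by (intro sum.cong) (auto simp: lookup_single when_def)
  also have "\<dots> = Poly_Mapping.lookup v f0"
    using f0 by (simp add: sum.delta)
  also have "\<dots> \<noteq> 0" using f0 by (simp add: in_keys_iff)
  finally have "lin_comp r (Poly_Mapping.single f 1) v \<noteq> 0" by auto
  with f show ?thesis by blast
qed

text \<open>Adjoining the point \<open>1\<close> as a new last argument is a contracting homotopy.\<close>

lemma koszul_exact:
  fixes v :: "(nat \<Rightarrow> nat) \<Rightarrow>\<^sub>0 'k::field_char_0"
  assumes keys: "Poly_Mapping.keys v \<subseteq> FA_hom n x" and "x \<ge> 1" "n \<ge> 1" and alt: "alternating n v"
    and closed: "lin_comp (n - 1) v (Poly_Mapping.single (FA_id (n - 1)) 1) = 0"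
  shows "\<exists>y. Poly_Mapping.keys y \<subseteq> FA_hom (Suc n) x \<and> v = lin_comp n y (koszul_generator n)"
proof -
  define w where "w = push (\<lambda>f. f(Suc n := 1)) v"
  have keys_w: "Poly_Mapping.keys w \<subseteq> FA_hom (Suc n) x"
    unfolding w_def push_eq_lin_ext
    using keys \<open>x \<ge> 1\<close> by (intro keys_lin_ext) (fastforce simp: FA_hom_def PiE_def Pi_def extensional_def)
  define moved where "moved p = push (\<lambda>f. restrict (f(Suc n := 1) \<circ> p) {1..n}) v" for p
  have expand: "lin_comp n w (koszul_generator n)
      = (\<Sum>p | p permutes {1..Suc n}. of_int (sign p) *\<^sub>p moved p)"
    unfolding koszul_generator_eq_sum lin_comp_linear_right lin_comp_single_right w_def push_push moved_def
    by (intro sum.cong refl arg_cong[of _ _ "\<lambda>a. _ *\<^sub>p a"] push_cong) (auto simp: compose_def fun_eq_iff)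
  \<comment> \<open>The point \<open>p (Suc n)\<close> is not a value of \<open>p\<close> on
    \<open>[n]\<close>, so this term ignores one of the \<open>n\<close> arguments of
    \<open>v\<close>. As \<open>v\<close> is alternating, ignoring any argument gives zero as soon
    as ignoring the last one does.\<close>
  have moved_zero: "moved p = 0" if p: "p permutes {1..Suc n}" and "p (Suc n) \<noteq> Suc n" for p
  proof -
    define a where "a = p (Suc n)"
    have a: "a \<in> {1..n}"
      using permutes_in_image[OF p, of "Suc n"] that by (auto simp: a_def)
    \<comment> \<open>Moves the ignored argument \<open>a\<close> to the last place
      \<open>n\<close>, where \<open>closed\<close> applies.\<close>
    define t where "t = transpose a n"
    have t: "t permutes {1..n}"
      using a \<open>n \<ge> 1\<close> unfolding t_def by (intro permutes_swap_id) auto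
    have tt: "t (t i) = i" for i by (simp add: t_def)
    \<comment> \<open>Rebuilds the term from the restriction of \<open>f \<circ> t\<close> to
      \<open>[n - 1]\<close>; the involution \<open>t\<close> is undone inside.\<close>
    define h where "h g = restrict ((g \<circ> t)(Suc n := 1) \<circ> p) {1..n}" for g :: "nat \<Rightarrow> nat"
    have "restrict (f(Suc n := 1) \<circ> p) {1..n} = h (compose {1..n - 1} (compose {1..n} f (restrict t {1..n})) (FA_id (n - 1)))" for f
    proof
      fix i
      show "restrict (f(Suc n := 1) \<circ> p) {1..n} i
        = h (compose {1..n - 1} (compose {1..n} f (restrict t {1..n})) (FA_id (n - 1))) i"
      proof (cases "i \<in> {1..n} \<and> p i \<noteq> Suc n")
        case True
        then have "p i \<noteq> a" "p i \<in> {1..Suc n}"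
          using permutes_inj[OF p] permutes_in_image[OF p, of i] by (auto simp: a_def inj_eq)
        with True have pi: "p i \<in> {1..n}" "p i \<noteq> a" by auto
        moreover have "t (p i) \<in> {1..n}"
          using pi permutes_in_image[OF t] by blast
        moreover have "t (p i) \<noteq> n"
          using pi by (auto simp: t_def transpose_def split: if_splits)
        ultimately have "t (p i) \<in> {1..n - 1}" by auto
        then show ?thesis
          using True pi \<open>t (p i) \<in> {1..n}\<close> by (simp add: h_def compose_def FA_id_def tt)
      qed (auto simp: h_def)
    qed
    then have "moved p = push h (lin_comp (n - 1) (lin_comp n v (Poly_Mapping.single (restrict t {1..n}) 1))
        (Poly_Mapping.single (FA_id (n - 1)) 1))"
      by (simp add: moved_def lin_comp_single_right push_push)
    also have "\<dots> = 0"
      using alt t closed by (simp add: alternating_def lin_comp_linear_left)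
    finally show ?thesis .
  qed
  \<comment> \<open>Here the new argument drops out and \<open>p\<close> merely permutes the
    arguments of \<open>v\<close>, which supplies a second factor \<open>sign p\<close>.\<close>
  have moved_fixed: "of_int (sign p) *\<^sub>p moved p = v" if p: "p permutes {1..n}" for p
  proof -
    have "restrict (f(Suc n := 1) \<circ> p) {1..n} = compose {1..n} f (restrict p {1..n})" for f :: "nat \<Rightarrow> nat"
    proof
      fix i
      show "restrict (f(Suc n := 1) \<circ> p) {1..n} i = compose {1..n} f (restrict p {1..n}) i"
        using permutes_in_image[OF p, of i] by (auto simp: compose_def)
    qed
    then have "moved p = lin_comp n v (Poly_Mapping.single (restrict p {1..n}) 1)"
      by (simp add: moved_def lin_comp_single_right)
    also have "\<dots> = of_int (sign p) *\<^sub>p v"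
      using alt p by (simp add: alternating_def)
    finally show ?thesis by (simp add: sign_def)
  qed
  have fixing: "p permutes {1..Suc n} \<and> p (Suc n) = Suc n \<longleftrightarrow> p permutes {1..n}" for p
  proof
    assume p: "p permutes {1..Suc n} \<and> p (Suc n) = Suc n"
    show "p permutes {1..n}"
    proof (rule permutes_superset)
      show "p permutes {1..Suc n}" using p by blast
      show "p i = i" if "i \<in> {1..Suc n} - {1..n}" for i
        using p that by (cases "i = Suc n") auto
    qed
  next
    assume p: "p permutes {1..n}"
    have "{1..n} \<subseteq> {1..Suc n}" "Suc n \<notin> {1..n}" by auto
    with p show "p permutes {1..Suc n} \<and> p (Suc n) = Suc n"
      using permutes_subset permutes_not_in by metis
  qed
  have "lin_comp n w (koszul_generator n)
      = (\<Sum>p | p permutes {1..Suc n} \<and> p (Suc n) = Suc n. of_int (sign p) *\<^sub>p moved p)"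
    unfolding expand
    by (intro sum.mono_neutral_right) (auto simp: finite_permutations moved_zero)
  also have "\<dots> = (\<Sum>p | p permutes {1..n}. v)"
    unfolding fixing using moved_fixed by (intro sum.cong) auto
  also have "\<dots> = of_nat (fact n) *\<^sub>p v"
    by (rule poly_mapping_eqI) (simp add: lookup_sum card_permutations)
  finally have w: "lin_comp n w (koszul_generator n) = of_nat (fact n) *\<^sub>p v" .
  show ?thesis
  proof (intro exI conjI)
    \<comment> \<open>There are \<open>n!\<close> permutations fixing \<open>Suc n\<close>, each
      contributing \<open>v\<close>; hence this normalization.\<close>
    show "Poly_Mapping.keys (inverse (of_nat (fact n)) *\<^sub>p w) \<subseteq> FA_hom (Suc n) x"
      by (rule order_trans[OF keys_pscale keys_w])
    show "v = lin_comp n (inverse (of_nat (fact n)) *\<^sub>p w) (koszul_generator n)"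
      unfolding lin_comp_linear_left w pscale_simps by simp
  qed
qed

section \<open>Quotients of free modules and the standard modules\<close>

lemma ground_simps [simp]:
  "carrier ground = UNIV" "a \<otimes>\<^bsub>ground\<^esub> b = a * b" "\<one>\<^bsub>ground\<^esub> = 1" "\<zero>\<^bsub>ground\<^esub> = 0"
  "a \<oplus>\<^bsub>ground\<^esub> b = a + b"
  by (simp_all add: ring_of_type_algebra_def)

lemma free_module_simps [simp]:
  "carrier (free_module S) = {a. Poly_Mapping.keys a \<subseteq> S}" "\<zero>\<^bsub>free_module S\<^esub> = 0"
  "a \<oplus>\<^bsub>free_module S\<^esub> b = a + b" "c \<odot>\<^bsub>free_module S\<^esub> a = c *\<^sub>p a"
  by (simp_all add: free_module_def)

lemma keys_add_subset: "Poly_Mapping.keys a \<subseteq> S \<Longrightarrow> Poly_Mapping.keys b \<subseteq> S \<Longrightarrow> Poly_Mapping.keys (a + b) \<subseteq> S"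
  using Poly_Mapping.keys_add[of a b] by blast

lemma keys_pscale_subset: "Poly_Mapping.keys a \<subseteq> S \<Longrightarrow> Poly_Mapping.keys (c *\<^sub>p a) \<subseteq> S"
  by (rule order_trans[OF keys_pscale])

lemma keys_diff_subset:
  fixes a b :: "'s \<Rightarrow>\<^sub>0 'k::field_char_0"
  assumes "Poly_Mapping.keys a \<subseteq> S" "Poly_Mapping.keys b \<subseteq> S"
  shows "Poly_Mapping.keys (a - b) \<subseteq> S"
  proof
  fix s assume "s \<in> Poly_Mapping.keys (a - b)"
  then have "s \<in> Poly_Mapping.keys a \<or> s \<in> Poly_Mapping.keys b"
    by (auto simp: in_keys_iff lookup_minus)
  with assms show "s \<in> S" by blast
qed

lemma module_free_module: "module ground (free_module S)"
proof (rule moduleI)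
  show "cring (ground :: 'a ring)" by (rule cring_from_type_algebra)
  show "abelian_group (free_module S :: ('a, 'b \<Rightarrow>\<^sub>0 'a) module)"
  proof (rule abelian_groupI)
    fix a :: "'b \<Rightarrow>\<^sub>0 'a" assume "a \<in> carrier (free_module S)"
    then show "\<exists>b\<in>carrier (free_module S). b \<oplus>\<^bsub>free_module S\<^esub> a = \<zero>\<^bsub>free_module S\<^esub>"
      by (intro bexI[of _ "- a"]) auto
  qed (simp_all add: keys_add_subset add_ac)
qed (simp_all add: keys_pscale_subset pscale_add pscale_add_left)

text \<open>Speaks of the type of all finite linear combinations instead of a module record;
  \<open>submodule_free_module_iff\<close> restores the basis \<open>S\<close>.\<close>

definition linear_subspace :: "('s \<Rightarrow>\<^sub>0 'k::field_char_0) set \<Rightarrow> bool" where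
  "linear_subspace W \<longleftrightarrow> 0 \<in> W \<and> (\<forall>a\<in>W. \<forall>b\<in>W. a + b \<in> W) \<and> (\<forall>c. \<forall>a\<in>W. c *\<^sub>p a \<in> W)"

lemma linear_subspaceI:
  "0 \<in> W \<Longrightarrow> (\<And>a b. a \<in> W \<Longrightarrow> b \<in> W \<Longrightarrow> a + b \<in> W) \<Longrightarrow> (\<And>c a. a \<in> W \<Longrightarrow> c *\<^sub>p a \<in> W)
    \<Longrightarrow> linear_subspace W"
  by (auto simp: linear_subspace_def)

lemma linear_subspaceD:
  assumes "linear_subspace W"
  shows "0 \<in> W" "a \<in> W \<Longrightarrow> b \<in> W \<Longrightarrow> a + b \<in> W" "a \<in> W \<Longrightarrow> c *\<^sub>p a \<in> W"
    "a \<in> W \<Longrightarrow> - a \<in> W" "a \<in> W \<Longrightarrow> b \<in> W \<Longrightarrow> a - b \<in> W"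
proof -
  show *: "0 \<in> W" "a \<in> W \<Longrightarrow> b \<in> W \<Longrightarrow> a + b \<in> W" "a \<in> W \<Longrightarrow> c *\<^sub>p a \<in> W" for a b c
    using assms by (auto simp: linear_subspace_def)
  show "a \<in> W \<Longrightarrow> - a \<in> W" for a
    using *(3)[of a "- 1"] by (simp only: pscale_minus_one)
  then show "a \<in> W \<Longrightarrow> b \<in> W \<Longrightarrow> a - b \<in> W"
    using *(2)[of a "- b"] by simp
qed

lemma linear_subspace_keys: "linear_subspace {a. Poly_Mapping.keys a \<subseteq> S}"
  by (rule linear_subspaceI) (simp_all add: keys_add_subset keys_pscale_subset)

lemma submodule_free_module_iff:
  fixes U :: "('s \<Rightarrow>\<^sub>0 'k::field_char_0) set"
  shows "submodule U ground (free_module S) \<longleftrightarrow> U \<subseteq> {a. Poly_Mapping.keys a \<subseteq> S} \<and> linear_subspace U"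
proof -
  interpret module "ground :: 'k ring" "free_module S :: ('k, 's \<Rightarrow>\<^sub>0 'k) module"
    by (rule module_free_module)
  have inv: "\<ominus>\<^bsub>free_module S\<^esub> a = - a" if "Poly_Mapping.keys a \<subseteq> S" for a :: "'s \<Rightarrow>\<^sub>0 'k"
    using that by (intro minus_equality) auto
  show ?thesis
  proof
    assume U: "submodule U ground (free_module S)"
    then have "0 \<in> U"
      using submoduleE(2)[OF U] submoduleE(4)[OF U, of 0] by fastforce
    then show "U \<subseteq> {a. Poly_Mapping.keys a \<subseteq> S} \<and> linear_subspace U"
      using submoduleE[OF U] by (auto intro!: linear_subspaceI)
  next
    assume U: "U \<subseteq> {a. Poly_Mapping.keys a \<subseteq> S} \<and> linear_subspace U"
    show "submodule U ground (free_module S)"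
    proof (rule submoduleI)
      fix a assume "a \<in> U"
      moreover from this have "Poly_Mapping.keys a \<subseteq> S" using U by blast
      ultimately show "\<ominus>\<^bsub>free_module S\<^esub> a \<in> U"
        using U by (simp add: inv linear_subspaceD(4))
    qed (use U linear_subspaceD in auto)
  qed
qed

lemma span_in_free_module:
  assumes "R \<subseteq> {a. Poly_Mapping.keys a \<subseteq> S}"
  shows "span_in ground (free_module S) R \<subseteq> {a. Poly_Mapping.keys a \<subseteq> S}"
    "linear_subspace (span_in ground (free_module S) R)"
    "R \<subseteq> span_in ground (free_module S) R"
proof -
  show "span_in ground (free_module S) R \<subseteq> {a. Poly_Mapping.keys a \<subseteq> S}"
    unfolding span_in_def submodule_free_module_iff
    using assms linear_subspace_keys by (intro Inter_lower) auto
  show "linear_subspace (span_in ground (free_module S) R)"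
    unfolding span_in_def submodule_free_module_iff
    by (rule linear_subspaceI) (auto intro: linear_subspaceD(1-3))
  show "R \<subseteq> span_in ground (free_module S) R"
    unfolding span_in_def by blast
qed

lemma span_in_least:
  "V \<subseteq> {a. Poly_Mapping.keys a \<subseteq> S} \<Longrightarrow> linear_subspace V \<Longrightarrow> R \<subseteq> V
    \<Longrightarrow> span_in ground (free_module S) R \<subseteq> V"
  unfolding span_in_def submodule_free_module_iff by blast

lemma span_in_singles:
  fixes A :: "'s set"
  assumes "A \<subseteq> S"
  shows "span_in ground (free_module S) {Poly_Mapping.single s 1 | s. s \<in> A}
    = {a :: 's \<Rightarrow>\<^sub>0 'k::field_char_0. Poly_Mapping.keys a \<subseteq> A}" (is "?L = ?R")
proof
  let ?G = "{Poly_Mapping.single s (1::'k) | s. s \<in> A}"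
  show "?L \<subseteq> ?R"
    using assms by (intro span_in_least linear_subspace_keys) auto
  have G: "?G \<subseteq> {a. Poly_Mapping.keys a \<subseteq> S}" using assms by auto
  note span = span_in_free_module[OF G]
  show "?R \<subseteq> ?L"
  proof safe
    fix a :: "'s \<Rightarrow>\<^sub>0 'k" assume "Poly_Mapping.keys a \<subseteq> A"
    then show "a \<in> ?L"
    proof (induction rule: keys_induct)
      case zero
      show ?case by (rule linear_subspaceD(1)[OF span(2)])
    next
      case (single s c)
      then have "Poly_Mapping.single s 1 \<in> ?L" using span(3) by blast
      from linear_subspaceD(3)[OF span(2) this, of c] show ?case by simp
    next
      case (add a b)
      then show ?case by (rule linear_subspaceD(2)[OF span(2)])
    qed
  qed
qed

text \<open>A span of basis elements is described by supports, so membership can be checked map by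
  map.\<close>

lemma noninjective_eq:
  "noninjective n m = {a. Poly_Mapping.keys a \<subseteq> {f \<in> FA_hom n m. \<not> inj_on f {1..n}}}"
  unfolding noninjective_def
  using span_in_singles[of "{f \<in> FA_hom n m. \<not> inj_on f {1..n}}" "FA_hom n m"] by simp

lemma linear_subspace_noninjective: "linear_subspace (noninjective n m)"
  unfolding noninjective_eq by (rule linear_subspace_keys)

text \<open>Subtraction of the type replaces the module record, so the coset no longer mentions the
  basis \<open>S\<close>.\<close>

definition pcoset :: "('s \<Rightarrow>\<^sub>0 'k::field_char_0) set \<Rightarrow> ('s \<Rightarrow>\<^sub>0 'k) \<Rightarrow> ('s \<Rightarrow>\<^sub>0 'k) set" where
  "pcoset W a = {b. b - a \<in> W}"

lemma a_r_coset_free_module [simp]: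
  fixes a :: "'s \<Rightarrow>\<^sub>0 'k::field_char_0"
  shows "W +>\<^bsub>free_module S\<^esub> a = pcoset W a"
proof (rule Set.set_eqI)
  fix b :: "'s \<Rightarrow>\<^sub>0 'k"
  have "b \<in> W +>\<^bsub>free_module S\<^esub> a \<longleftrightarrow> (\<exists>h\<in>W. b = h + a)"
    unfolding a_r_coset_def' free_module_simps by blast
  also have "\<dots> \<longleftrightarrow> b - a \<in> W"
    by (auto intro: bexI[of _ "b - a"])
  finally show "b \<in> W +>\<^bsub>free_module S\<^esub> a \<longleftrightarrow> b \<in> pcoset W a"
    by (simp only: pcoset_def mem_Collect_eq)
qed

lemma pcoset_eq_iff:
  assumes "linear_subspace W"
  shows "pcoset W a = pcoset W b \<longleftrightarrow> a - b \<in> W"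
proof
  assume "pcoset W a = pcoset W b"
  moreover have "a \<in> pcoset W a"
    using linear_subspaceD(1)[OF assms] by (simp add: pcoset_def)
  ultimately show "a - b \<in> W" by (auto simp: pcoset_def)
next
  assume ab: "a - b \<in> W"
  have "c - b \<in> W \<longleftrightarrow> c - a \<in> W" for c
    using linear_subspaceD(2)[OF assms _ ab, of "c - a"] linear_subspaceD(5)[OF assms _ ab, of "c - b"]
    by auto
  then show "pcoset W a = pcoset W b" by (auto simp: pcoset_def)
qed

text \<open>The union in \<open>quot_map\<close> runs over all representatives; compatibility of
  \<open>h\<close> with the subspaces makes their cosets coincide.\<close>

lemma quot_map_pcoset:
  assumes W: "linear_subspace W" and W': "linear_subspace W'"
    and h: "\<And>x. x - a \<in> W \<Longrightarrow> h x - h a \<in> W'"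
  shows "quot_map (free_module S) W' h (pcoset W a) = pcoset W' (h a)"
proof -
  have "pcoset W' (h x) = pcoset W' (h a)" if "x \<in> pcoset W a" for x
    using h that by (simp add: pcoset_eq_iff[OF W']) (simp add: pcoset_def)
  moreover have "a \<in> pcoset W a"
    using linear_subspaceD(1)[OF W] by (simp add: pcoset_def)
  ultimately show ?thesis
    unfolding quot_map_def a_r_coset_free_module by blast
qed

lemma quot_free_module_simps:
  assumes W: "linear_subspace W"
  shows "carrier (quot_module (free_module S) W) = pcoset W ` {a. Poly_Mapping.keys a \<subseteq> S}"
    "\<zero>\<^bsub>quot_module (free_module S) W\<^esub> = W"
    "pcoset W a \<oplus>\<^bsub>quot_module (free_module S) W\<^esub> pcoset W b = pcoset W (a + b)"
    "c \<odot>\<^bsub>quot_module (free_module S) W\<^esub> pcoset W a = pcoset W (c *\<^sub>p a)"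
proof -
  show "carrier (quot_module (free_module S) W) = pcoset W ` {a. Poly_Mapping.keys a \<subseteq> S}"
    by (auto simp: quot_module_def A_RCOSETS_def' image_def simp flip: a_r_coset_def')
  show "\<zero>\<^bsub>quot_module (free_module S) W\<^esub> = W"
    by (simp add: quot_module_def)
  have "pcoset W a \<oplus>\<^bsub>quot_module (free_module S) W\<^esub> pcoset W b = {x + y | x y. x - a \<in> W \<and> y - b \<in> W}"
    by (auto simp: quot_module_def set_add_def' pcoset_def)
  also have "\<dots> = pcoset W (a + b)"
  proof (intro equalityI subsetI)
    fix z assume "z \<in> {x + y | x y. x - a \<in> W \<and> y - b \<in> W}"
    then obtain x y where xy: "z = x + y" "x - a \<in> W" "y - b \<in> W" by blast
    have "(x - a) + (y - b) = z - (a + b)" by (simp add: xy)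
    with linear_subspaceD(2)[OF W xy(2,3)] show "z \<in> pcoset W (a + b)"
      by (simp only: pcoset_def mem_Collect_eq)
  next
    fix z assume "z \<in> pcoset W (a + b)"
    moreover have "(z - b) - a = z - (a + b)" by (simp add: algebra_simps)
    ultimately have "(z - b) - a \<in> W" by (simp only: pcoset_def mem_Collect_eq)
    moreover have "z = (z - b) + b" "b - b \<in> W"
      using linear_subspaceD(1)[OF W] by simp_all
    ultimately show "z \<in> {x + y | x y. x - a \<in> W \<and> y - b \<in> W}" by blast
  qed
  finally show "pcoset W a \<oplus>\<^bsub>quot_module (free_module S) W\<^esub> pcoset W b = pcoset W (a + b)" .
  have "quot_map (free_module S) W (\<lambda>a. c *\<^sub>p a) (pcoset W a) = pcoset W (c *\<^sub>p a)"
    by (rule quot_map_pcoset[OF W W]) (simp add: linear_subspaceD(3)[OF W] flip: pscale_diff)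
  then show "c \<odot>\<^bsub>quot_module (free_module S) W\<^esub> pcoset W a = pcoset W (c *\<^sub>p a)"
    by (simp add: quot_module_def free_module_def)
qed

section \<open>The modules \<open>k FA(n, -)\<close> and their quotients by non-injective
  maps\<close>

lemma kFA_simps [simp]:
  "fa_obj (kFA n) x = free_module (FA_hom n x)"
  "fa_act (kFA n) x y f = lin_comp n (Poly_Mapping.single f 1)"
  by (simp_all add: kFA_def)

lemma FA_act_keys:
  "f \<in> FA_hom x y \<Longrightarrow> Poly_Mapping.keys z \<subseteq> FA_hom n x
    \<Longrightarrow> Poly_Mapping.keys (lin_comp n (Poly_Mapping.single f c) z) \<subseteq> FA_hom n y"
  by (rule FA_hom_keys_lin_comp) auto

lemma FA_right_keys:
  "Poly_Mapping.keys a \<subseteq> FA_aut n \<Longrightarrow> Poly_Mapping.keys z \<subseteq> FA_hom n x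
    \<Longrightarrow> Poly_Mapping.keys (lin_comp n z a) \<subseteq> FA_hom n x"
  using FA_aut_hom by (intro FA_hom_keys_lin_comp) auto

lemma noninjective_left:
  assumes "f \<in> FA_hom x y" "z \<in> noninjective n x"
  shows "lin_comp n (Poly_Mapping.single f c) z \<in> noninjective n y"
  unfolding noninjective_eq mem_Collect_eq
proof (rule keys_lin_comp)
  fix g h assume "g \<in> Poly_Mapping.keys (Poly_Mapping.single f c)" "h \<in> Poly_Mapping.keys z"
  then have g: "g = f" and h: "h \<in> FA_hom n x" "\<not> inj_on h {1..n}"
    using assms by (auto simp: noninjective_eq split: if_splits)
  obtain i j where "i \<in> {1..n}" "j \<in> {1..n}" "i \<noteq> j" "h i = h j"
    using h(2) by (auto simp: inj_on_def)
  then have "\<not> inj_on (compose {1..n} f h) {1..n}"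
    unfolding inj_on_def compose_def by (metis restrict_apply)
  then show "compose {1..n} g h \<in> {f \<in> FA_hom n y. \<not> inj_on f {1..n}}"
    using g h assms by auto
qed

text \<open>An automorphism \<open>f\<close> maps onto \<open>[n]\<close>, so injectivity of
  \<open>g \<circ> f\<close> would give that of \<open>g\<close>. Hence the right action descends to
  the standard module.\<close>

lemma noninjective_right:
  assumes "Poly_Mapping.keys a \<subseteq> FA_aut n" "z \<in> noninjective n x"
  shows "lin_comp n z a \<in> noninjective n x"
  unfolding noninjective_eq mem_Collect_eq
proof (rule keys_lin_comp)
  fix g f assume "g \<in> Poly_Mapping.keys z" "f \<in> Poly_Mapping.keys a"
  then have g: "g \<in> FA_hom n x" "\<not> inj_on g {1..n}" and f: "f \<in> FA_aut n"
    using assms by (auto simp: noninjective_eq)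
  have "\<not> inj_on (g \<circ> f) {1..n}"
    using g(2) f inj_on_imageI[of g f "{1..n}"] by (auto simp: FA_aut_def bij_betw_def)
  moreover have "inj_on (compose {1..n} g f) {1..n} \<longleftrightarrow> inj_on (g \<circ> f) {1..n}"
    by (rule inj_on_cong) (simp add: compose_def)
  ultimately show "compose {1..n} g f \<in> {f \<in> FA_hom n x. \<not> inj_on f {1..n}}"
    using g f FA_aut_hom by auto
qed

abbreviation std_class :: "nat \<Rightarrow> nat \<Rightarrow> ((nat \<Rightarrow> nat) \<Rightarrow>\<^sub>0 'k::field_char_0) \<Rightarrow> ((nat \<Rightarrow> nat) \<Rightarrow>\<^sub>0 'k) set" where
  "std_class n x \<equiv> pcoset (noninjective n x)"

lemma standard_simps:
  "carrier (fa_obj (standard n) x) = std_class n x ` {z. Poly_Mapping.keys z \<subseteq> FA_hom n x}"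
  "std_class n x z \<oplus>\<^bsub>fa_obj (standard n) x\<^esub> std_class n x z' = std_class n x (z + z')"
  "c \<odot>\<^bsub>fa_obj (standard n) x\<^esub> std_class n x z = std_class n x (c *\<^sub>p z)"
  using quot_free_module_simps[OF linear_subspace_noninjective]
  by (simp_all add: standard_def fa_quotient_def)

lemma standard_act:
  assumes "f \<in> FA_hom x y"
  shows "fa_act (standard n) x y f (std_class n x z) = std_class n y (lin_comp n (Poly_Mapping.single f 1) z)"
  unfolding standard_def fa_quotient_def
  by (simp, rule quot_map_pcoset[OF linear_subspace_noninjective linear_subspace_noninjective])
    (simp add: noninjective_left[OF assms] flip: lin_comp_linear_right)

lemma standard_right_class:
  assumes "Poly_Mapping.keys a \<subseteq> FA_aut n"
  shows "standard_right n x (std_class n x z) a = std_class n x (lin_comp n z a)"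
  unfolding standard_right_def
  by (simp, rule quot_map_pcoset[OF linear_subspace_noninjective linear_subspace_noninjective])
    (simp add: noninjective_right[OF assms] flip: lin_comp_linear_left)

lemma std_class_epi: "fa_epi (kFA n) (standard n) (std_class n)"
  by (auto simp: fa_epi_def fa_homs_def linear_maps_def standard_simps standard_act)

text \<open>The homomorphism theorem for a quotient \<open>B\<close> of \<open>kFA n\<close>. It
  lets homomorphisms out of \<open>standard\<close> and \<open>standard_irr\<close> be given on
  representatives.\<close>

lemma fa_epi_factor:
  assumes T: "fa_epi (kFA n) B T" and S: "S \<in> fa_homs (kFA n) C"
    and ker: "\<And>x a b. x \<ge> 1 \<Longrightarrow> Poly_Mapping.keys a \<subseteq> FA_hom n x \<Longrightarrow> Poly_Mapping.keys b \<subseteq> FA_hom n x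
      \<Longrightarrow> T x a = T x b \<Longrightarrow> S x a = S x b"
  shows "\<exists>\<phi>\<in>fa_homs B C. \<forall>x\<ge>1. \<forall>a. Poly_Mapping.keys a \<subseteq> FA_hom n x \<longrightarrow> \<phi> x (T x a) = S x a"
proof -
  \<comment> \<open>An arbitrary preimage under \<open>T x\<close>; by \<open>ker\<close> the value
    does not depend on the choice.\<close>
  define \<phi> where "\<phi> x u = S x (SOME a. Poly_Mapping.keys a \<subseteq> FA_hom n x \<and> T x a = u)" for x u
  have \<phi>: "\<phi> x (T x a) = S x a" if "x \<ge> 1" "Poly_Mapping.keys a \<subseteq> FA_hom n x" for x a
    unfolding \<phi>_def
    using someI[of "\<lambda>b. Poly_Mapping.keys b \<subseteq> FA_hom n x \<and> T x b = T x a" a] that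
    by (intro ker) auto
  have cases: "\<exists>a. Poly_Mapping.keys a \<subseteq> FA_hom n x \<and> u = T x a" if "x \<ge> 1" "u \<in> carrier (fa_obj B x)" for x u
  proof -
    have "u \<in> T x ` carrier (fa_obj (kFA n) x)"
      using T that by (simp add: fa_epi_def)
    then show ?thesis by auto
  qed
  have T_lin: "T x a \<oplus>\<^bsub>fa_obj B x\<^esub> T x b = T x (a + b)" "c \<odot>\<^bsub>fa_obj B x\<^esub> T x a = T x (c *\<^sub>p a)"
    if "x \<ge> 1" "Poly_Mapping.keys a \<subseteq> FA_hom n x" "Poly_Mapping.keys b \<subseteq> FA_hom n x" for x a b c
    using T that by (auto simp: fa_epi_def fa_homs_def linear_maps_def)
  have T_act: "fa_act B x y f (T x a) = T y (lin_comp n (Poly_Mapping.single f 1) a)"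
    if "x \<ge> 1" "y \<ge> 1" "f \<in> FA_hom x y" "Poly_Mapping.keys a \<subseteq> FA_hom n x" for x y f a
    using T that by (auto simp: fa_epi_def fa_homs_def)
  have S_lin: "S x a \<in> carrier (fa_obj C x)" "S x (a + b) = S x a \<oplus>\<^bsub>fa_obj C x\<^esub> S x b"
      "S x (c *\<^sub>p a) = c \<odot>\<^bsub>fa_obj C x\<^esub> S x a"
    if "x \<ge> 1" "Poly_Mapping.keys a \<subseteq> FA_hom n x" "Poly_Mapping.keys b \<subseteq> FA_hom n x" for x a b c
    using S that by (auto simp: fa_homs_def linear_maps_def)
  have S_act: "S y (lin_comp n (Poly_Mapping.single f 1) a) = fa_act C x y f (S x a)"
    if "x \<ge> 1" "y \<ge> 1" "f \<in> FA_hom x y" "Poly_Mapping.keys a \<subseteq> FA_hom n x" for x y f a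
    using S that by (auto simp: fa_homs_def)
  have "\<phi> x \<in> linear_maps ground (fa_obj B x) (fa_obj C x)" if x: "x \<ge> 1" for x
    unfolding linear_maps_def
  proof (intro CollectI conjI ballI funcsetI)
    fix u assume "u \<in> carrier (fa_obj B x)"
    then obtain a where a: "Poly_Mapping.keys a \<subseteq> FA_hom n x" "u = T x a" using cases x by blast
    then show "\<phi> x u \<in> carrier (fa_obj C x)" using S_lin(1)[OF x a(1) a(1)] \<phi>[OF x a(1)] by simp
    show "\<phi> x (c \<odot>\<^bsub>fa_obj B x\<^esub> u) = c \<odot>\<^bsub>fa_obj C x\<^esub> \<phi> x u" for c
      unfolding a(2) T_lin(2)[OF x a(1) a(1)] \<phi>[OF x a(1)] \<phi>[OF x keys_pscale_subset[OF a(1)]]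
      by (rule S_lin(3)[OF x a(1) a(1)])
    fix v assume "v \<in> carrier (fa_obj B x)"
    then obtain b where b: "Poly_Mapping.keys b \<subseteq> FA_hom n x" "v = T x b" using cases x by blast
    show "\<phi> x (u \<oplus>\<^bsub>fa_obj B x\<^esub> v) = \<phi> x u \<oplus>\<^bsub>fa_obj C x\<^esub> \<phi> x v"
      unfolding a(2) b(2) T_lin(1)[OF x a(1) b(1)] \<phi>[OF x a(1)] \<phi>[OF x b(1)] \<phi>[OF x keys_add_subset[OF a(1) b(1)]]
      by (rule S_lin(2)[OF x a(1) b(1)])
  qed
  moreover have "\<phi> y (fa_act B x y f u) = fa_act C x y f (\<phi> x u)"
    if xy: "x \<ge> 1" "y \<ge> 1" and f: "f \<in> FA_hom x y" and u: "u \<in> carrier (fa_obj B x)" for x y f u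
  proof -
    obtain a where a: "Poly_Mapping.keys a \<subseteq> FA_hom n x" "u = T x a" using cases[OF xy(1) u] by blast
    show ?thesis
      unfolding a(2) T_act[OF xy f a(1)] \<phi>[OF xy(1) a(1)] \<phi>[OF xy(2) FA_act_keys[OF f a(1)]]
      by (rule S_act[OF xy f a(1)])
  qed
  ultimately have "\<phi> \<in> fa_homs B C" by (simp add: fa_homs_def)
  with \<phi> show ?thesis by blast
qed

section \<open>The modules \<open>\<Delta>\<^bsub>n,\<lambda>\<^esub>\<close>\<close>

lemma group_algebra_simps [simp]:
  "carrier (group_algebra n) = {a. Poly_Mapping.keys a \<subseteq> FA_aut n}"
  "a \<otimes>\<^bsub>group_algebra n\<^esub> b = lin_comp n a b" "\<zero>\<^bsub>group_algebra n\<^esub> = 0"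
  "a \<oplus>\<^bsub>group_algebra n\<^esub> b = a + b" "\<one>\<^bsub>group_algebra n\<^esub> = Poly_Mapping.single (FA_id n) 1"
  by (simp_all add: group_algebra_def)

lemma left_ideal_simps [simp]:
  "carrier (left_ideal n e) = (\<lambda>a. lin_comp n a e) ` {a. Poly_Mapping.keys a \<subseteq> FA_aut n}"
  "\<zero>\<^bsub>left_ideal n e\<^esub> = 0" "a \<oplus>\<^bsub>left_ideal n e\<^esub> b = a + b" "a \<odot>\<^bsub>left_ideal n e\<^esub> b = lin_comp n a b"
  by (simp_all add: left_ideal_def)

lemma FA_aut_keys_lin_comp:
  "Poly_Mapping.keys b \<subseteq> FA_aut n \<Longrightarrow> Poly_Mapping.keys a \<subseteq> FA_aut n
    \<Longrightarrow> Poly_Mapping.keys (lin_comp n b a) \<subseteq> FA_aut n"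
  by (intro keys_lin_comp FA_aut_compose) auto

text \<open>The tensor product is studied through the epimorphism
  \<open>z \<mapsto> (z + U) \<otimes> e\<close> from \<open>kFA n\<close>, called
  \<open>proj\<close> below: first its surjectivity, then its kernel.\<close>

locale group_algebra_idempotent =
  fixes n :: nat and e :: "(nat \<Rightarrow> nat) \<Rightarrow>\<^sub>0 'k::field_char_0"
  assumes keys_e: "Poly_Mapping.keys e \<subseteq> FA_aut n" and e_idem: "lin_comp n e e = e"
begin

abbreviation ideal where "ideal \<equiv> (\<lambda>a. lin_comp n a e) ` {a. Poly_Mapping.keys a \<subseteq> FA_aut n}"
abbreviation cell where "cell x \<equiv> {z :: (nat \<Rightarrow> nat) \<Rightarrow>\<^sub>0 'k. Poly_Mapping.keys z \<subseteq> FA_hom n x}"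
abbreviation pairs where "pairs x \<equiv> std_class n x ` cell x \<times> ideal"

definition tensor_rels where
  "tensor_rels x = tensor_relations (group_algebra n) (fa_obj (standard n) x) (standard_right n x) (left_ideal n e)"

definition tensor_zero where
  "tensor_zero x = tensor_null (group_algebra n) (fa_obj (standard n) x) (standard_right n x) (left_ideal n e)"

lemma keys_e_hom: "Poly_Mapping.keys e \<subseteq> FA_hom n n"
  using keys_e FA_aut_hom by blast

lemma e_in_ideal: "e \<in> ideal"
  using keys_e e_idem by (intro image_eqI[of _ _ e]) auto

lemma keys_ideal: "y \<in> ideal \<Longrightarrow> Poly_Mapping.keys y \<subseteq> FA_aut n"
  using FA_aut_keys_lin_comp keys_e by auto

lemma ideal_add: "y \<in> ideal \<Longrightarrow> y' \<in> ideal \<Longrightarrow> y + y' \<in> ideal"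
  by (elim imageE) (auto intro!: image_eqI simp: keys_add_subset simp flip: lin_comp_linear_left)

lemma ideal_mult: "y \<in> ideal \<Longrightarrow> Poly_Mapping.keys a \<subseteq> FA_aut n \<Longrightarrow> lin_comp n a y \<in> ideal"
  by (elim imageE) (auto intro!: image_eqI simp: FA_aut_keys_lin_comp simp flip: lin_comp_assoc[OF keys_e_hom])

text \<open>Here and in \<open>tensor_rels_cases\<close> the relations, which are defined by
  operations on cosets, are expressed by representatives.\<close>

lemma tensor_relsI:
  assumes "z \<in> cell x" "y \<in> ideal"
  shows "z' \<in> cell x \<Longrightarrow> Poly_Mapping.single (std_class n x (z + z'), y) 1 - Poly_Mapping.single (std_class n x z, y) 1
      - Poly_Mapping.single (std_class n x z', y) 1 \<in> tensor_rels x"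
    and "y' \<in> ideal \<Longrightarrow> Poly_Mapping.single (std_class n x z, y + y') 1 - Poly_Mapping.single (std_class n x z, y) 1
      - Poly_Mapping.single (std_class n x z, y') 1 \<in> tensor_rels x"
    and "Poly_Mapping.single (std_class n x (c *\<^sub>p z), y) 1 - Poly_Mapping.single (std_class n x z, y) c \<in> tensor_rels x"
    and "Poly_Mapping.keys a \<subseteq> FA_aut n \<Longrightarrow>
      Poly_Mapping.single (std_class n x (lin_comp n z a), y) 1 - Poly_Mapping.single (std_class n x z, lin_comp n a y) 1
      \<in> tensor_rels x"
proof -
  let ?C = "carrier (fa_obj (standard n) x)" and ?I = "carrier (left_ideal n e)"
  have z: "std_class n x z \<in> ?C" and y: "y \<in> ?I"
    using assms by (auto simp: standard_simps)
  show "Poly_Mapping.single (std_class n x (z + z'), y) 1 - Poly_Mapping.single (std_class n x z, y) 1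
      - Poly_Mapping.single (std_class n x z', y) 1 \<in> tensor_rels x" if "z' \<in> cell x"
  proof -
    have "std_class n x z' \<in> ?C" using that by (auto simp: standard_simps)
    with z y show ?thesis
      unfolding tensor_rels_def tensor_relations_def standard_simps(2)[symmetric] by blast
  qed
  show "Poly_Mapping.single (std_class n x z, y + y') 1 - Poly_Mapping.single (std_class n x z, y) 1
      - Poly_Mapping.single (std_class n x z, y') 1 \<in> tensor_rels x" if "y' \<in> ideal"
  proof -
    have "y' \<in> ?I" using that by simp
    with z y show ?thesis
      unfolding tensor_rels_def tensor_relations_def left_ideal_simps(3)[of n e y y', symmetric] by blast
  qed
  show "Poly_Mapping.single (std_class n x (c *\<^sub>p z), y) 1 - Poly_Mapping.single (std_class n x z, y) c \<in> tensor_rels x"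
    using z y unfolding tensor_rels_def tensor_relations_def standard_simps(3)[symmetric] by blast
  show "Poly_Mapping.single (std_class n x (lin_comp n z a), y) 1 - Poly_Mapping.single (std_class n x z, lin_comp n a y) 1
      \<in> tensor_rels x" if a: "Poly_Mapping.keys a \<subseteq> FA_aut n"
  proof -
    have "a \<in> carrier (group_algebra n)" using a by simp
    with z y show ?thesis
      unfolding tensor_rels_def tensor_relations_def standard_right_class[OF a, symmetric]
        left_ideal_simps(4)[of n e a y, symmetric] by blast
  qed
qed

lemma tensor_rels_cases:
  assumes "r \<in> tensor_rels x"
  obtains (left) z z' y where "z \<in> cell x" "z' \<in> cell x" "y \<in> ideal"
      "r = Poly_Mapping.single (std_class n x (z + z'), y) 1 - Poly_Mapping.single (std_class n x z, y) 1
        - Poly_Mapping.single (std_class n x z', y) 1"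
    | (right) z y y' where "z \<in> cell x" "y \<in> ideal" "y' \<in> ideal"
      "r = Poly_Mapping.single (std_class n x z, y + y') 1 - Poly_Mapping.single (std_class n x z, y) 1
        - Poly_Mapping.single (std_class n x z, y') 1"
    | (scalar) c z y where "z \<in> cell x" "y \<in> ideal"
      "r = Poly_Mapping.single (std_class n x (c *\<^sub>p z), y) 1 - Poly_Mapping.single (std_class n x z, y) c"
    | (balance) z a y where "z \<in> cell x" "Poly_Mapping.keys a \<subseteq> FA_aut n" "y \<in> ideal"
      "r = Poly_Mapping.single (std_class n x (lin_comp n z a), y) 1
        - Poly_Mapping.single (std_class n x z, lin_comp n a y) 1"
proof -
  let ?C = "carrier (fa_obj (standard n) x)" and ?I = "carrier (left_ideal n e)"
  from assms consider
      (1) u u' y where "u \<in> ?C" "u' \<in> ?C" "y \<in> ?I" "r = Poly_Mapping.single (u \<oplus>\<^bsub>fa_obj (standard n) x\<^esub> u', y) 1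
        - Poly_Mapping.single (u, y) 1 - Poly_Mapping.single (u', y) 1"
    | (2) u y y' where "u \<in> ?C" "y \<in> ?I" "y' \<in> ?I" "r = Poly_Mapping.single (u, y \<oplus>\<^bsub>left_ideal n e\<^esub> y') 1
        - Poly_Mapping.single (u, y) 1 - Poly_Mapping.single (u, y') 1"
    | (3) c u y where "u \<in> ?C" "y \<in> ?I"
        "r = Poly_Mapping.single (c \<odot>\<^bsub>fa_obj (standard n) x\<^esub> u, y) 1 - Poly_Mapping.single (u, y) c"
    | (4) u a y where "u \<in> ?C" "a \<in> carrier (group_algebra n)" "y \<in> ?I"
        "r = Poly_Mapping.single (standard_right n x u a, y) 1 - Poly_Mapping.single (u, a \<odot>\<^bsub>left_ideal n e\<^esub> y) 1"
    unfolding tensor_rels_def tensor_relations_def by blast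
  then show thesis
  proof cases
    case 1
    from 1(1,2) obtain z z' where "z \<in> cell x" "u = std_class n x z" "z' \<in> cell x" "u' = std_class n x z'"
      unfolding standard_simps by blast
    with 1 show thesis using left[of z z' y] by (simp add: standard_simps)
  next
    case 2
    from 2(1) obtain z where "z \<in> cell x" "u = std_class n x z"
      unfolding standard_simps by blast
    with 2 show thesis using right[of z y y'] by simp
  next
    case 3
    from 3(1) obtain z where "z \<in> cell x" "u = std_class n x z"
      unfolding standard_simps by blast
    with 3 show thesis using scalar[of z y c] by (simp add: standard_simps)
  next
    case 4
    from 4(1) obtain z where "z \<in> cell x" "u = std_class n x z"
      unfolding standard_simps by blast
    with 4 show thesis using balance[of z a y] by (simp add: standard_right_class)
  qed
qed

lemma cell_right: "z \<in> cell x \<Longrightarrow> Poly_Mapping.keys a \<subseteq> FA_aut n \<Longrightarrow> lin_comp n z a \<in> cell x"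
  using FA_right_keys by blast

lemma cell_add: "z \<in> cell x \<Longrightarrow> z' \<in> cell x \<Longrightarrow> z + z' \<in> cell x"
  by (simp add: keys_add_subset)

lemma cell_pscale: "z \<in> cell x \<Longrightarrow> c *\<^sub>p z \<in> cell x"
  by (simp add: keys_pscale_subset)

lemma keys_single_pairs:
  "z \<in> cell x \<Longrightarrow> y \<in> ideal \<Longrightarrow> Poly_Mapping.keys (Poly_Mapping.single (std_class n x z, y) (c::'k)) \<subseteq> pairs x"
  by (cases "c = 0") auto

lemma tensor_rels_keys: "tensor_rels x \<subseteq> {r. Poly_Mapping.keys r \<subseteq> pairs x}"
proof
  fix r assume "r \<in> tensor_rels x"
  then have "Poly_Mapping.keys r \<subseteq> pairs x"
  proof (cases rule: tensor_rels_cases)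
    case (left z z' y)
    then show ?thesis
      by (simp only:) (intro keys_diff_subset keys_single_pairs cell_add)
  next
    case (right z y y')
    then show ?thesis
      by (simp only:) (intro keys_diff_subset keys_single_pairs ideal_add)
  next
    case (scalar c z y)
    then show ?thesis
      by (simp only:) (intro keys_diff_subset keys_single_pairs cell_pscale)
  next
    case (balance z a y)
    then show ?thesis
      by (simp only:) (intro keys_diff_subset keys_single_pairs cell_right ideal_mult)
  qed
  then show "r \<in> {r. Poly_Mapping.keys r \<subseteq> pairs x}" by simp
qed

lemma tensor_zero_eq: "tensor_zero x = span_in ground (free_module (pairs x)) (tensor_rels x)"
  by (simp add: tensor_zero_def tensor_null_def tensor_rels_def standard_simps)

lemma tensor_zero:
  "linear_subspace (tensor_zero x)" "tensor_zero x \<subseteq> {r. Poly_Mapping.keys r \<subseteq> pairs x}"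
  "tensor_rels x \<subseteq> tensor_zero x"
  unfolding tensor_zero_eq using span_in_free_module[OF tensor_rels_keys] by blast+

text \<open>Intersecting with the carrier of the free module allows \<open>V\<close> to be any
  subspace of the type.\<close>

lemma tensor_zero_least:
  assumes "linear_subspace V" "tensor_rels x \<subseteq> V"
  shows "tensor_zero x \<subseteq> V"
proof -
  let ?V = "V \<inter> {r. Poly_Mapping.keys r \<subseteq> pairs x}"
  have "linear_subspace ?V"
    using assms(1) by (intro linear_subspaceI) (auto simp: linear_subspaceD keys_add_subset keys_pscale_subset)
  then have "tensor_zero x \<subseteq> ?V"
    unfolding tensor_zero_eq using assms(2) tensor_rels_keys by (intro span_in_least) auto
  then show ?thesis by blast
qed

text \<open>The pure tensor \<open>(z + U) \<otimes> e\<close>: \<open>gen\<close> is its name in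
  the free module, \<open>proj\<close> its class.\<close>

definition gen :: "nat \<Rightarrow> ((nat \<Rightarrow> nat) \<Rightarrow>\<^sub>0 'k) \<Rightarrow> (((nat \<Rightarrow> nat) \<Rightarrow>\<^sub>0 'k) set \<times> ((nat \<Rightarrow> nat) \<Rightarrow>\<^sub>0 'k) \<Rightarrow>\<^sub>0 'k)" where
  "gen x z = Poly_Mapping.single (std_class n x z, e) 1"

definition proj :: "nat \<Rightarrow> ((nat \<Rightarrow> nat) \<Rightarrow>\<^sub>0 'k) \<Rightarrow> (((nat \<Rightarrow> nat) \<Rightarrow>\<^sub>0 'k) set \<times> ((nat \<Rightarrow> nat) \<Rightarrow>\<^sub>0 'k) \<Rightarrow>\<^sub>0 'k) set" where
  "proj x z = pcoset (tensor_zero x) (gen x z)"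

lemma gen_add:
  assumes "z \<in> cell x" "z' \<in> cell x"
  shows "gen x (z + z') - (gen x z + gen x z') \<in> tensor_zero x"
  using subsetD[OF tensor_zero(3) tensor_relsI(1)[OF assms(1) e_in_ideal assms(2)]]
  by (simp only: gen_def diff_diff_eq)

lemma gen_pscale:
  assumes "z \<in> cell x"
  shows "gen x (c *\<^sub>p z) - c *\<^sub>p gen x z \<in> tensor_zero x"
  using subsetD[OF tensor_zero(3) tensor_relsI(3)[OF assms e_in_ideal, of c]]
  by (simp add: gen_def)

text \<open>Balancing gives \<open>u \<otimes> a e = u a \<otimes> e\<close>, so each pure tensor
  can be written with second factor \<open>e\<close>, and such tensors add up to one of the same
  shape.\<close>

lemma gen_surj:
  assumes "Poly_Mapping.keys r \<subseteq> pairs x"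
  shows "\<exists>z\<in>cell x. r - gen x z \<in> tensor_zero x"
  using assms
proof (induction rule: keys_induct)
  case zero
  have "gen x 0 \<in> tensor_zero x"
    using gen_pscale[of 0 x 0] by simp
  then show ?case
    using linear_subspaceD(4)[OF tensor_zero(1)] by (intro bexI[of _ 0]) auto
next
  case (single s c)
  then obtain z a where s: "s = (std_class n x z, lin_comp n a e)" "z \<in> cell x" "Poly_Mapping.keys a \<subseteq> FA_aut n"
    by blast
  let ?z = "lin_comp n z a"
  have z: "?z \<in> cell x" using s cell_right by blast
  have "gen x ?z - Poly_Mapping.single s 1 \<in> tensor_zero x"
    using tensor_relsI(4)[OF s(2) e_in_ideal s(3)] tensor_zero(3) by (auto simp: gen_def s)
  from linear_subspaceD(3)[OF tensor_zero(1) this, of "- c"]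
  have "Poly_Mapping.single s c - c *\<^sub>p gen x ?z \<in> tensor_zero x"
    by (simp add: pscale_diff pscale_minus_left single_uminus)
  from linear_subspaceD(5)[OF tensor_zero(1) this gen_pscale[OF z, of c]]
  have "Poly_Mapping.single s c - gen x (c *\<^sub>p ?z) \<in> tensor_zero x" by simp
  moreover have "c *\<^sub>p ?z \<in> cell x" using z keys_pscale_subset by blast
  ultimately show ?case by blast
next
  case (add a b)
  then obtain z z' where z: "z \<in> cell x" "a - gen x z \<in> tensor_zero x" and z': "z' \<in> cell x" "b - gen x z' \<in> tensor_zero x"
    by blast
  from linear_subspaceD(5)[OF tensor_zero(1) linear_subspaceD(2)[OF tensor_zero(1) z(2) z'(2)] gen_add[OF z(1) z'(1)]]
  have "a + b - gen x (z + z') \<in> tensor_zero x" by (simp add: algebra_simps)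
  moreover have "z + z' \<in> cell x" using z z' keys_add_subset by blast
  ultimately show ?case by blast
qed

lemma standard_irr_simps:
  "carrier (fa_obj (standard_irr n e) x) = proj x ` cell x"
  "z \<in> cell x \<Longrightarrow> z' \<in> cell x \<Longrightarrow> proj x z \<oplus>\<^bsub>fa_obj (standard_irr n e) x\<^esub> proj x z' = proj x (z + z')"
  "z \<in> cell x \<Longrightarrow> c \<odot>\<^bsub>fa_obj (standard_irr n e) x\<^esub> proj x z = proj x (c *\<^sub>p z)"
  "\<zero>\<^bsub>fa_obj (standard_irr n e) x\<^esub> = proj x 0"
proof -
  have obj: "fa_obj (standard_irr n e) x = quot_module (free_module (pairs x)) (tensor_zero x)"
    by (simp add: standard_irr_def fa_tensor_def tensor_def standard_simps flip: tensor_zero_def)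
  note simps = quot_free_module_simps[OF tensor_zero(1)[of x], where S = "pairs x", folded obj]
  show "carrier (fa_obj (standard_irr n e) x) = proj x ` cell x"
  proof
    show "carrier (fa_obj (standard_irr n e) x) \<subseteq> proj x ` cell x"
    proof
      fix u assume "u \<in> carrier (fa_obj (standard_irr n e) x)"
      then obtain r where r: "Poly_Mapping.keys r \<subseteq> pairs x" "u = pcoset (tensor_zero x) r"
        unfolding simps by blast
      from gen_surj[OF r(1)] obtain z where z: "z \<in> cell x" "r - gen x z \<in> tensor_zero x" by blast
      from z(2) have "u = proj x z"
        unfolding r(2) proj_def by (simp only: pcoset_eq_iff[OF tensor_zero(1)])
      with z(1) show "u \<in> proj x ` cell x" by blast
    qed
    show "proj x ` cell x \<subseteq> carrier (fa_obj (standard_irr n e) x)"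
      unfolding simps proj_def gen_def using keys_single_pairs[OF _ e_in_ideal] by blast
  qed
  show "z \<in> cell x \<Longrightarrow> z' \<in> cell x \<Longrightarrow> proj x z \<oplus>\<^bsub>fa_obj (standard_irr n e) x\<^esub> proj x z' = proj x (z + z')"
    unfolding proj_def simps pcoset_eq_iff[OF tensor_zero(1)]
    using linear_subspaceD(4)[OF tensor_zero(1) gen_add] by simp
  show "z \<in> cell x \<Longrightarrow> c \<odot>\<^bsub>fa_obj (standard_irr n e) x\<^esub> proj x z = proj x (c *\<^sub>p z)"
    unfolding proj_def simps pcoset_eq_iff[OF tensor_zero(1)]
    using linear_subspaceD(4)[OF tensor_zero(1) gen_pscale, of z x c] by simp
  have "gen x 0 \<in> tensor_zero x"
    using gen_pscale[of 0 x 0] by simp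
  moreover have "tensor_zero x = pcoset (tensor_zero x) 0"
    by (simp add: pcoset_def)
  ultimately show "\<zero>\<^bsub>fa_obj (standard_irr n e) x\<^esub> = proj x 0"
    unfolding simps proj_def using pcoset_eq_iff[OF tensor_zero(1)[of x], of "gen x 0" 0] by simp
qed

text \<open>Postcomposition commutes with sums, scalars and the right action, so it takes each
  relation to a relation of the same kind.\<close>

lemma tensor_zero_act:
  assumes f: "f \<in> FA_hom x w" and r: "r \<in> tensor_zero x"
  shows "push (\<lambda>(u, y). (fa_act (standard n) x w f u, y)) r \<in> tensor_zero w"
proof -
  let ?h = "\<lambda>(u, y). (fa_act (standard n) x w f u, y)" and ?f = "lin_comp n (Poly_Mapping.single f 1)"
  have "linear_subspace {r. push ?h r \<in> tensor_zero w}"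
    using linear_subspaceD(1-3)[OF tensor_zero(1)] by (intro linear_subspaceI) (auto simp: push_linear)
  moreover have "tensor_rels x \<subseteq> {r. push ?h r \<in> tensor_zero w}"
  proof
    fix r assume "r \<in> tensor_rels x"
    then have "push ?h r \<in> tensor_rels w"
    proof (cases rule: tensor_rels_cases)
      case (left z z' y)
      then have "?f z \<in> cell w" "?f z' \<in> cell w" using FA_act_keys[OF f] by blast+
      from tensor_relsI(1)[OF this(1) left(3) this(2)] left(4) show ?thesis
        by (simp add: push_linear standard_act[OF f] lin_comp_linear_right)
    next
      case (right z y y')
      then have "?f z \<in> cell w" using FA_act_keys[OF f] by blast
      from tensor_relsI(2)[OF this right(2,3)] right(4) show ?thesis
        by (simp add: push_linear standard_act[OF f])
    next
      case (scalar c z y)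
      then have "?f z \<in> cell w" using FA_act_keys[OF f] by blast
      from tensor_relsI(3)[OF this scalar(2), of c] scalar(3) show ?thesis
        by (simp add: push_linear standard_act[OF f] lin_comp_linear_right)
    next
      case (balance z a y)
      then have "?f z \<in> cell w" using FA_act_keys[OF f] by blast
      moreover have "lin_comp n (?f z) a = ?f (lin_comp n z a)"
        using balance(2) FA_aut_hom by (intro lin_comp_assoc) auto
      ultimately show ?thesis
        using tensor_relsI(4)[OF _ balance(3,2), of "?f z" w] balance(4)
        by (simp add: push_linear standard_act[OF f])
    qed
    then show "r \<in> {r. push ?h r \<in> tensor_zero w}" using tensor_zero(3) by blast
  qed
  ultimately show ?thesis using tensor_zero_least r by blast
qed

lemma standard_irr_act:
  assumes f: "f \<in> FA_hom x w"
  shows "fa_act (standard_irr n e) x w f (proj x z) = proj w (lin_comp n (Poly_Mapping.single f 1) z)"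
proof -
  let ?h = "\<lambda>(u, y). (fa_act (standard n) x w f u, y)"
  have "fa_act (standard_irr n e) x w f (proj x z)
      = quot_map (free_module (carrier (fa_obj (standard n) w) \<times> carrier (left_ideal n e))) (tensor_zero w) (push ?h)
        (pcoset (tensor_zero x) (gen x z))"
    by (simp add: standard_irr_def fa_tensor_def proj_def tensor_zero_def)
  also have "\<dots> = pcoset (tensor_zero w) (push ?h (gen x z))"
    by (rule quot_map_pcoset[OF tensor_zero(1) tensor_zero(1)])
      (simp add: tensor_zero_act[OF f] flip: push_linear)
  also have "push ?h (gen x z) = gen w (lin_comp n (Poly_Mapping.single f 1) z)"
    by (simp add: gen_def standard_act[OF f])
  finally show ?thesis by (simp add: proj_def)
qed

lemma proj_epi: "fa_epi (kFA n) (standard_irr n e) proj"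
  by (auto simp: fa_epi_def fa_homs_def linear_maps_def standard_irr_simps standard_irr_act)

text \<open>The multiplication \<open>(z + U) \<otimes> y \<mapsto> z y\<close> is only defined modulo the span of the non-injective maps;
  a representative is chosen to obtain an honest linear map on the free module.\<close>

lemma tensor_zero_gen:
  assumes z: "z \<in> cell x" and "gen x z \<in> tensor_zero x"
  shows "lin_comp n z e \<in> noninjective n x"
proof -
  define F where "F = (\<lambda>(u, y). lin_comp n (SOME w :: (nat \<Rightarrow> nat) \<Rightarrow>\<^sub>0 'k. w \<in> u) y)"
  have F: "F (std_class n x z, y) - lin_comp n z y \<in> noninjective n x"
    if "y \<in> ideal" for z y
  proof -
    have "z \<in> std_class n x z"
      using linear_subspaceD(1)[OF linear_subspace_noninjective] by (simp add: pcoset_def)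
    then have "(SOME w. w \<in> std_class n x z) - z \<in> noninjective n x"
      using someI[of "\<lambda>w. w \<in> std_class n x z" z] by (simp add: pcoset_def)
    from noninjective_right[OF keys_ideal[OF that] this] show ?thesis
      by (simp add: F_def lin_comp_linear_left)
  qed
  define V where "V = {r. lin_ext F r \<in> noninjective n x}"
  note sub = linear_subspaceD[OF linear_subspace_noninjective[of n x]]
  \<comment> \<open>The unprimed terms are values of \<open>F\<close> at chosen representatives, the
    primed ones at the given representatives; the errors stay in the subspace.\<close>
  have combine: "u - v - w \<in> noninjective n x"
    if "u - u' \<in> noninjective n x" "v - v' \<in> noninjective n x" "w - w' \<in> noninjective n x" "u' = v' + w'"
    for u u' v v' w w' :: "(nat \<Rightarrow> nat) \<Rightarrow>\<^sub>0 'k"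
    using sub(5)[OF sub(5)[OF that(1,2)] that(3)] that(4) by (simp add: algebra_simps)
  have combine2: "u - v \<in> noninjective n x"
    if "u - u' \<in> noninjective n x" "v - u' \<in> noninjective n x" for u u' v :: "(nat \<Rightarrow> nat) \<Rightarrow>\<^sub>0 'k"
    using sub(5)[OF that] by simp
  have "linear_subspace V"
    using sub by (intro linear_subspaceI) (auto simp: V_def lin_ext_add lin_ext_pscale)
  moreover have "tensor_rels x \<subseteq> V"
  proof
    fix r assume "r \<in> tensor_rels x"
    then show "r \<in> V"
    proof (cases rule: tensor_rels_cases)
      case (left z z' y)
      then show ?thesis
        unfolding V_def using combine[OF F F F, of y y y "z + z'" z z']
        by (simp add: lin_ext_diff lin_comp_linear_left)
    next
      case (right z y y')
      then show ?thesis
        unfolding V_def using combine[OF F F F, of "y + y'" y y' z z z] ideal_add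
        by (simp add: lin_ext_diff lin_comp_linear_right)
    next
      case (scalar c z y)
      from sub(3)[OF F[OF scalar(2), of z], of c] F[OF scalar(2), of "c *\<^sub>p z"]
      have "F (std_class n x (c *\<^sub>p z), y) - c *\<^sub>p F (std_class n x z, y) \<in> noninjective n x"
        unfolding lin_comp_linear_left pscale_diff by (rule combine2[rotated])
      then show ?thesis
        unfolding V_def scalar(3) by (simp add: lin_ext_diff)
    next
      case (balance z a y)
      have eq: "lin_comp n (lin_comp n z a) y = lin_comp n z (lin_comp n a y)"
        using keys_ideal[OF balance(3)] FA_aut_hom by (intro lin_comp_assoc) auto
      have "F (std_class n x (lin_comp n z a), y) - F (std_class n x z, lin_comp n a y) \<in> noninjective n x"
        by (rule combine2[OF F[OF balance(3), of "lin_comp n z a", unfolded eq] F[OF ideal_mult[OF balance(3,2)]]])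
      then show ?thesis
        unfolding V_def balance(4) by (simp add: lin_ext_diff)
    qed
  qed
  ultimately have "gen x z \<in> V" using tensor_zero_least assms(2) by blast
  then have "F (std_class n x z, e) \<in> noninjective n x"
    by (simp add: V_def gen_def)
  from sub(5)[OF this F[OF e_in_ideal, of z]] show ?thesis by simp
qed

text \<open>One direction is \<open>tensor_zero_gen\<close>; the other is
  \<open>z \<otimes> e = z \<otimes> e e = z e \<otimes> e\<close>, which vanishes when
  \<open>z e\<close> lies in \<open>U\<close>.\<close>

lemma proj_eq_iff:
  assumes z: "z \<in> cell x" and z': "z' \<in> cell x"
  shows "proj x z = proj x z' \<longleftrightarrow> lin_comp n (z - z') e \<in> noninjective n x"
proof -
  note sub = linear_subspaceD[OF tensor_zero(1)[of x]]
  have d: "z - z' \<in> cell x" using z z' keys_diff_subset by blast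
  \<comment> \<open>\<open>gen\<close> is additive only modulo the relations.\<close>
  have "gen x (z - z') - (gen x z - gen x z') \<in> tensor_zero x"
    using sub(4)[OF gen_add[OF d z']] by (simp add: algebra_simps)
  then have "gen x z - gen x z' \<in> tensor_zero x \<longleftrightarrow> gen x (z - z') \<in> tensor_zero x"
    using sub(2)[of "gen x (z - z') - (gen x z - gen x z')" "gen x z - gen x z'"]
      sub(5)[of "gen x (z - z')" "gen x (z - z') - (gen x z - gen x z')"] by auto
  also have "\<dots> \<longleftrightarrow> lin_comp n (z - z') e \<in> noninjective n x"
  proof
    assume *: "lin_comp n (z - z') e \<in> noninjective n x"
    have "gen x (lin_comp n (z - z') e) - gen x (z - z') \<in> tensor_zero x"
      using tensor_relsI(4)[OF d e_in_ideal keys_e] tensor_zero(3) by (auto simp: gen_def e_idem)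
    moreover have "std_class n x (lin_comp n (z - z') e) = std_class n x 0"
      using * by (simp add: pcoset_eq_iff[OF linear_subspace_noninjective])
    then have "gen x (lin_comp n (z - z') e) = gen x 0"
      by (simp add: gen_def)
    moreover have "gen x 0 \<in> tensor_zero x"
      using gen_pscale[of 0 x 0] by simp
    ultimately show "gen x (z - z') \<in> tensor_zero x"
      using sub(5)[of "gen x 0" "gen x 0 - gen x (z - z')"] by simp
  qed (rule tensor_zero_gen[OF d])
  finally show ?thesis by (simp add: proj_def pcoset_eq_iff[OF tensor_zero(1)])
qed

end

section \<open>The sign representation\<close>

lemma antisymmetrizer_kills_noninjective:
  assumes "z \<in> noninjective n x"
  shows "lin_comp n z (antisymmetrizer n) = 0"
proof -
  have "Poly_Mapping.keys z \<subseteq> {f. \<not> inj_on f {1..n}}"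
    using assms by (auto simp: noninjective_eq)
  then show ?thesis
    by (induction rule: keys_induct) (simp_all add: lin_comp_linear_left antisymmetrizer_noninjective)
qed

lemma alternating_pscale: "alternating n v \<Longrightarrow> alternating n (c *\<^sub>p v)"
  by (simp add: alternating_def lin_comp_linear_left mult.commute)

lemma of_int_sign_square: "of_int (sign p) * of_int (sign p) = (1 :: 'k::field_char_0)"
  by (simp add: sign_def)

text \<open>A permutation of \<open>[m]\<close>, extended by fixing \<open>m + 1\<close>, commutes
  with the inclusion and can then be absorbed by the antisymmetrizer on \<open>m + 1\<close>
  points.\<close>

lemma alternating_koszul_generator: "alternating m (koszul_generator m :: _ \<Rightarrow>\<^sub>0 'k::field_char_0)"
  unfolding alternating_def
proof safe
  fix t assume t: "t permutes {1..m}"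
  have t': "t permutes {1..Suc m}"
    using t by (rule permutes_subset) auto
  let ?s = "Poly_Mapping.single (restrict t {1..m}) (1::'k)"
  let ?s' = "Poly_Mapping.single (restrict t {1..Suc m}) (1::'k)"
  let ?\<iota> = "Poly_Mapping.single (FA_id m) (1::'k)"
  have s_keys: "Poly_Mapping.keys ?s \<subseteq> FA_hom m m"
    using FA_aut_hom[OF permutes_FA_aut[OF t]] by simp
  have "compose {1..m} (restrict t {1..Suc m}) (FA_id m) = compose {1..m} (FA_id m) (restrict t {1..m})"
    using permutes_in_image[OF t] by (auto simp: compose_def FA_id_def fun_eq_iff)
  then have swap: "lin_comp m ?\<iota> ?s = lin_comp m ?s' ?\<iota>"
    by (simp add: lin_comp_single_single)
  have "lin_comp m (koszul_generator m) ?s = lin_comp m (antisymmetrizer (Suc m)) (lin_comp m ?\<iota> ?s)"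
    unfolding koszul_generator_def by (rule lin_comp_assoc[OF s_keys])
  also have "\<dots> = lin_comp m (lin_comp (Suc m) (antisymmetrizer (Suc m)) ?s') ?\<iota>"
    unfolding swap by (rule lin_comp_assoc[symmetric]) simp
  also have "\<dots> = of_int (sign t) *\<^sub>p koszul_generator m"
    unfolding antisymmetrizer_right[OF t'] lin_comp_linear_left koszul_generator_def ..
  finally show "lin_comp m (koszul_generator m) ?s = of_int (sign t) *\<^sub>p koszul_generator m" .
qed

text \<open>Phrased by the action on \<open>e\<close> because it is entered by two routes: from an
  isomorphism with \<open>sgn_rep\<close>, and in \<open>regular_no_cover_hom\<close> for an
  arbitrary \<open>L\<close> that turns out to be the sign representation.\<close>

locale sign_idempotent = group_algebra_idempotent n e
  for n :: nat and e :: "(nat \<Rightarrow> nat) \<Rightarrow>\<^sub>0 'k::field_char_0" +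
  assumes e_nonzero: "e \<noteq> 0"
    and sign_left: "\<And>p. p permutes {1..n} \<Longrightarrow>
      lin_comp n (Poly_Mapping.single (restrict p {1..n}) 1) e = of_int (sign p) *\<^sub>p e"
begin

text \<open>The product \<open>lin_comp n (antisymmetrizer n) e\<close> is computed twice: as
  \<open>n!\<close> times \<open>e\<close> by \<open>sign_left\<close>, and as a multiple of the
  antisymmetrizer.\<close>

lemma e_eq_antisymmetrizer: "\<exists>c. c \<noteq> 0 \<and> e = c *\<^sub>p antisymmetrizer n"
proof -
  have "lin_comp n (Poly_Mapping.single (restrict p {1..n}) (of_int (sign p))) e = e" if "p permutes {1..n}" for p
  proof -
    have "lin_comp n (Poly_Mapping.single (restrict p {1..n}) (of_int (sign p))) e
        = of_int (sign p) *\<^sub>p lin_comp n (Poly_Mapping.single (restrict p {1..n}) 1) e"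
      by (simp add: lin_comp_single_left)
    also have "\<dots> = e"
      unfolding sign_left[OF that] by (simp add: of_int_sign_square)
    finally show ?thesis .
  qed
  then have "lin_comp n (antisymmetrizer n) e = (\<Sum>p | p permutes {1..n}. e)"
    unfolding antisymmetrizer_def lin_comp_linear_left by (intro sum.cong) auto
  also have "\<dots> = of_nat (fact n) *\<^sub>p e"
    by (rule poly_mapping_eqI) (simp add: lookup_sum card_permutations)
  finally have *: "lin_comp n (antisymmetrizer n) e = of_nat (fact n) *\<^sub>p e" .
  obtain c where "lin_comp n (antisymmetrizer n) e = c *\<^sub>p antisymmetrizer n"
    using antisymmetrizer_right_multiple[OF keys_e] by blast
  with * have c: "c *\<^sub>p antisymmetrizer n = of_nat (fact n) *\<^sub>p e" by simp
  have "e = (inverse (of_nat (fact n)) * of_nat (fact n)) *\<^sub>p e" by simp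
  also have "\<dots> = inverse (of_nat (fact n)) *\<^sub>p (c *\<^sub>p antisymmetrizer n)"
    unfolding c by (simp only: pscale_simps)
  finally have "e = (inverse (of_nat (fact n)) * c) *\<^sub>p antisymmetrizer n"
    by (simp only: pscale_simps)
  with e_nonzero show ?thesis
    by (intro exI[of _ "inverse (of_nat (fact n)) * c"]) auto
qed

lemma kills_noninjective: "z \<in> noninjective n x \<Longrightarrow> lin_comp n z e = 0"
  using e_eq_antisymmetrizer by (auto simp: lin_comp_linear_right antisymmetrizer_kills_noninjective)

lemma alternating_mult_e: "alternating n (lin_comp n z e)"
  using e_eq_antisymmetrizer
  by (auto simp: lin_comp_linear_right alternating_pscale alternating_lin_comp_antisymmetrizer)

text \<open>Right multiplication by \<open>e\<close> is one scalar on all alternating elements. It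
  must be 1, since \<open>e\<close> is itself alternating, nonzero and idempotent.\<close>

lemma alternating_fixed:
  assumes "alternating n v"
  shows "lin_comp n v e = v"
proof -
  obtain c where c: "c \<noteq> 0" "e = c *\<^sub>p antisymmetrizer n"
    using e_eq_antisymmetrizer by blast
  have scaled: "lin_comp n w e = (c * of_nat (fact n)) *\<^sub>p w" if "alternating n w" for w
    unfolding c(2) lin_comp_linear_right alternating_antisymmetrizer[OF that] by simp
  have "alternating n e"
    using alternating_mult_e[of e] by (simp add: e_idem)
  from scaled[OF this] have "(c * of_nat (fact n)) *\<^sub>p e - 1 *\<^sub>p e = 0"
    by (simp add: e_idem)
  then have "(c * of_nat (fact n) - 1) *\<^sub>p e = 0"
    by (simp only: pscale_add_left pscale_minus_left diff_conv_add_uminus)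
  then have "c * of_nat (fact n) = 1"
    using e_nonzero by (simp only: pscale_eq_0_iff) simp
  with scaled[OF assms] show ?thesis by simp
qed

text \<open>If \<open>z e\<close> lies in the span of the non-injective maps, which \<open>e\<close>
  kills, then \<open>z e = z e e = 0\<close>.\<close>

lemma proj_eq_iff_sign:
  assumes "z \<in> cell x" "z' \<in> cell x"
  shows "proj x z = proj x z' \<longleftrightarrow> lin_comp n z e = lin_comp n z' e"
proof -
  have "lin_comp n (z - z') e = 0" if "lin_comp n (z - z') e \<in> noninjective n x"
    using kills_noninjective[OF that] by (simp add: lin_comp_assoc[OF keys_e_hom] e_idem)
  moreover have "0 \<in> noninjective n x"
    by (rule linear_subspaceD(1)[OF linear_subspace_noninjective])
  ultimately have "lin_comp n (z - z') e \<in> noninjective n x \<longleftrightarrow> lin_comp n (z - z') e = 0"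
    by auto
  then show ?thesis
    unfolding proj_eq_iff[OF assms] by (simp add: lin_comp_linear_left)
qed

lemma kFA_idem_simps:
  "carrier (fa_obj (kFA_idem n e) x) = (\<lambda>z. lin_comp n z e) ` cell x"
  "a \<oplus>\<^bsub>fa_obj (kFA_idem n e) x\<^esub> b = a + b" "c \<odot>\<^bsub>fa_obj (kFA_idem n e) x\<^esub> a = c *\<^sub>p a"
  "fa_act (kFA_idem n e) x w f = lin_comp n (Poly_Mapping.single f 1)"
  by (simp_all add: kFA_idem_def)

text \<open>The map \<open>z \<mapsto> z e\<close> has the same fibres as \<open>proj\<close>, so it
  factors through an injective map, which is onto by definition of \<open>kFA_idem\<close>.\<close>

lemma standard_irr_iso:
  "\<exists>\<psi>\<in>fa_homs (standard_irr n e) (kFA_idem n e).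
    (\<forall>x\<ge>1. \<forall>z\<in>cell x. \<psi> x (proj x z) = lin_comp n z e) \<and>
    (\<forall>x\<ge>1. bij_betw (\<psi> x) (carrier (fa_obj (standard_irr n e) x)) (carrier (fa_obj (kFA_idem n e) x)))"
proof -
  have "(\<lambda>x z. lin_comp n z e) \<in> fa_homs (kFA n) (kFA_idem n e)"
    by (auto simp: fa_homs_def linear_maps_def kFA_idem_simps lin_comp_linear_left lin_comp_assoc[OF keys_e_hom])
  from fa_epi_factor[OF proj_epi this]
  have "\<exists>\<psi>\<in>fa_homs (standard_irr n e) (kFA_idem n e).
      \<forall>x\<ge>1. \<forall>z. Poly_Mapping.keys z \<subseteq> FA_hom n x \<longrightarrow> \<psi> x (proj x z) = lin_comp n z e"
    using proj_eq_iff_sign by simp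
  then obtain \<psi> where \<psi>: "\<psi> \<in> fa_homs (standard_irr n e) (kFA_idem n e)"
      "\<And>x z. x \<ge> 1 \<Longrightarrow> z \<in> cell x \<Longrightarrow> \<psi> x (proj x z) = lin_comp n z e"
    by auto
  have "bij_betw (\<psi> x) (carrier (fa_obj (standard_irr n e) x)) (carrier (fa_obj (kFA_idem n e) x))" if x: "x \<ge> 1" for x
  proof (rule bij_betw_imageI)
    show "inj_on (\<psi> x) (carrier (fa_obj (standard_irr n e) x))"
      unfolding standard_irr_simps
    proof (rule inj_onI, elim imageE)
      fix u u' z z' assume "\<psi> x u = \<psi> x u'" "u = proj x z" "z \<in> cell x" "u' = proj x z'" "z' \<in> cell x"
      then show "u = u'" using \<psi>(2)[OF x] proj_eq_iff_sign by simp
    qed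
    show "\<psi> x ` carrier (fa_obj (standard_irr n e) x) = carrier (fa_obj (kFA_idem n e) x)"
      unfolding standard_irr_simps kFA_idem_simps image_image using \<psi>(2)[OF x] by (intro image_cong) auto
  qed
  with \<psi> show ?thesis by blast
qed

text \<open>Right multiplication by the Koszul generator sends the class of the identity to that of
  the generator. The latter is nonzero because \<open>e\<close> fixes the alternating
  generator.\<close>

lemma nonzero_hom_from_next_standard:
  "\<exists>\<phi>\<in>fa_homs (standard (Suc n)) (standard_irr n e).
    \<not> fa_zero_hom (standard (Suc n)) (standard_irr n e) \<phi>"
proof -
  let ?g = "koszul_generator n :: _ \<Rightarrow>\<^sub>0 'k"
  define S where "S x y = proj x (lin_comp n y ?g)" for x y
  have g_keys: "Poly_Mapping.keys ?g \<subseteq> FA_hom n (Suc n)"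
    using keys_koszul_generator by blast
  have cell: "lin_comp n y ?g \<in> cell x" if "Poly_Mapping.keys y \<subseteq> FA_hom (Suc n) x" for x y
    using FA_hom_keys_lin_comp[OF that g_keys] by simp
  have "S \<in> fa_homs (kFA (Suc n)) (standard_irr n e)"
    using cell by (auto simp: fa_homs_def linear_maps_def S_def standard_irr_simps standard_irr_act
        lin_comp_linear_left lin_comp_assoc[OF g_keys])
  moreover have "S x y = S x y'" if "std_class (Suc n) x y = std_class (Suc n) x y'" for x y y'
  proof -
    have "lin_comp n (y - y') ?g = 0"
      using that antisymmetrizer_kills_noninjective[of "y - y'"]
      by (simp add: pcoset_eq_iff[OF linear_subspace_noninjective] lin_comp_koszul_generator lin_comp_linear_left(5))
    then show ?thesis by (simp add: S_def lin_comp_linear_left)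
  qed
  ultimately obtain \<phi> where \<phi>: "\<phi> \<in> fa_homs (standard (Suc n)) (standard_irr n e)"
      "\<And>x y. x \<ge> 1 \<Longrightarrow> Poly_Mapping.keys y \<subseteq> FA_hom (Suc n) x \<Longrightarrow> \<phi> x (std_class (Suc n) x y) = S x y"
    using fa_epi_factor[OF std_class_epi, of S "Suc n" "standard_irr n e"] by blast
  let ?id = "Poly_Mapping.single (FA_id (Suc n)) (1::'k)"
  have "lin_comp n ?g e \<noteq> lin_comp n 0 e"
    using alternating_fixed[OF alternating_koszul_generator] koszul_generator_nonzero
    by (simp add: lin_comp_linear_left)
  then have "proj (Suc n) ?g \<noteq> proj (Suc n) 0"
    using g_keys by (subst proj_eq_iff_sign) auto
  moreover have "\<phi> (Suc n) (std_class (Suc n) (Suc n) ?id) = proj (Suc n) ?g"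
    using \<phi>(2)[of "Suc n" ?id] lin_comp_id_left[OF g_keys] by (simp add: S_def)
  moreover have "std_class (Suc n) (Suc n) ?id \<in> carrier (fa_obj (standard (Suc n)) (Suc n))"
    by (auto simp: standard_simps)
  ultimately have "\<not> fa_zero_hom (standard (Suc n)) (standard_irr n e) \<phi>"
    unfolding fa_zero_hom_def standard_irr_simps by (metis le_add1 plus_1_eq_Suc)
  with \<phi>(1) show ?thesis by blast
qed

end

section \<open>From representations to idempotents and left ideals\<close>

lemma idempotent_of_group_algebra_idempotent:
  assumes "idempotent_of n L e"
  shows "group_algebra_idempotent n e" "e \<noteq> 0"
  using assms by (auto simp: idempotent_of_def primitive_idempotent_def group_algebra_idempotent_def)

text \<open>The isomorphism with \<open>sgn_rep\<close> is injective, so the sign action on the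
  image of \<open>e\<close> pulls back to \<open>e\<close>.\<close>

lemma idempotent_of_sgn_rep:
  fixes e :: "(nat \<Rightarrow> nat) \<Rightarrow>\<^sub>0 'k::field_char_0"
  assumes e: "idempotent_of n (sgn_rep n) e"
  shows "sign_idempotent n e"
proof -
  interpret group_algebra_idempotent n e
    using e by (rule idempotent_of_group_algebra_idempotent)
  obtain h where h: "h \<in> linear_maps (group_algebra n) (left_ideal n e) (sgn_rep n)"
      "inj_on h (carrier (left_ideal n e))"
    using e by (auto simp: idempotent_of_def module_isomorphic_def bij_betw_def)
  have e_in: "e \<in> carrier (left_ideal n e)" using e_in_ideal by simp
  \<comment> \<open>The coefficient stays general: \<open>c = 1\<close> yields the action of
    \<open>p\<close>, and the identity permutation yields that of a scalar.\<close>
  have act: "h (lin_comp n (Poly_Mapping.single (restrict p {1..n}) c) e) = c * of_int (sign p) * h e"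
    if p: "p permutes {1..n}" for p c
  proof -
    define q where "q = restrict p {1..n}"
    have r: "restrict_id q {1..n} = p"
      using p by (auto simp: q_def restrict_id_def fun_eq_iff permutes_not_in)
    have "Poly_Mapping.single q c \<in> carrier (group_algebra n)"
      using p by (cases "c = 0") (auto simp: q_def)
    then have "h (Poly_Mapping.single q c \<odot>\<^bsub>left_ideal n e\<^esub> e) = Poly_Mapping.single q c \<odot>\<^bsub>sgn_rep n\<^esub> h e"
      using h(1) e_in unfolding linear_maps_def by blast
    then show ?thesis
      unfolding q_def[symmetric] by (cases "c = 0") (simp_all add: sgn_rep_def r)
  qed
  have "lin_comp n (Poly_Mapping.single (restrict p {1..n}) 1) e = of_int (sign p) *\<^sub>p e" if p: "p permutes {1..n}" for p
  proof -
    have id: "restrict id {1..n} = FA_id n" by (simp add: FA_id_def)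
    have "of_int (sign p) *\<^sub>p e = lin_comp n (Poly_Mapping.single (FA_id n) (of_int (sign p))) e"
      by (rule lin_comp_scalar_left[OF keys_e_hom, symmetric])
    moreover have "h (lin_comp n (Poly_Mapping.single (FA_id n) (of_int (sign p))) e) = of_int (sign p) * h e"
      using act[OF permutes_id, of "of_int (sign p)"] by (simp add: id sign_id)
    moreover have "h (lin_comp n (Poly_Mapping.single (restrict p {1..n}) 1) e) = of_int (sign p) * h e"
      using act[OF p, of 1] by simp
    ultimately have eq: "h (lin_comp n (Poly_Mapping.single (restrict p {1..n}) 1) e) = h (of_int (sign p) *\<^sub>p e)"
      by simp
    have "lin_comp n (Poly_Mapping.single (restrict p {1..n}) 1) e \<in> carrier (left_ideal n e)"
      unfolding left_ideal_simps using p by (intro ideal_mult[OF e_in_ideal]) auto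
    moreover have "of_int (sign p) *\<^sub>p e \<in> carrier (left_ideal n e)"
      unfolding left_ideal_simps
      by (rule image_eqI[of _ _ "of_int (sign p) *\<^sub>p e"])
        (simp_all add: lin_comp_linear_left e_idem keys_pscale_subset[OF keys_e])
    ultimately show ?thesis using h(2) eq by (auto dest: inj_onD)
  qed
  then show ?thesis
    using idempotent_of_group_algebra_idempotent[OF e] by (intro sign_idempotent.intro sign_idempotent_axioms.intro) auto
qed

text \<open>Irreducibility of \<open>L\<close> is carried back along the isomorphism and put in
  terms of closure conditions on a set of linear combinations.\<close>

lemma left_ideal_irreducible:
  fixes e :: "(nat \<Rightarrow> nat) \<Rightarrow>\<^sub>0 'k::field_char_0"
  assumes L: "irreducible_module (group_algebra m) L" and e: "idempotent_of m L e"
    and Z: "Z \<subseteq> carrier (left_ideal m e)" "0 \<in> Z" "\<And>y y'. y \<in> Z \<Longrightarrow> y' \<in> Z \<Longrightarrow> y + y' \<in> Z"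
      "\<And>a y. Poly_Mapping.keys a \<subseteq> FA_aut m \<Longrightarrow> y \<in> Z \<Longrightarrow> lin_comp m a y \<in> Z"
  shows "Z = {0} \<or> Z = carrier (left_ideal m e)"
proof -
  interpret group_algebra_idempotent m e
    using e by (rule idempotent_of_group_algebra_idempotent)
  interpret L: left_module "group_algebra m" L
    using L by (simp add: irreducible_module_def)
  obtain h where h: "h \<in> linear_maps (group_algebra m) (left_ideal m e) L"
      "bij_betw h (carrier (left_ideal m e)) (carrier L)"
    using e by (auto simp: idempotent_of_def module_isomorphic_def)
  let ?I = "carrier (left_ideal m e)"
  have h_closed: "y \<in> ?I \<Longrightarrow> h y \<in> carrier L"
    and h_add: "y \<in> ?I \<Longrightarrow> y' \<in> ?I \<Longrightarrow> h (y + y') = h y \<oplus>\<^bsub>L\<^esub> h y'"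
    and h_mult: "Poly_Mapping.keys a \<subseteq> FA_aut m \<Longrightarrow> y \<in> ?I \<Longrightarrow> h (lin_comp m a y) = a \<odot>\<^bsub>L\<^esub> h y" for y y' a
    using h(1) unfolding linear_maps_def by auto
  have zero_in: "0 \<in> ?I" using Z by blast
  have "h 0 \<oplus>\<^bsub>L\<^esub> h 0 = h 0 \<oplus>\<^bsub>L\<^esub> \<zero>\<^bsub>L\<^esub>"
    using h_add[OF zero_in zero_in] h_closed[OF zero_in] by simp
  then have h_zero: "h 0 = \<zero>\<^bsub>L\<^esub>"
    using h_closed[OF zero_in] by (metis L.M.add.l_cancel L.M.zero_closed)
  have minus: "- y \<in> Z" if "y \<in> Z" for y
  proof -
    have "y \<in> ideal" using that Z(1) unfolding left_ideal_simps by blast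
    from keys_ideal[OF this] have "Poly_Mapping.keys y \<subseteq> FA_hom m m"
      using FA_aut_hom by blast
    then have "- y = lin_comp m (Poly_Mapping.single (FA_id m) (- 1)) y"
      by (simp only: lin_comp_scalar_left pscale_minus_one)
    moreover have "Poly_Mapping.keys (Poly_Mapping.single (FA_id m) (- 1 :: 'k)) \<subseteq> FA_aut m" by simp
    ultimately show ?thesis using Z(4) that by metis
  qed
  have "submodule (h ` Z) (group_algebra m) L"
  proof (intro submodule.intro subgroup.intro submodule_axioms.intro)
    show "h ` Z \<subseteq> carrier (add_monoid L)"
      using h_closed Z(1) by auto
    show "\<one>\<^bsub>add_monoid L\<^esub> \<in> h ` Z"
      using h_zero Z(2) by (auto intro!: image_eqI[of _ h 0])
    show "u \<otimes>\<^bsub>add_monoid L\<^esub> v \<in> h ` Z" if "u \<in> h ` Z" "v \<in> h ` Z" for u v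
    proof -
      from that obtain y y' where y: "y \<in> Z" "u = h y" "y' \<in> Z" "v = h y'" by blast
      from imageI[OF Z(3)[OF y(1,3)], of h] show ?thesis
        unfolding h_add[OF subsetD[OF Z(1) y(1)] subsetD[OF Z(1) y(3)]] y by simp
    qed
    show "inv\<^bsub>add_monoid L\<^esub> u \<in> h ` Z" if "u \<in> h ` Z" for u
    proof -
      from that obtain y where y: "y \<in> Z" "u = h y" by blast
      have "h (- y) \<oplus>\<^bsub>L\<^esub> h y = \<zero>\<^bsub>L\<^esub>"
        using h_add[OF subsetD[OF Z(1) minus[OF y(1)]] subsetD[OF Z(1) y(1)]] h_zero by simp
      then have "\<ominus>\<^bsub>L\<^esub> h y = h (- y)"
        using h_closed[OF subsetD[OF Z(1) minus[OF y(1)]]] h_closed[OF subsetD[OF Z(1) y(1)]]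
        by (simp add: L.M.minus_equality)
      then show ?thesis
        using y minus[OF y(1)] unfolding a_inv_def by simp
    qed
    show "a \<odot>\<^bsub>L\<^esub> u \<in> h ` Z" if "a \<in> carrier (group_algebra m)" "u \<in> h ` Z" for a u
    proof -
      from that obtain y where y: "y \<in> Z" "u = h y" by blast
      have a: "Poly_Mapping.keys a \<subseteq> FA_aut m" using that by simp
      show ?thesis
        unfolding y(2) h_mult[OF a subsetD[OF Z(1) y(1)], symmetric] using Z(4)[OF a y(1)] by (rule imageI)
    qed
  qed
  then have "h ` Z = {\<zero>\<^bsub>L\<^esub>} \<or> h ` Z = carrier L"
    using L by (auto simp: irreducible_module_def)
  then have "h ` Z = h ` {0} \<or> h ` Z = h ` ?I"
    using h_zero h(2) by (auto simp: bij_betw_def)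
  moreover have "inj_on h ?I" using h(2) by (simp add: bij_betw_def)
  ultimately show ?thesis
    using Z(1) zero_in by (metis empty_subsetI inj_on_image_eq_iff insert_subset order_refl)
qed

section \<open>Homomorphisms from projective covers\<close>

text \<open>Written with the scalar \<open>- 1\<close> because homomorphisms are defined by sums and
  scalar multiples.\<close>

lemma module_split:
  assumes "module ground M" "u \<in> carrier M" "v \<in> carrier M"
  shows "u = v \<oplus>\<^bsub>M\<^esub> (u \<oplus>\<^bsub>M\<^esub> (- 1) \<odot>\<^bsub>M\<^esub> v)"
proof -
  interpret module ground M by fact
  have c: "(- 1) \<odot>\<^bsub>M\<^esub> v \<in> carrier M"
    using assms(3) by (intro smult_closed) simp_all
  have "v \<oplus>\<^bsub>M\<^esub> (- 1) \<odot>\<^bsub>M\<^esub> v = (1 + - 1) \<odot>\<^bsub>M\<^esub> v"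
    using assms(3) smult_l_distr[of 1 "- 1" v] smult_one[of v] by simp
  also have "\<dots> = \<zero>\<^bsub>M\<^esub>"
    using assms(3) smult_l_null[of v] by simp
  finally have "v \<oplus>\<^bsub>M\<^esub> (u \<oplus>\<^bsub>M\<^esub> (- 1) \<odot>\<^bsub>M\<^esub> v) = u"
    using assms c by (simp add: M.a_lcomm)
  then show ?thesis ..
qed

text \<open>\<open>(m, e)\<close> encodes \<open>\<lambda>\<close>, and \<open>\<phi>\<close> is the map \<open>P \<rightarrow> D\<^sub>q\<close> for \<open>q = r + 1\<close>.\<close>

locale cover_hom = group_algebra_idempotent m e
  for m :: nat and e :: "(nat \<Rightarrow> nat) \<Rightarrow>\<^sub>0 'k::field_char_0" +
  fixes P :: "('k, 'p) fa_functor" and \<pi> and r :: nat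
    and \<phi> :: "nat \<Rightarrow> 'p \<Rightarrow> ((nat \<Rightarrow> nat) \<Rightarrow>\<^sub>0 'k)"
  assumes m_pos: "m \<ge> 1" and P: "fa_module P" and \<pi>: "fa_epi P (standard_irr m e) \<pi>"
    and superfluous: "\<And>U. fa_submodule P U \<Longrightarrow>
      (\<And>x. x \<ge> 1 \<Longrightarrow> set_add (fa_obj P x) (U x) {p \<in> carrier (fa_obj P x). \<pi> x p = \<zero>\<^bsub>fa_obj (standard_irr m e) x\<^esub>}
        = carrier (fa_obj P x)) \<Longrightarrow> x \<ge> 1 \<Longrightarrow> U x = carrier (fa_obj P x)"
    and \<phi>: "\<phi> \<in> fa_homs P (kFA r)"
    and koszul_image: "\<And>x p. x \<ge> 1 \<Longrightarrow> p \<in> carrier (fa_obj P x) \<Longrightarrow>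
      \<exists>y. Poly_Mapping.keys y \<subseteq> FA_hom (Suc r) x \<and> \<phi> x p = lin_comp r y (koszul_generator r)"
    and nonzero: "\<exists>x\<ge>1. \<exists>p\<in>carrier (fa_obj P x). \<phi> x p \<noteq> 0"
begin

lemma P_module: "x \<ge> 1 \<Longrightarrow> module ground (fa_obj P x)"
  using P by (simp add: fa_module_def)

text \<open>Records the values of \<open>\<pi>\<close> and \<open>\<phi>\<close> at \<open>p\<close>
  together. It is a relation because the representative \<open>z\<close> of the class
  \<open>\<pi> x p\<close> is not unique.\<close>

definition lift :: "nat \<Rightarrow> 'p \<Rightarrow> ((nat \<Rightarrow> nat) \<Rightarrow>\<^sub>0 'k) \<Rightarrow> ((nat \<Rightarrow> nat) \<Rightarrow>\<^sub>0 'k) \<Rightarrow> bool" where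
  "lift x p z v \<longleftrightarrow> p \<in> carrier (fa_obj P x) \<and> z \<in> cell x \<and> \<pi> x p = proj x z \<and> \<phi> x p = v"

lemma lift_add:
  assumes x: "x \<ge> 1" and p: "lift x p z v" and p': "lift x p' z' v'"
  shows "lift x (p \<oplus>\<^bsub>fa_obj P x\<^esub> p') (z + z') (v + v')"
proof -
  interpret M: module ground "fa_obj P x" by (rule P_module[OF x])
  have "\<pi> x \<in> linear_maps ground (fa_obj P x) (fa_obj (standard_irr m e) x)"
      "\<phi> x \<in> linear_maps ground (fa_obj P x) (fa_obj (kFA r) x)"
    using \<pi> \<phi> x by (auto simp: fa_epi_def fa_homs_def)
  then have "\<pi> x (p \<oplus>\<^bsub>fa_obj P x\<^esub> p') = \<pi> x p \<oplus>\<^bsub>fa_obj (standard_irr m e) x\<^esub> \<pi> x p'"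
      "\<phi> x (p \<oplus>\<^bsub>fa_obj P x\<^esub> p') = \<phi> x p + \<phi> x p'"
    using p p' by (auto simp: linear_maps_def lift_def)
  then show ?thesis
    using p p' cell_add by (simp add: lift_def standard_irr_simps)
qed

lemma lift_scale:
  assumes x: "x \<ge> 1" and p: "lift x p z v"
  shows "lift x (c \<odot>\<^bsub>fa_obj P x\<^esub> p) (c *\<^sub>p z) (c *\<^sub>p v)"
proof -
  interpret M: module ground "fa_obj P x" by (rule P_module[OF x])
  have "\<pi> x \<in> linear_maps ground (fa_obj P x) (fa_obj (standard_irr m e) x)"
      "\<phi> x \<in> linear_maps ground (fa_obj P x) (fa_obj (kFA r) x)"
    using \<pi> \<phi> x by (auto simp: fa_epi_def fa_homs_def)
  then have "\<pi> x (c \<odot>\<^bsub>fa_obj P x\<^esub> p) = c \<odot>\<^bsub>fa_obj (standard_irr m e) x\<^esub> \<pi> x p"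
      "\<phi> x (c \<odot>\<^bsub>fa_obj P x\<^esub> p) = c *\<^sub>p \<phi> x p"
    using p by (auto simp: linear_maps_def lift_def)
  then show ?thesis
    using p cell_pscale by (simp add: lift_def standard_irr_simps)
qed

lemma lift_act:
  assumes xw: "x \<ge> 1" "w \<ge> 1" and f: "f \<in> FA_hom x w" and p: "lift x p z v"
  shows "lift w (fa_act P x w f p) (lin_comp m (Poly_Mapping.single f 1) z) (lin_comp r (Poly_Mapping.single f 1) v)"
proof -
  have "fa_act P x w f \<in> linear_maps ground (fa_obj P x) (fa_obj P w)"
    using P xw f by (simp add: fa_module_def)
  then have "fa_act P x w f p \<in> carrier (fa_obj P w)"
    using p by (auto simp: linear_maps_def lift_def)
  moreover have "\<pi> w (fa_act P x w f p) = fa_act (standard_irr m e) x w f (\<pi> x p)"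
      "\<phi> w (fa_act P x w f p) = fa_act (kFA r) x w f (\<phi> x p)"
    using \<pi> \<phi> xw f p unfolding fa_epi_def fa_homs_def lift_def by blast+
  moreover have "Poly_Mapping.keys (lin_comp m (Poly_Mapping.single f 1) z) \<subseteq> FA_hom m w"
    using p by (intro FA_act_keys[OF f]) (simp add: lift_def)
  ultimately show ?thesis
    using p by (simp add: lift_def standard_irr_act[OF f])
qed

lemma lift_exists:
  assumes "x \<ge> 1" "p \<in> carrier (fa_obj P x)"
  shows "\<exists>z. lift x p z (\<phi> x p)"
proof -
  have "\<pi> x p \<in> carrier (fa_obj (standard_irr m e) x)"
    using \<pi> assms unfolding fa_epi_def by blast
  with assms show ?thesis
    unfolding standard_irr_simps by (auto simp: lift_def)
qed

lemma lift_zero: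
  assumes "x \<ge> 1"
  shows "lift x \<zero>\<^bsub>fa_obj P x\<^esub> 0 0"
proof -
  interpret M: module ground "fa_obj P x" by (rule P_module[OF assms])
  \<comment> \<open>The representative found here need not be 0; scaling by 0 makes it so.\<close>
  obtain z where "lift x \<zero>\<^bsub>fa_obj P x\<^esub> z (\<phi> x \<zero>\<^bsub>fa_obj P x\<^esub>)"
    using lift_exists[OF assms M.zero_closed] by blast
  from lift_scale[OF assms this, of 0] show ?thesis
    using M.smult_r_null[of 0] by simp
qed

lemma lift_surj:
  assumes "x \<ge> 1" "z \<in> cell x"
  shows "\<exists>p. lift x p z (\<phi> x p)"
proof -
  have "proj x z \<in> \<pi> x ` carrier (fa_obj P x)"
    using \<pi> assms by (simp add: fa_epi_def standard_irr_simps)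
  with assms show ?thesis by (auto simp: lift_def)
qed

text \<open>On \<open>P\<close> only single morphisms act; induction over \<open>y\<close> supplies
  an element that plays the role of \<open>y\<close> applied to \<open>p\<close>.\<close>

lemma lift_lin_comp:
  assumes xw: "x \<ge> 1" "w \<ge> 1" and y: "Poly_Mapping.keys y \<subseteq> FA_hom x w" and p: "lift x p z v"
  shows "\<exists>p'. lift w p' (lin_comp m y z) (lin_comp r y v)"
  using y
proof (induction rule: keys_induct)
  case zero
  then show ?case
    using lift_zero[OF xw(2)] by (auto simp: lin_comp_linear_left)
next
  case (single f c)
  have "lin_comp l (Poly_Mapping.single f c) u = c *\<^sub>p lin_comp l (Poly_Mapping.single f 1) u"
    for l and u :: "(nat \<Rightarrow> nat) \<Rightarrow>\<^sub>0 'k"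
    unfolding lin_comp_single_left by (simp only: pscale_simps mult_1_right)
  then show ?case
    using lift_scale[OF xw(2) lift_act[OF xw single p], of c] by metis
next
  case (add a b)
  then show ?case
    using lift_add[OF xw(2)] unfolding lin_comp_linear_left by blast
qed

definition kernel_part where "kernel_part x = {p \<in> carrier (fa_obj P x). \<phi> x p = 0}"

lemma kernel_part_submodule: "fa_submodule P kernel_part"
  unfolding fa_submodule_def
proof (intro conjI allI impI ballI)
  fix x :: nat assume x: "x \<ge> 1"
  interpret M: module ground "fa_obj P x" by (rule P_module[OF x])
  have k: "p \<in> kernel_part x \<longleftrightarrow> (\<exists>z. lift x p z 0)" for p
    using lift_exists[OF x, of p] by (auto simp: kernel_part_def lift_def)
  show "submodule (kernel_part x) ground (fa_obj P x)"
  proof (rule M.submoduleI)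
    show "kernel_part x \<subseteq> carrier (fa_obj P x)" by (auto simp: kernel_part_def)
    show "\<zero>\<^bsub>fa_obj P x\<^esub> \<in> kernel_part x" using lift_zero[OF x] k by blast
    show "a \<oplus>\<^bsub>fa_obj P x\<^esub> b \<in> kernel_part x" if "a \<in> kernel_part x" "b \<in> kernel_part x" for a b
    proof -
      from that obtain z z' where "lift x a z 0" "lift x b z' 0" unfolding k by blast
      from lift_add[OF x this] show ?thesis unfolding k by auto
    qed
    show scale: "c \<odot>\<^bsub>fa_obj P x\<^esub> a \<in> kernel_part x" if "a \<in> kernel_part x" for c a
    proof -
      from that obtain z where "lift x a z 0" unfolding k by blast
      from lift_scale[OF x this, of c] show ?thesis unfolding k by auto
    qed
    show "\<ominus>\<^bsub>fa_obj P x\<^esub> a \<in> kernel_part x" if "a \<in> kernel_part x" for a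
    proof -
      have a: "a \<in> carrier (fa_obj P x)" using that by (simp add: kernel_part_def)
      have c: "(- 1) \<odot>\<^bsub>fa_obj P x\<^esub> a \<in> carrier (fa_obj P x)"
        using scale[OF that, of "- 1"] by (simp add: kernel_part_def)
      have "a \<oplus>\<^bsub>fa_obj P x\<^esub> (- 1) \<odot>\<^bsub>fa_obj P x\<^esub> a = \<zero>\<^bsub>fa_obj P x\<^esub>"
        using module_split[OF P_module[OF x] M.zero_closed a] c by simp
      then have "\<ominus>\<^bsub>fa_obj P x\<^esub> a = (- 1) \<odot>\<^bsub>fa_obj P x\<^esub> a"
        using a c M.a_comm by (intro M.minus_equality) auto
      then show ?thesis using scale[OF that, of "- 1"] by simp
    qed
  qed
next
  fix x w f assume xw: "(x::nat) \<ge> 1" "(w::nat) \<ge> 1" and f: "f \<in> FA_hom x w"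
  show "fa_act P x w f ` kernel_part x \<subseteq> kernel_part w"
  proof safe
    fix p assume "p \<in> kernel_part x"
    then obtain z where "lift x p z 0"
      using lift_exists[OF xw(1), of p] by (auto simp: kernel_part_def)
    from lift_act[OF xw f this] show "fa_act P x w f p \<in> kernel_part w"
      by (auto simp: kernel_part_def lift_def lin_comp_linear_right)
  qed
qed

lemma not_covered:
  assumes split: "\<And>x p. x \<ge> 1 \<Longrightarrow> p \<in> carrier (fa_obj P x) \<Longrightarrow>
    \<exists>k s z. lift x k z 0 \<and> lift x s 0 (\<phi> x s) \<and> p = k \<oplus>\<^bsub>fa_obj P x\<^esub> s"
  shows False
proof -
  have "set_add (fa_obj P x) (kernel_part x) {p \<in> carrier (fa_obj P x). \<pi> x p = \<zero>\<^bsub>fa_obj (standard_irr m e) x\<^esub>}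
      = carrier (fa_obj P x)" if x: "x \<ge> 1" for x
  proof -
    interpret M: module ground "fa_obj P x" by (rule P_module[OF x])
    show ?thesis
    proof
      show "carrier (fa_obj P x) \<subseteq>
          set_add (fa_obj P x) (kernel_part x) {p \<in> carrier (fa_obj P x). \<pi> x p = \<zero>\<^bsub>fa_obj (standard_irr m e) x\<^esub>}"
      proof
        fix p assume "p \<in> carrier (fa_obj P x)"
        from split[OF x this] obtain k s where "k \<in> kernel_part x"
            "s \<in> {p \<in> carrier (fa_obj P x). \<pi> x p = \<zero>\<^bsub>fa_obj (standard_irr m e) x\<^esub>}" "p = k \<oplus>\<^bsub>fa_obj P x\<^esub> s"
          unfolding lift_def kernel_part_def standard_irr_simps by blast
        then show "p \<in> set_add (fa_obj P x) (kernel_part x) {p \<in> carrier (fa_obj P x). \<pi> x p = \<zero>\<^bsub>fa_obj (standard_irr m e) x\<^esub>}"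
          unfolding set_add_def' by blast
      qed
    qed (auto simp: set_add_def' kernel_part_def)
  qed
  from superfluous[OF kernel_part_submodule this] nonzero show False
    by (force simp: kernel_part_def)
qed

text \<open>The class of the identity generates the target of \<open>\<pi>\<close>. If it had a
  preimage in the kernel of \<open>\<phi>\<close>, that kernel would map onto the target.\<close>

lemma generator_not_in_kernel: "\<not> lift m p (Poly_Mapping.single (FA_id m) 1) 0"
proof
  assume gen: "lift m p (Poly_Mapping.single (FA_id m) 1) 0"
  show False
  proof (rule not_covered)
    fix x p assume x: "(x::nat) \<ge> 1" and p: "p \<in> carrier (fa_obj P x)"
    then obtain z where z: "lift x p z (\<phi> x p)" using lift_exists by blast
    then have z_keys: "Poly_Mapping.keys z \<subseteq> FA_hom m x" by (simp add: lift_def)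
    from lift_lin_comp[OF m_pos x z_keys gen] obtain k where k: "lift x k z 0"
      by (auto simp: lin_comp_id_right[OF z_keys] lin_comp_linear_right)
    \<comment> \<open>\<open>k\<close> lies over the same class as \<open>p\<close>, so the
      difference lies in the kernel of \<open>\<pi>\<close>.\<close>
    let ?s = "p \<oplus>\<^bsub>fa_obj P x\<^esub> (- 1) \<odot>\<^bsub>fa_obj P x\<^esub> k"
    have "lift x ?s (z + (- 1) *\<^sub>p z) (\<phi> x p + (- 1) *\<^sub>p 0)"
      by (rule lift_add[OF x z lift_scale[OF x k]])
    then have s: "lift x ?s 0 (\<phi> x ?s)"
      by (simp add: lift_def pscale_minus_one)
    have "k \<in> carrier (fa_obj P x)" using k by (simp add: lift_def)
    from module_split[OF P_module[OF x] p this] k s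
    show "\<exists>k s z. lift x k z 0 \<and> lift x s 0 (\<phi> x s) \<and> p = k \<oplus>\<^bsub>fa_obj P x\<^esub> s"
      by blast
  qed
qed

lemma bottom_degree:
  assumes "lift (Suc r) p z v"
  shows "\<exists>c. v = c *\<^sub>p koszul_generator r"
proof -
  have "p \<in> carrier (fa_obj P (Suc r))" "\<phi> (Suc r) p = v" using assms by (auto simp: lift_def)
  then obtain y where "Poly_Mapping.keys y \<subseteq> FA_hom (Suc r) (Suc r)" "v = lin_comp r y (koszul_generator r)"
    using koszul_image[of "Suc r" p] by auto
  then show ?thesis using koszul_left_multiple by blast
qed

text \<open>A nonzero value in degree \<open>r + 1\<close> is a multiple of the generator. If the
  kernel of \<open>\<pi>\<close> attained one, its image under \<open>\<phi>\<close> would contain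
  every value of \<open>\<phi>\<close>, and the two kernels would span \<open>P\<close>.\<close>

lemma kernel_of_cover_in_kernel:
  assumes s: "lift (Suc r) s 0 v"
  shows "v = 0"
proof (rule ccontr)
  assume "v \<noteq> 0"
  moreover obtain c where c: "v = c *\<^sub>p koszul_generator r" using bottom_degree[OF s] by blast
  ultimately have "c \<noteq> 0" by auto
  have Suc_pos: "Suc r \<ge> 1" by simp
  from lift_scale[OF Suc_pos s, of "inverse c"] c \<open>c \<noteq> 0\<close>
  have gen: "lift (Suc r) (inverse c \<odot>\<^bsub>fa_obj P (Suc r)\<^esub> s) 0 (koszul_generator r)" by simp
  show False
  proof (rule not_covered)
    fix x p assume x: "(x::nat) \<ge> 1" and p: "p \<in> carrier (fa_obj P x)"
    interpret M: module ground "fa_obj P x" by (rule P_module[OF x])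
    obtain z where z: "lift x p z (\<phi> x p)" using lift_exists[OF x p] by blast
    obtain y where y: "Poly_Mapping.keys y \<subseteq> FA_hom (Suc r) x" "\<phi> x p = lin_comp r y (koszul_generator r)"
      using koszul_image[OF x p] by blast
    from lift_lin_comp[OF Suc_pos x y(1) gen] obtain s' where s': "lift x s' 0 (\<phi> x p)"
      by (auto simp: lin_comp_linear_right y(2))
    \<comment> \<open>\<open>s'\<close> has the same image under \<open>\<phi>\<close> as
      \<open>p\<close>, so the difference lies in the kernel of \<open>\<phi>\<close>.\<close>
    let ?k = "p \<oplus>\<^bsub>fa_obj P x\<^esub> (- 1) \<odot>\<^bsub>fa_obj P x\<^esub> s'"
    have "lift x ?k (z + (- 1) *\<^sub>p 0) (\<phi> x p + (- 1) *\<^sub>p \<phi> x p)"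
      by (rule lift_add[OF x z lift_scale[OF x s']])
    then have k: "lift x ?k z 0"
      by (simp add: pscale_minus_one)
    have s'_in: "s' \<in> carrier (fa_obj P x)" using s' by (simp add: lift_def)
    have "p = s' \<oplus>\<^bsub>fa_obj P x\<^esub> ?k" by (rule module_split[OF P_module[OF x] p s'_in])
    also have "\<dots> = ?k \<oplus>\<^bsub>fa_obj P x\<^esub> s'"
      using k s'_in by (intro M.a_comm) (auto simp: lift_def)
    finally have "p = ?k \<oplus>\<^bsub>fa_obj P x\<^esub> s'" .
    moreover have "lift x s' 0 (\<phi> x s')" using s' by (simp add: lift_def)
    ultimately show "\<exists>k s z. lift x k z 0 \<and> lift x s 0 (\<phi> x s) \<and> p = k \<oplus>\<^bsub>fa_obj P x\<^esub> s"
      using k by blast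
  qed
qed

text \<open>The test map of \<open>injective_support_detect\<close> carries a nonzero value in any
  degree to a nonzero value in degree \<open>r + 1\<close>.\<close>

lemma nonzero_in_bottom_degree: "\<exists>p z v. lift (Suc r) p z v \<and> v \<noteq> 0"
proof -
  obtain x p where x: "x \<ge> 1" and p: "p \<in> carrier (fa_obj P x)" "\<phi> x p \<noteq> 0" using nonzero by blast
  obtain y where y: "Poly_Mapping.keys y \<subseteq> FA_hom (Suc r) x" "\<phi> x p = lin_comp r y (koszul_generator r)"
    using koszul_image[OF x p(1)] by blast
  obtain f where f: "f \<in> FA_hom x (Suc r)" "lin_comp r (Poly_Mapping.single f 1) (\<phi> x p) \<noteq> 0"
    using injective_support_detect[of "\<phi> x p" r x] keys_koszul[OF y(1)] p(2) y(2) by auto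
  obtain z where "lift x p z (\<phi> x p)" using lift_exists[OF x p(1)] by blast
  from lift_act[OF x _ f(1) this] f(2) show ?thesis by fastforce
qed

text \<open>If \<open>m > r + 1\<close>, the target of \<open>\<pi>\<close> vanishes in degree
  \<open>r + 1\<close>, so all of \<open>P\<close> there is in the kernel of \<open>\<pi>\<close>
  and \<open>\<phi>\<close> is zero on it. If \<open>m < r + 1\<close>, then \<open>\<phi>\<close>
  is zero in degree \<open>m\<close>, which \<open>generator_not_in_kernel\<close> forbids.\<close>

lemma degree_eq: "m = Suc r"
proof (rule antisym)
  show "m \<le> Suc r"
  proof (rule ccontr)
    assume "\<not> m \<le> Suc r"
    obtain p z v where p: "lift (Suc r) p z v" "v \<noteq> 0" using nonzero_in_bottom_degree by blast
    then have z: "Poly_Mapping.keys z \<subseteq> FA_hom m (Suc r)" by (simp add: lift_def)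
    have "\<not> inj_on f {1..m}" if "f \<in> FA_hom m (Suc r)" for f
      using card_inj_on_le[of f "{1..m}" "{1..Suc r}"] that \<open>\<not> m \<le> Suc r\<close> by (auto simp: FA_hom_def)
    with z have "z \<in> noninjective m (Suc r)" by (auto simp: noninjective_eq)
    then have "lin_comp m (z - 0) e \<in> noninjective m (Suc r)"
      using noninjective_right[OF keys_e] by simp
    with z have "proj (Suc r) z = proj (Suc r) 0" by (subst proj_eq_iff) auto
    with p(1) have "lift (Suc r) p 0 v" by (simp add: lift_def)
    with kernel_of_cover_in_kernel p(2) show False by blast
  qed
  show "Suc r \<le> m"
  proof (rule ccontr)
    assume "\<not> Suc r \<le> m"
    have "Poly_Mapping.single (FA_id m) 1 \<in> cell m" by simp
    from lift_surj[OF m_pos this] obtain p where p: "lift m p (Poly_Mapping.single (FA_id m) 1) (\<phi> m p)" by blast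
    then have "p \<in> carrier (fa_obj P m)" by (simp add: lift_def)
    from koszul_image[OF m_pos this] obtain y
      where y: "Poly_Mapping.keys y \<subseteq> FA_hom (Suc r) m" "\<phi> m p = lin_comp r y (koszul_generator r)" by blast
    have "\<phi> m p = 0"
      unfolding y(2) using \<open>\<not> Suc r \<le> m\<close> by (intro koszul_low_degree[OF y(1)]) simp
    with p generator_not_in_kernel show False by simp
  qed
qed

text \<open>The classes with a preimage in the kernel of \<open>\<phi>\<close> give a proper
  submodule \<open>Z\<close> of \<open>k G\<^sub>m e\<close>, hence zero. Since
  \<open>\<phi>\<close> takes its values in degree \<open>m\<close> in the sign representation,
  \<open>t - sign t\<close> times \<open>e\<close> lies in \<open>Z\<close>.\<close>

lemma sign_left:
  assumes irreducible: "\<And>Z. Z \<subseteq> ideal \<Longrightarrow> 0 \<in> Z \<Longrightarrow> (\<And>y y'. y \<in> Z \<Longrightarrow> y' \<in> Z \<Longrightarrow> y + y' \<in> Z) \<Longrightarrow>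
      (\<And>a y. Poly_Mapping.keys a \<subseteq> FA_aut m \<Longrightarrow> y \<in> Z \<Longrightarrow> lin_comp m a y \<in> Z) \<Longrightarrow> Z = {0} \<or> Z = ideal"
    and t: "t permutes {1..m}"
  shows "lin_comp m (Poly_Mapping.single (restrict t {1..m}) 1) e = of_int (sign t) *\<^sub>p e"
proof -
  define Z where "Z = {lin_comp m a e | a. Poly_Mapping.keys a \<subseteq> FA_aut m \<and> (\<exists>p. lift m p a 0)}"
  have "Z = {0} \<or> Z = ideal"
  proof (rule irreducible)
    show "Z \<subseteq> ideal" by (auto simp: Z_def)
    show "0 \<in> Z"
      unfolding Z_def using lift_zero[OF m_pos] by (auto intro!: exI[of _ 0] simp: lin_comp_linear_left)
    show "y + y' \<in> Z" if "y \<in> Z" "y' \<in> Z" for y y'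
    proof -
      from that obtain a a' p p' where a: "y = lin_comp m a e" "Poly_Mapping.keys a \<subseteq> FA_aut m" "lift m p a 0"
          and a': "y' = lin_comp m a' e" "Poly_Mapping.keys a' \<subseteq> FA_aut m" "lift m p' a' 0"
        unfolding Z_def by blast
      have "lift m (p \<oplus>\<^bsub>fa_obj P m\<^esub> p') (a + a') 0"
        using lift_add[OF m_pos a(3) a'(3)] by simp
      with keys_add_subset[OF a(2) a'(2)] show ?thesis
        unfolding Z_def a(1) a'(1) lin_comp_linear_left(1)[symmetric] by blast
    qed
    show "lin_comp m b y \<in> Z" if b: "Poly_Mapping.keys b \<subseteq> FA_aut m" and "y \<in> Z" for b y
    proof -
      from \<open>y \<in> Z\<close> obtain a p where a: "y = lin_comp m a e" "Poly_Mapping.keys a \<subseteq> FA_aut m" "lift m p a 0"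
        unfolding Z_def by blast
      have "Poly_Mapping.keys b \<subseteq> FA_hom m m" using b FA_aut_hom by blast
      from lift_lin_comp[OF m_pos m_pos this a(3)] have "\<exists>p. lift m p (lin_comp m b a) 0"
        by (simp add: lin_comp_linear_right)
      with FA_aut_keys_lin_comp[OF b a(2)] show ?thesis
        unfolding Z_def a(1) lin_comp_assoc[OF keys_e_hom, symmetric] by blast
    qed
  qed
  moreover have "Z \<noteq> ideal"
  proof
    assume "Z = ideal"
    with e_in_ideal have "e \<in> Z" by simp
    then obtain a p where a: "e = lin_comp m a e" "lift m p a 0" unfolding Z_def by blast
    let ?id = "Poly_Mapping.single (FA_id m) (1::'k)"
    \<comment> \<open>Equal products with \<open>e\<close> give equal classes, so \<open>a\<close>
      may be replaced by the identity.\<close>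
    have "lin_comp m (a - ?id) e = 0"
      using a(1) lin_comp_id_left[OF keys_e_hom] by (simp add: lin_comp_linear_left)
    then have "lin_comp m (a - ?id) e \<in> noninjective m m"
      using linear_subspaceD(1)[OF linear_subspace_noninjective] by simp
    moreover have "a \<in> cell m" using a(2) by (simp add: lift_def)
    ultimately have "proj m a = proj m ?id"
      by (subst proj_eq_iff) simp_all
    with a(2) have "lift m p ?id 0" by (simp add: lift_def)
    with generator_not_in_kernel show False by blast
  qed
  ultimately have Z: "Z = {0}" by blast
  let ?id = "Poly_Mapping.single (FA_id m) (1::'k)" and ?t = "Poly_Mapping.single (restrict t {1..m}) (1::'k)"
  have "?id \<in> cell m" by simp
  from lift_surj[OF m_pos this] obtain p where p: "lift m p ?id (\<phi> m p)" by blast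
  obtain c where c: "\<phi> m p = c *\<^sub>p koszul_generator r"
    using p bottom_degree[of p ?id "\<phi> m p"] degree_eq by auto
  have t_hom: "restrict t {1..m} \<in> FA_hom m m" using t FA_aut_hom by blast
  have "lin_comp r ?t (koszul_generator r) = of_int (sign t) *\<^sub>p koszul_generator r"
    using koszul_left_sign[of t r] t by (simp add: degree_eq)
  then have t_sign: "lin_comp r ?t (\<phi> m p) = of_int (sign t) *\<^sub>p \<phi> m p"
    unfolding c lin_comp_linear_right by (simp add: mult.commute)
  have "lin_comp m ?t ?id = ?t"
    using t_hom by (intro lin_comp_id_right[of _ m m]) simp
  with lift_act[OF m_pos m_pos t_hom p] t_sign
  have "lift m (fa_act P m m (restrict t {1..m}) p) ?t (of_int (sign t) *\<^sub>p \<phi> m p)" by simp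
  from lift_add[OF m_pos this lift_scale[OF m_pos p, of "- of_int (sign t)"]]
  have "\<exists>p'. lift m p' (?t + (- of_int (sign t)) *\<^sub>p ?id) 0"
    unfolding pscale_minus_left by auto
  moreover have "Poly_Mapping.keys (?t + (- of_int (sign t)) *\<^sub>p ?id) \<subseteq> FA_aut m"
    using t by (intro keys_add_subset keys_pscale_subset) auto
  ultimately have "lin_comp m (?t + (- of_int (sign t)) *\<^sub>p ?id) e \<in> Z"
    unfolding Z_def by blast
  then have "lin_comp m ?t e + (- of_int (sign t)) *\<^sub>p e = 0"
    unfolding Z lin_comp_linear_left lin_comp_id_left[OF keys_e_hom] by blast
  then show ?thesis
    unfolding pscale_minus_left by (simp add: add_eq_0_iff)
qed

end

text \<open>Such a homomorphism would make \<open>e\<close> an idempotent of the sign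
  representation, and then \<open>nonzero_hom_from_next_standard\<close> would make \<open>L\<close>
  singular.\<close>

lemma regular_no_cover_hom:
  fixes L :: "((nat \<Rightarrow> nat) \<Rightarrow>\<^sub>0 'k::field_char_0, 'l) module" and P :: "('k, 'p) fa_functor"
  assumes L: "irreducible_module (group_algebra m) L" "regular_rep m L" "idempotent_of m L e"
  shows "\<not> cover_hom m e P \<pi> r \<phi>"
proof
  assume "cover_hom m e P \<pi> r \<phi>"
  then interpret cover_hom m e P \<pi> r \<phi> .
  interpret sign_idempotent m e
  proof
    show "e \<noteq> 0" by (rule idempotent_of_group_algebra_idempotent(2)[OF L(3)])
    show "lin_comp m (Poly_Mapping.single (restrict p {1..m}) 1) e = of_int (sign p) *\<^sub>p e" if "p permutes {1..m}" for p
      using left_ideal_irreducible[OF L(1,3)] that by (intro sign_left) simp_all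
  qed
  obtain \<psi> where "\<psi> \<in> fa_homs (standard (m + 1)) (standard_irr m e)"
      "\<not> fa_zero_hom (standard (m + 1)) (standard_irr m e) \<psi>"
    using nonzero_hom_from_next_standard unfolding Suc_eq_plus1 by blast
  with L(3) have "singular_rep m L"
    unfolding singular_rep_def by blast
  with L(2) show False by (simp add: regular_rep_def)
qed

lemma cover_homI:
  assumes "m \<ge> 1" and e: "group_algebra_idempotent m e" and cover: "fa_projective_cover P \<pi> (standard_irr m e)"
    and "\<phi> \<in> fa_homs P (kFA r)"
    and "\<And>x p. x \<ge> 1 \<Longrightarrow> p \<in> carrier (fa_obj P x) \<Longrightarrow>
      \<exists>y. Poly_Mapping.keys y \<subseteq> FA_hom (Suc r) x \<and> \<phi> x p = lin_comp r y (koszul_generator r)"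
    and "x \<ge> 1" "p \<in> carrier (fa_obj P x)" "\<phi> x p \<noteq> 0"
  shows "cover_hom m e P \<pi> r \<phi>"
proof (intro cover_hom.intro cover_hom_axioms.intro e)
  show "fa_module P" "fa_epi P (standard_irr m e) \<pi>"
    using cover by (simp_all add: fa_projective_cover_def fa_projective_def)
  show "U x = carrier (fa_obj P x)" if "fa_submodule P U"
      "\<And>x. x \<ge> 1 \<Longrightarrow> set_add (fa_obj P x) (U x) {p \<in> carrier (fa_obj P x). \<pi> x p = \<zero>\<^bsub>fa_obj (standard_irr m e) x\<^esub>}
        = carrier (fa_obj P x)" "x \<ge> 1" for U x
    using cover that unfolding fa_projective_cover_def by blast
  show "\<exists>x\<ge>1. \<exists>p\<in>carrier (fa_obj P x). \<phi> x p \<noteq> 0"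
    using assms(6-8) by blast
qed (use assms in auto)

section \<open>Vanishing by exactness of the Koszul complex\<close>

lemma fa_homs_compose:
  assumes "\<phi> \<in> fa_homs U V" "\<psi> \<in> fa_homs V W"
  shows "(\<lambda>x p. \<psi> x (\<phi> x p)) \<in> fa_homs U W"
  using assms by (simp add: fa_homs_def linear_maps_def Pi_iff)

lemma kFA_precompose:
  assumes "Poly_Mapping.keys a \<subseteq> FA_hom r n"
  shows "(\<lambda>x z. lin_comp r z a) \<in> fa_homs (kFA n) (kFA r)"
  using FA_hom_keys_lin_comp[OF _ assms]
  by (simp add: fa_homs_def linear_maps_def lin_comp_linear_left lin_comp_assoc[OF assms])

context sign_idempotent
begin

lemma kFA_idem_inclusion: "(\<lambda>x z. z) \<in> fa_homs (kFA_idem n e) (kFA n)"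
  using FA_right_keys[OF keys_e] by (simp add: fa_homs_def linear_maps_def kFA_idem_simps Pi_iff)

text \<open>\<open>regular_no_cover_hom\<close> is applied twice: first to \<open>\<phi>2\<close>,
  the composite with the differential, and after exactness to \<open>\<phi>1\<close> itself.\<close>

lemma no_hom_from_regular_cover:
  fixes L :: "((nat \<Rightarrow> nat) \<Rightarrow>\<^sub>0 'k, 'l) module" and P :: "('k, 'p) fa_functor"
  assumes n: "n \<ge> 1" and m: "m \<ge> 1"
    and L: "irreducible_module (group_algebra m) L" "regular_rep m L" "idempotent_of m L e'"
    and cover: "fa_projective_cover P \<pi> (standard_irr m e')"
    and \<phi>: "\<phi> \<in> fa_homs P (standard_irr n e)"
  shows "fa_zero_hom P (standard_irr n e) \<phi>"
proof -
  note no_cover_hom = regular_no_cover_hom[OF L, of P \<pi>]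
  note e' = idempotent_of_group_algebra_idempotent(1)[OF L(3)]
  obtain \<psi> where \<psi>: "\<psi> \<in> fa_homs (standard_irr n e) (kFA_idem n e)"
      "\<And>x z. x \<ge> 1 \<Longrightarrow> z \<in> cell x \<Longrightarrow> \<psi> x (proj x z) = lin_comp n z e"
    using standard_irr_iso by blast
  obtain c where c: "e = c *\<^sub>p antisymmetrizer n" using e_eq_antisymmetrizer by blast
  define \<phi>1 where "\<phi>1 x p = \<psi> x (\<phi> x p)" for x p
  have rep: "\<exists>z\<in>cell x. \<phi> x p = proj x z \<and> \<phi>1 x p = lin_comp n z e"
    if x: "x \<ge> 1" and p: "p \<in> carrier (fa_obj P x)" for x p
  proof -
    have "\<phi> x p \<in> proj x ` cell x"
      using \<phi> x p unfolding fa_homs_def linear_maps_def standard_irr_simps(1) by blast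
    then show ?thesis using \<psi>(2)[OF x] by (auto simp: \<phi>1_def)
  qed
  have \<phi>1_keys: "Poly_Mapping.keys (\<phi>1 x p) \<subseteq> FA_hom n x" if x: "x \<ge> 1" and p: "p \<in> carrier (fa_obj P x)" for x p
  proof -
    obtain z where z: "z \<in> cell x" "\<phi>1 x p = lin_comp n z e" using rep[OF x p] by blast
    show ?thesis unfolding z(2) using z(1) by (intro FA_right_keys[OF keys_e]) simp
  qed
  have \<phi>1: "\<phi>1 \<in> fa_homs P (kFA n)"
    unfolding \<phi>1_def using fa_homs_compose[OF fa_homs_compose[OF \<phi> \<psi>(1)] kFA_idem_inclusion] .
  \<comment> \<open>For \<open>n = 1\<close> the target \<open>kFA r\<close> is the constant functor
    spanned by the empty map, the augmentation of the complex.\<close>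
  obtain r where r: "n = Suc r" using n by (cases n) auto
  let ?\<iota> = "Poly_Mapping.single (FA_id r) (1::'k)"
  have \<iota>_keys: "Poly_Mapping.keys ?\<iota> \<subseteq> FA_hom r n" by (simp add: r)
  define \<phi>2 where "\<phi>2 x p = lin_comp r (\<phi>1 x p) ?\<iota>" for x p
  have \<phi>2: "\<phi>2 \<in> fa_homs P (kFA r)"
    unfolding \<phi>2_def by (rule fa_homs_compose[OF \<phi>1 kFA_precompose[OF \<iota>_keys]])
  have \<phi>2_image: "\<exists>y. Poly_Mapping.keys y \<subseteq> FA_hom (Suc r) x \<and> \<phi>2 x p = lin_comp r y (koszul_generator r)"
    if x: "x \<ge> 1" and p: "p \<in> carrier (fa_obj P x)" for x p
  proof -
    obtain z where z: "z \<in> cell x" "\<phi>1 x p = lin_comp n z e" using rep[OF x p] by blast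
    \<comment> \<open>The factor \<open>c\<close> comes from
      \<open>e = c *\<^sub>p antisymmetrizer n\<close>.\<close>
    have "\<phi>2 x p = lin_comp r (c *\<^sub>p z) (koszul_generator r)"
      by (simp add: \<phi>2_def z(2) c lin_comp_koszul_generator lin_comp_linear_left lin_comp_linear_right flip: r)
    with z(1) keys_pscale_subset show ?thesis unfolding r by blast
  qed
  have \<phi>2_zero: "\<phi>2 x p = 0" if "x \<ge> 1" "p \<in> carrier (fa_obj P x)" for x p
    using cover_homI[OF m e' cover \<phi>2 \<phi>2_image that] no_cover_hom by blast
  have \<phi>1_image: "\<exists>y. Poly_Mapping.keys y \<subseteq> FA_hom (Suc n) x \<and> \<phi>1 x p = lin_comp n y (koszul_generator n)"
    if x: "x \<ge> 1" and p: "p \<in> carrier (fa_obj P x)" for x p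
  proof -
    have "alternating n (\<phi>1 x p)" using rep[OF x p] alternating_mult_e by auto
    moreover have "lin_comp (n - 1) (\<phi>1 x p) (Poly_Mapping.single (FA_id (n - 1)) 1) = 0"
      using \<phi>2_zero[OF x p] by (simp add: \<phi>2_def r)
    ultimately show ?thesis
      by (rule koszul_exact[OF \<phi>1_keys[OF x p] x n])
  qed
  have \<phi>1_zero: "\<phi>1 x p = 0" if "x \<ge> 1" "p \<in> carrier (fa_obj P x)" for x p
    using cover_homI[OF m e' cover \<phi>1 \<phi>1_image that] no_cover_hom by blast
  show ?thesis
    unfolding fa_zero_hom_def
  proof (intro allI impI ballI)
    fix x p assume x: "(x::nat) \<ge> 1" and p: "p \<in> carrier (fa_obj P x)"
    obtain z where z: "z \<in> cell x" "\<phi> x p = proj x z" "\<phi>1 x p = lin_comp n z e" using rep[OF x p] by blast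
    have "proj x z = proj x 0"
      using z(1,3) \<phi>1_zero[OF x p] by (subst proj_eq_iff_sign) (simp_all add: lin_comp_linear_left)
    with z(2) show "\<phi> x p = \<zero>\<^bsub>fa_obj (standard_irr n e) x\<^esub>"
      by (simp add: standard_irr_simps)
  qed
qed

end

theorem proposition6p7:
  fixes n :: nat
    and e_sgn :: "(nat \<Rightarrow> nat) \<Rightarrow>\<^sub>0 'k::field_char_0"
  assumes "n \<ge> 1"
    and "idempotent_of n (sgn_rep n) e_sgn"
  shows "fa_isomorphic (standard_irr n e_sgn) (kFA_idem n e_sgn) \<and>
    (\<forall>(m :: nat) (L :: ((nat \<Rightarrow> nat) \<Rightarrow>\<^sub>0 'k, 'l) module) e
       (P :: ('k, 'p) fa_functor) \<pi>.
      m \<ge> 1 \<and> irreducible_module (group_algebra m) L \<and> regular_rep m L \<and>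
      idempotent_of m L e \<and> fa_projective_cover P \<pi> (standard_irr m e) \<longrightarrow>
      (\<forall>\<phi>\<in>fa_homs P (standard_irr n e_sgn). fa_zero_hom P (standard_irr n e_sgn) \<phi>))"
proof -
  interpret sign_idempotent n e_sgn
    using assms(2) by (rule idempotent_of_sgn_rep)
  show ?thesis
  proof (intro conjI allI impI ballI, goal_cases)
    case 1
    show ?case
      using standard_irr_iso unfolding fa_isomorphic_def by blast
  next
    case (2 m L e P \<pi> \<phi>)
    then show ?case
      using no_hom_from_regular_cover[OF assms(1), of m L e P \<pi> \<phi>] by blast
  qed
qed

end
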